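(* Let $\delta\ge0$, $\alpha\in\mathbb R$, $x\ge0$ and let $\hat X$ be the squared radial Ornstein–Uhlenbeck process, i.e. the unique solution of $$\hat X_t=x+2\int_0^t\sqrt{\hat X_s}\,dB_s+\int_0^t(\delta-2\alpha\hat X_s)\,ds .$$ Then, for $\lambda\ge0$, $\gamma>0$ and $t\ge0$, $$\mathbb E e^{-\lambda\hat X_t-\gamma\int_0^t\hat X_udu}=e^{-x\phi(t,\lambda)-\psi(t,\lambda)},$$ where $$\phi(t,\lambda)=a+\frac{(\lambda-a)(2a+\alpha)}{e^{2t(\alpha+2a)}(a+\alpha+\lambda)+a-\lambda},\qquad a=\frac{\sqrt{\alpha^2+2\gamma}-\alpha}{2},$$ $$\psi(t,\lambda)=\delta at-\frac{\delta}{2}\ln\Big|1+\frac{(\lambda-a)(1-e^{2t(\alpha+2a)})}{e^{2t(\alpha+2a)}(a+\lambda+\alpha)+a-\lambda}\Big|.$$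
   Context: $B$ is a standard Brownian motion. *)

theory Defs
  imports "HOL-Probability.Probability"
begin

section \<open>Brownian motion on a filtered probability space\<close>

text \<open>
  Time is modelled by the type of real numbers, but only times in the half-line from 0 on are
  relevant; the values of processes (and of the filtration) at negative times play no role.
  The filtration is not required to be complete or right-continuous.
\<close>

locale filtered_prob_space = prob_space M + filtration "space M" F
  for M :: "'a measure" and F :: "real \<Rightarrow> 'a measure" +
  assumes sets_F_subset: "sets (F t) \<subseteq> sets M"

locale brownian_motion = filtered_prob_space M F
  for M :: "'a measure" and F :: "real \<Rightarrow> 'a measure" +
  fixes B :: "real \<Rightarrow> 'a \<Rightarrow> real"
  assumes BM_adapted: "0 \<le> t \<Longrightarrow> B t \<in> borel_measurable (F t)"
    and BM_zero: "AE \<omega> in M. B 0 \<omega> = 0"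
    and BM_continuous: "AE \<omega> in M. continuous_on {0..} (\<lambda>t. B t \<omega>)"
    and BM_normal: "0 \<le> s \<Longrightarrow> s < t \<Longrightarrow>
      distributed M lborel (\<lambda>\<omega>. B t \<omega> - B s \<omega>) (normal_density 0 (sqrt (t - s)))"
    and BM_indep: "0 \<le> s \<Longrightarrow> s < t \<Longrightarrow>
      indep_set (sets (F s)) {(\<lambda>\<omega>. B t \<omega> - B s \<omega>) -` A \<inter> space M | A. A \<in> sets borel}"

section \<open>The stochastic integral\<close>

text \<open>
  Measurability is part of the definition because the measure of a non-measurable set is 0
  by convention, which would make the convergence requirement void.
\<close>

definition tendsto_in_probability ::
  "'a measure \<Rightarrow> (nat \<Rightarrow> 'a \<Rightarrow> real) \<Rightarrow> ('a \<Rightarrow> real) \<Rightarrow> bool" where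
  "tendsto_in_probability M Y Z \<longleftrightarrow>
     (\<forall>k. Y k \<in> borel_measurable M) \<and> Z \<in> borel_measurable M \<and>
     (\<forall>\<epsilon>>0. (\<lambda>k. measure M {\<omega> \<in> space M. \<bar>Y k \<omega> - Z \<omega>\<bar> > \<epsilon>}) \<longlonglongrightarrow> 0)"

text \<open>
  The data \<open>n, \<tau>, \<xi>\<close> describe the simple predictable process that equals
  \<open>\<xi> i\<close> on \<open>(\<tau> i, \<tau> (i + 1)]\<close> for \<open>i < n\<close> and 0 elsewhere, each
  coefficient being bounded and known at the left end point.
\<close>

definition simple_integrand ::
  "'a measure \<Rightarrow> (real \<Rightarrow> 'a measure) \<Rightarrow> nat \<Rightarrow> (nat \<Rightarrow> real) \<Rightarrow> (nat \<Rightarrow> 'a \<Rightarrow> real) \<Rightarrow> bool" where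
  "simple_integrand M F n \<tau> \<xi> \<longleftrightarrow>
     0 \<le> \<tau> 0 \<and> (\<forall>i<n. \<tau> i < \<tau> (Suc i)) \<and>
     (\<forall>i<n. \<xi> i \<in> borel_measurable (F (\<tau> i)) \<and> (\<exists>C. \<forall>\<omega>\<in>space M. \<bar>\<xi> i \<omega>\<bar> \<le> C))"

definition simple_process ::
  "nat \<Rightarrow> (nat \<Rightarrow> real) \<Rightarrow> (nat \<Rightarrow> 'a \<Rightarrow> real) \<Rightarrow> real \<Rightarrow> 'a \<Rightarrow> real" where
  "simple_process n \<tau> \<xi> t \<omega> = (\<Sum>i<n. \<xi> i \<omega> * indicator {\<tau> i<..\<tau> (Suc i)} t)"

definition simple_integral ::
  "(real \<Rightarrow> 'a \<Rightarrow> real) \<Rightarrow> nat \<Rightarrow> (nat \<Rightarrow> real) \<Rightarrow> (nat \<Rightarrow> 'a \<Rightarrow> real) \<Rightarrow> real \<Rightarrow> 'a \<Rightarrow> real" where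
  "simple_integral B n \<tau> \<xi> t \<omega> =
     (\<Sum>i<n. \<xi> i \<omega> * (B (min (\<tau> (Suc i)) t) \<omega> - B (min (\<tau> i) t) \<omega>))"

text \<open>
  Progressively measurable processes that are almost surely locally square integrable in time.
\<close>

definition ito_integrand ::
  "'a measure \<Rightarrow> (real \<Rightarrow> 'a measure) \<Rightarrow> (real \<Rightarrow> 'a \<Rightarrow> real) \<Rightarrow> bool" where
  "ito_integrand M F H \<longleftrightarrow>
     (\<forall>t\<ge>0. (\<lambda>(s, \<omega>). H s \<omega>) \<in> borel_measurable (restrict_space borel {0..t} \<Otimes>\<^sub>M F t)) \<and>
     (\<forall>t\<ge>0. AE \<omega> in M. set_integrable lborel {0..t} (\<lambda>s. (H s \<omega>)\<^sup>2))"

text \<open>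
  \<open>is_ito_integral M F B H I\<close>: the process \<open>I\<close> is (a version, continuous in \<open>t\<close>, of) the
  integral of \<open>H\<close> against \<open>B\<close> over \<open>[0, t]\<close>, that is, the limit in probability of the
  elementary integrals of simple processes that approximate \<open>H\<close> in the sense that
  \<open>\<integral>\<^sub>0\<^sup>t (H\<^sup>k - H)\<^sup>2 ds \<rightarrow> 0\<close> in probability.  The limit does not depend on the approximating
  sequence, so this determines \<open>I\<close> up to indistinguishability.
\<close>

definition is_ito_integral ::
  "'a measure \<Rightarrow> (real \<Rightarrow> 'a measure) \<Rightarrow> (real \<Rightarrow> 'a \<Rightarrow> real) \<Rightarrow>
   (real \<Rightarrow> 'a \<Rightarrow> real) \<Rightarrow> (real \<Rightarrow> 'a \<Rightarrow> real) \<Rightarrow> bool" where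
  "is_ito_integral M F B H I \<longleftrightarrow>
     ito_integrand M F H \<and>
     (AE \<omega> in M. continuous_on {0..} (\<lambda>t. I t \<omega>)) \<and>
     (\<exists>n \<tau> \<xi>.
        (\<forall>k. simple_integrand M F (n k) (\<tau> k) (\<xi> k)) \<and>
        (\<forall>t\<ge>0. tendsto_in_probability M
           (\<lambda>k \<omega>. LBINT s:{0..t}. (simple_process (n k) (\<tau> k) (\<xi> k) s \<omega> - H s \<omega>)\<^sup>2) (\<lambda>\<omega>. 0)) \<and>
        (\<forall>t\<ge>0. tendsto_in_probability M
           (\<lambda>k. simple_integral B (n k) (\<tau> k) (\<xi> k) t) (I t)))"

section \<open>The squared radial Ornstein--Uhlenbeck process\<close>

text \<open>
  Almost sure nonnegativity is implicit in the use of the square root (the library function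
  \<open>sqrt\<close> is odd, hence also defined for negative arguments).  All paths of \<open>X\<close> are required to
  be continuous, so that the time integral of \<open>X\<close> is a random variable even if the probability
  space is not complete.
\<close>

definition squared_radial_OU ::
  "'a measure \<Rightarrow> (real \<Rightarrow> 'a measure) \<Rightarrow> (real \<Rightarrow> 'a \<Rightarrow> real) \<Rightarrow>
   real \<Rightarrow> real \<Rightarrow> real \<Rightarrow> (real \<Rightarrow> 'a \<Rightarrow> real) \<Rightarrow> bool" where
  "squared_radial_OU M F B \<delta> \<alpha> x X \<longleftrightarrow>
     (\<forall>t\<ge>0. X t \<in> borel_measurable (F t)) \<and>
     (\<forall>\<omega>\<in>space M. continuous_on {0..} (\<lambda>t. X t \<omega>)) \<and>
     (AE \<omega> in M. \<forall>t\<ge>0. 0 \<le> X t \<omega>) \<and>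
     (\<exists>I. is_ito_integral M F B (\<lambda>s \<omega>. sqrt (X s \<omega>)) I \<and>
        (AE \<omega> in M. \<forall>t\<ge>0.
           X t \<omega> = x + 2 * I t \<omega> + (LBINT s:{0..t}. \<delta> - 2 * \<alpha> * X s \<omega>)))"

definition OU_a :: "real \<Rightarrow> real \<Rightarrow> real" where
  "OU_a \<alpha> \<gamma> = (sqrt (\<alpha>\<^sup>2 + 2 * \<gamma>) - \<alpha>) / 2"

definition OU_phi :: "real \<Rightarrow> real \<Rightarrow> real \<Rightarrow> real \<Rightarrow> real" where
  "OU_phi \<alpha> \<gamma> t l = (let a = OU_a \<alpha> \<gamma> in
     a + ((l - a) * (2 * a + \<alpha>)) / (exp (2 * t * (\<alpha> + 2 * a)) * (a + \<alpha> + l) + a - l))"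

definition OU_psi :: "real \<Rightarrow> real \<Rightarrow> real \<Rightarrow> real \<Rightarrow> real \<Rightarrow> real" where
  "OU_psi \<delta> \<alpha> \<gamma> t l = (let a = OU_a \<alpha> \<gamma> in
     \<delta> * a * t - \<delta> / 2 * ln \<bar>1 + ((l - a) * (1 - exp (2 * t * (\<alpha> + 2 * a)))) /
       (exp (2 * t * (\<alpha> + 2 * a)) * (a + l + \<alpha>) + a - l)\<bar>)"

end

theory Submission
  imports Defs
begin

text \<open>
  Since \<open>\<phi>\<close> solves the Riccati equation \<open>\<phi>' = \<gamma> - 2\<phi>\<^sup>2 - 2\<alpha>\<phi>\<close> with \<open>\<phi>(0) = \<lambda>\<close>, and \<open>\<psi>' = \<delta>\<phi>\<close>
  with \<open>\<psi>(0) = 0\<close>, the exponent \<open>-\<lambda> X\<^sub>t - \<gamma> \<integral> X\<close> differs from \<open>- x \<phi>(t) - \<psi>(t)\<close> by the logarithm of the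
  stochastic exponential of \<open>- 2 \<integral> \<phi>(t - s) \<surd>X dB\<close>, so the claim is that this exponential has mean 1.

  Ito's formula is avoided.  Along a partition, with integrand an approximating simple process cut
  off when its quadratic variation exceeds a level, the discrete stochastic exponential has mean
  exactly 1 by the Gaussian moment generating function, and it is bounded in \<open>L\<^sup>2\<close>.  Summation by parts
  and a maximal inequality show that its exponent is uniformly close to \<open>V\<^sub>s - V\<^sub>0\<close>, where
  \<open>V\<^sub>s = - \<phi>(t - s) X\<^sub>s - \<psi>(t - s) - \<gamma> \<integral>\<^sub>0\<^sup>s X\<close> is bounded above because \<open>X\<close> and \<open>\<phi>\<close> are nonnegative.
  Hence one may let the mesh tend to 0 and then remove the cutoff.
\<close>

section \<open>Discrete exponential martingales\<close>

text \<open>The obstacle is that no exponential moment of the time integral of \<open>X\<close> is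
  available, so a Novikov-type criterion is out of reach. The second moment bound bought by the
  cutoff explodes with the cutoff level, hence it gives uniform integrability only at a fixed level.
  What survives the removal of the cutoff is a bound that does not see the level: the cut-off
  exponential is the discrete exponential at a random partition point, where it is close to
  \<open>exp (V s - V 0)\<close>, and that is bounded by a constant. Therefore closeness is needed
  at all partition points simultaneously, whereas \<open>I\<close> is given only as a limit in
  probability at each fixed time. The maximal inequality closes this gap, and it rests on the same
  exponential identity. Summation by parts works because \<open>\<phi>\<close> is deterministic and
  Lipschitz on bounded intervals, so only the size of the error of the integral matters, not its
  increments. The cutoff is predictable because partitions are deterministic and a simple process is
  known on the next interval at its left end.\<close>

lemma normal_density_exponential_tilt:
  assumes "0 < \<sigma>"
  shows "normal_density 0 \<sigma> y * exp (q * y - q\<^sup>2 * \<sigma>\<^sup>2 / 2) = normal_density (q * \<sigma>\<^sup>2) \<sigma> y"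
proof -
  have "- (y - 0)\<^sup>2 / (2 * \<sigma>\<^sup>2) + (q * y - q\<^sup>2 * \<sigma>\<^sup>2 / 2) = - (y - q * \<sigma>\<^sup>2)\<^sup>2 / (2 * \<sigma>\<^sup>2)"
    using assms by (simp add: field_simps power2_eq_square)
  then show ?thesis
    unfolding normal_density_def by (simp add: exp_add [symmetric])
qed

lemma nn_integral_normal_density:
  "0 < \<sigma> \<Longrightarrow> (\<integral>\<^sup>+y. ennreal (normal_density \<mu> \<sigma> y) \<partial>lborel) = 1"
  by (subst nn_integral_eq_integral) auto

context brownian_motion
begin

lemma F_measurable_mono:
  assumes "s \<le> t" and "f \<in> measurable (F s) N"
  shows "f \<in> measurable (F t) N"
  using assms sets_F_mono[of s t] space_F
  by (auto simp: measurable_def)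

lemma F_measurable_M:
  assumes "f \<in> measurable (F s) N"
  shows "f \<in> measurable M N"
  using assms sets_F_subset[of s] space_F[of s]
  by (auto simp: measurable_def)

lemma B_measurable_F: "0 \<le> s \<Longrightarrow> s \<le> t \<Longrightarrow> B s \<in> borel_measurable (F t)"
  using BM_adapted F_measurable_mono by blast

lemma B_measurable: "0 \<le> s \<Longrightarrow> B s \<in> borel_measurable M"
  using BM_adapted F_measurable_M by blast

text \<open>Independence as a product law. The first coordinate is the sample point itself, seen
  through \<open>F s\<close>, so that every coefficient known at time \<open>s\<close> can be frozen
  while the increment is integrated out. Agreement on rectangles suffices, and there it is the
  independence assumption.\<close>

lemma distr_pair_increment:
  assumes "0 \<le> s" "s < u"
  shows "distr M (F s) (\<lambda>\<omega>. \<omega>) \<Otimes>\<^sub>M distr M borel (\<lambda>\<omega>. B u \<omega> - B s \<omega>)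
       = distr M (F s \<Otimes>\<^sub>M borel) (\<lambda>\<omega>. (\<omega>, B u \<omega> - B s \<omega>))"
proof -
  let ?D = "\<lambda>\<omega>. B u \<omega> - B s \<omega>"
  have id [measurable]: "(\<lambda>\<omega>. \<omega>) \<in> measurable M (F s)"
    by (rule F_measurable_M[of _ s]) simp
  have D [measurable]: "?D \<in> borel_measurable M"
    using assms by (intro borel_measurable_diff B_measurable) auto
  interpret F: prob_space "distr M (F s) (\<lambda>\<omega>. \<omega>)" by (rule prob_space_distr) simp
  interpret D: prob_space "distr M borel ?D" by (rule prob_space_distr) simp
  show ?thesis
  proof (rule pair_measure_eqI)
    fix A C assume "A \<in> sets (distr M (F s) (\<lambda>\<omega>. \<omega>))" "C \<in> sets (distr M borel ?D)"
    then have AC [measurable]: "A \<in> sets (F s)" "C \<in> sets borel" by auto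
    have sub: "A \<subseteq> space M"
      using sets.sets_into_space[OF AC(1)] space_F by auto
    have AM [measurable]: "A \<in> sets M"
      using AC(1) sets_F_subset by blast
    have "prob (A \<inter> (?D -` C \<inter> space M)) = prob A * prob (?D -` C \<inter> space M)"
      using indep_setD[OF BM_indep[OF assms] AC(1)] AC(2) by blast
    moreover have "(\<lambda>\<omega>. (\<omega>, ?D \<omega>)) -` (A \<times> C) \<inter> space M = A \<inter> (?D -` C \<inter> space M)"
      using sub by auto
    ultimately show "emeasure (distr M (F s) (\<lambda>\<omega>. \<omega>)) A * emeasure (distr M borel ?D) C
      = emeasure (distr M (F s \<Otimes>\<^sub>M borel) (\<lambda>\<omega>. (\<omega>, ?D \<omega>))) (A \<times> C)"
      using sub by (simp add: emeasure_distr emeasure_eq_measure ennreal_mult'[symmetric] Int_absorb2)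
  qed (auto intro: F.sigma_finite_measure_axioms D.sigma_finite_measure_axioms sets_pair_measure_cong)
qed

text \<open>Tonelli's theorem makes boundedness of \<open>q\<close> and \<open>G\<close> unnecessary here.\<close>

lemma nn_integral_exp_increment:
  assumes "0 \<le> s" "s < u"
    and q [measurable]: "q \<in> borel_measurable (F s)" and G [measurable]: "G \<in> borel_measurable (F s)"
    and "\<And>\<omega>. 0 \<le> G \<omega>"
  shows "(\<integral>\<^sup>+\<omega>. ennreal (G \<omega> * exp (q \<omega> * (B u \<omega> - B s \<omega>) - (q \<omega>)\<^sup>2 * (u - s) / 2)) \<partial>M)
       = (\<integral>\<^sup>+\<omega>. ennreal (G \<omega>) \<partial>M)"
proof -
  let ?D = "\<lambda>\<omega>. B u \<omega> - B s \<omega>"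
  let ?f = "\<lambda>(\<omega>, y). ennreal (G \<omega> * exp (q \<omega> * y - (q \<omega>)\<^sup>2 * (u - s) / 2))"
  let ?N = "normal_density 0 (sqrt (u - s))"
  have id [measurable]: "(\<lambda>\<omega>. \<omega>) \<in> measurable M (F s)"
    by (rule F_measurable_M[of _ s]) simp
  have D [measurable]: "?D \<in> borel_measurable M"
    using assms by (intro borel_measurable_diff B_measurable) auto
  note eq = distr_pair_increment[OF assms(1,2)]
  interpret D: prob_space "distr M borel ?D" by (rule prob_space_distr) simp
  have [measurable]: "?f \<in> borel_measurable (F s \<Otimes>\<^sub>M borel)"
    by measurable
  \<comment> \<open>With \<open>\<omega>\<close> frozen, the exponential factor shifts the mean of
    the Gaussian density and leaves its total mass 1.\<close>
  have inner: "(\<integral>\<^sup>+y. ?f (\<omega>, y) \<partial>distr M borel ?D) = ennreal (G \<omega>)" for \<omega>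
  proof -
    have "distr M borel ?D = density lborel (\<lambda>y. ennreal (?N y))"
    proof -
      have "distr M borel ?D = distr M lborel ?D"
        by (rule distr_cong) auto
      then show ?thesis
        using BM_normal[OF assms(1,2)] by (simp add: distributed_def)
    qed
    then have "(\<integral>\<^sup>+y. ?f (\<omega>, y) \<partial>distr M borel ?D) = (\<integral>\<^sup>+y. ennreal (?N y) * ?f (\<omega>, y) \<partial>lborel)"
      by (simp add: nn_integral_density)
    also have "\<dots> = (\<integral>\<^sup>+y. ennreal (G \<omega>) * ennreal (normal_density (q \<omega> * (u - s)) (sqrt (u - s)) y) \<partial>lborel)"
    proof (rule nn_integral_cong)
      fix y :: real
      have "?N y * (G \<omega> * exp (q \<omega> * y - (q \<omega>)\<^sup>2 * (u - s) / 2))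
          = G \<omega> * normal_density (q \<omega> * (u - s)) (sqrt (u - s)) y"
        using normal_density_exponential_tilt[of "sqrt (u - s)" y "q \<omega>"] assms(2)
        by (simp add: mult_ac)
      then show "ennreal (?N y) * ?f (\<omega>, y) = ennreal (G \<omega>) * ennreal (normal_density (q \<omega> * (u - s)) (sqrt (u - s)) y)"
        using assms(5) by (simp add: ennreal_mult'[symmetric])
    qed
    also have "\<dots> = ennreal (G \<omega>)"
      using assms(2) by (subst nn_integral_cmult) (auto simp: nn_integral_normal_density)
    finally show ?thesis .
  qed
  have "(\<integral>\<^sup>+\<omega>. ?f (\<omega>, ?D \<omega>) \<partial>M) = (\<integral>\<^sup>+z. ?f z \<partial>distr M (F s \<Otimes>\<^sub>M borel) (\<lambda>\<omega>. (\<omega>, ?D \<omega>)))"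
    by (subst nn_integral_distr) auto
  also have "\<dots> = (\<integral>\<^sup>+\<omega>. \<integral>\<^sup>+y. ?f (\<omega>, y) \<partial>distr M borel ?D \<partial>distr M (F s) (\<lambda>\<omega>. \<omega>))"
    unfolding eq[symmetric] by (subst D.nn_integral_fst) auto
  also have "\<dots> = (\<integral>\<^sup>+\<omega>. ennreal (G \<omega>) \<partial>M)"
    unfolding inner by (subst nn_integral_distr) auto
  finally show ?thesis by simp
qed

lemma measurable_sum_increments:
  assumes "0 \<le> \<sigma> 0" "strict_mono_on {..n} \<sigma>" "m \<le> n"
    and "\<And>i. i < n \<Longrightarrow> q i \<in> borel_measurable (F (\<sigma> i))"
  shows "(\<lambda>\<omega>. \<Sum>i<m. q i \<omega> * (B (\<sigma> (Suc i)) \<omega> - B (\<sigma> i) \<omega>)) \<in> borel_measurable (F (\<sigma> m))"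
    and "(\<lambda>\<omega>. \<Sum>i<m. (q i \<omega>)\<^sup>2 * (\<sigma> (Suc i) - \<sigma> i)) \<in> borel_measurable (F (\<sigma> m))"
proof -
  have le: "\<sigma> i \<le> \<sigma> j" if "i \<le> j" "j \<le> n" for i j
    using assms(2) that by (cases "i = j") (auto simp: strict_mono_on_def less_imp_le)
  have [measurable]: "q i \<in> borel_measurable (F (\<sigma> m))" if "i < m" for i
    using assms(4)[of i] le[of i m] that assms(3) F_measurable_mono by (metis less_imp_le order_less_le_trans)
  have [measurable]: "B (\<sigma> i) \<in> borel_measurable (F (\<sigma> m))" if "i \<le> m" for i
    using le[of i m] le[of 0 i] that assms(1,3) by (intro B_measurable_F) auto
  show "(\<lambda>\<omega>. \<Sum>i<m. q i \<omega> * (B (\<sigma> (Suc i)) \<omega> - B (\<sigma> i) \<omega>)) \<in> borel_measurable (F (\<sigma> m))"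
    by (intro borel_measurable_sum borel_measurable_times borel_measurable_diff) auto
  show "(\<lambda>\<omega>. \<Sum>i<m. (q i \<omega>)\<^sup>2 * (\<sigma> (Suc i) - \<sigma> i)) \<in> borel_measurable (F (\<sigma> m))"
    by (intro borel_measurable_sum borel_measurable_times borel_measurable_power) auto
qed

text \<open>The last factor is peeled off repeatedly: the exponent up to step \<open>m\<close> is
  known at time \<open>\<sigma> m\<close>, so it can serve as the weight \<open>G\<close> of
  \<open>nn_integral_exp_increment\<close>. A finite product of positive factors of conditional mean
  1 has mean 1 without any integrability condition; in continuous time this may fail.\<close>

lemma nn_integral_exp_martingale:
  assumes "0 \<le> \<sigma> 0" "strict_mono_on {..n} \<sigma>"
    and q: "\<And>i. i < n \<Longrightarrow> q i \<in> borel_measurable (F (\<sigma> i))"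
  shows "(\<integral>\<^sup>+\<omega>. ennreal (exp ((\<Sum>i<n. q i \<omega> * (B (\<sigma> (Suc i)) \<omega> - B (\<sigma> i) \<omega>))
           - (\<Sum>i<n. (q i \<omega>)\<^sup>2 * (\<sigma> (Suc i) - \<sigma> i)) / 2)) \<partial>M) = 1"
proof -
  define S where "S m \<omega> = (\<Sum>i<m. q i \<omega> * (B (\<sigma> (Suc i)) \<omega> - B (\<sigma> i) \<omega>))" for m \<omega>
  define Q where "Q m \<omega> = (\<Sum>i<m. (q i \<omega>)\<^sup>2 * (\<sigma> (Suc i) - \<sigma> i))" for m \<omega>
  have "(\<integral>\<^sup>+\<omega>. ennreal (exp (S m \<omega> - Q m \<omega> / 2)) \<partial>M) = 1" if "m \<le> n" for m
    using that
  proof (induction m)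
    case 0
    then show ?case by (simp add: S_def Q_def emeasure_space_1)
  next
    case (Suc m)
    have [measurable]: "S m \<in> borel_measurable (F (\<sigma> m))" "Q m \<in> borel_measurable (F (\<sigma> m))"
      using measurable_sum_increments[OF assms(1,2) _ q, of m] Suc.prems
      unfolding S_def[abs_def] Q_def[abs_def] by auto
    have lt: "\<sigma> m < \<sigma> (Suc m)" and nn: "0 \<le> \<sigma> m"
      using assms(1,2) Suc.prems strict_mono_onD[of "{..n}" \<sigma> 0 m] strict_mono_onD[of "{..n}" \<sigma> m "Suc m"]
      by (auto, cases m) auto
    have "exp (S (Suc m) \<omega> - Q (Suc m) \<omega> / 2)
        = exp (S m \<omega> - Q m \<omega> / 2) * exp (q m \<omega> * (B (\<sigma> (Suc m)) \<omega> - B (\<sigma> m) \<omega>) - (q m \<omega>)\<^sup>2 * (\<sigma> (Suc m) - \<sigma> m) / 2)" for \<omega>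
      by (simp add: exp_add[symmetric] S_def Q_def add_divide_distrib)
    then have "(\<integral>\<^sup>+\<omega>. ennreal (exp (S (Suc m) \<omega> - Q (Suc m) \<omega> / 2)) \<partial>M)
        = (\<integral>\<^sup>+\<omega>. ennreal (exp (S m \<omega> - Q m \<omega> / 2)) \<partial>M)"
      using nn_integral_exp_increment[OF nn lt q, of "\<lambda>\<omega>. exp (S m \<omega> - Q m \<omega> / 2)"] Suc.prems
      by simp
    then show ?case using Suc by simp
  qed
  from this[of n] show ?thesis by (simp add: S_def Q_def)
qed

end

section \<open>A maximal inequality and simple processes\<close>

context brownian_motion
begin

text \<open>Exponential Chebyshev inequality: the exponential of mean 1 built from
  \<open>\<theta> * q\<close> is large wherever the sum exceeds \<open>\<epsilon>\<close>, since its
  quadratic variation is at most \<open>\<eta>\<close>.\<close>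

lemma tail_bound:
  assumes "0 \<le> \<sigma> 0" "strict_mono_on {..n} \<sigma>"
    and q: "\<And>i. i < n \<Longrightarrow> q i \<in> borel_measurable (F (\<sigma> i))"
    and "0 < \<epsilon>" "0 < \<eta>"
    and R: "\<And>\<omega>. \<omega> \<in> space M \<Longrightarrow> (\<Sum>i<n. (q i \<omega>)\<^sup>2 * (\<sigma> (Suc i) - \<sigma> i)) \<le> \<eta>"
  shows "prob {\<omega> \<in> space M. (\<Sum>i<n. q i \<omega> * (B (\<sigma> (Suc i)) \<omega> - B (\<sigma> i) \<omega>)) > \<epsilon>} \<le> exp (- \<epsilon>\<^sup>2 / (2 * \<eta>))"
proof -
  define S where "S \<omega> = (\<Sum>i<n. q i \<omega> * (B (\<sigma> (Suc i)) \<omega> - B (\<sigma> i) \<omega>))" for \<omega>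
  define Q where "Q \<omega> = (\<Sum>i<n. (q i \<omega>)\<^sup>2 * (\<sigma> (Suc i) - \<sigma> i))" for \<omega>
  \<comment> \<open>The maximiser of
    \<open>\<theta> * \<epsilon> - \<theta>\<^sup>2 * \<eta> / 2\<close>.\<close>
  define \<theta> where "\<theta> = \<epsilon> / \<eta>"
  have \<theta>: "0 < \<theta>" using assms by (simp add: \<theta>_def)
  have [measurable]: "S \<in> borel_measurable M" "Q \<in> borel_measurable M"
    using measurable_sum_increments[OF assms(1,2) le_refl q] F_measurable_M
    unfolding S_def[abs_def] Q_def[abs_def] by blast+
  have "(\<integral>\<^sup>+\<omega>. ennreal (exp (\<theta> * S \<omega> - \<theta>\<^sup>2 * Q \<omega> / 2)) \<partial>M) = 1"
    using nn_integral_exp_martingale[OF assms(1,2), of "\<lambda>i \<omega>. \<theta> * q i \<omega>"] q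
    by (simp add: S_def Q_def sum_distrib_left mult_ac power_mult_distrib)
  note one = this
  have exponent: "\<theta> * \<epsilon> - \<theta>\<^sup>2 * \<eta> / 2 = \<epsilon>\<^sup>2 / (2 * \<eta>)"
    using assms by (simp add: \<theta>_def field_simps power2_eq_square)
  have "emeasure M {\<omega> \<in> space M. S \<omega> > \<epsilon>} = (\<integral>\<^sup>+\<omega>. indicator {\<omega> \<in> space M. S \<omega> > \<epsilon>} \<omega> \<partial>M)"
    by simp
  also have "\<dots> \<le> (\<integral>\<^sup>+\<omega>. ennreal (exp (- \<epsilon>\<^sup>2 / (2 * \<eta>))) * ennreal (exp (\<theta> * S \<omega> - \<theta>\<^sup>2 * Q \<omega> / 2)) \<partial>M)"
  proof (rule nn_integral_mono)
    fix \<omega> assume \<omega>: "\<omega> \<in> space M"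
    show "indicator {\<omega> \<in> space M. S \<omega> > \<epsilon>} \<omega> \<le> ennreal (exp (- \<epsilon>\<^sup>2 / (2 * \<eta>))) * ennreal (exp (\<theta> * S \<omega> - \<theta>\<^sup>2 * Q \<omega> / 2))"
    proof (cases "S \<omega> > \<epsilon>")
      case True
      have "\<theta> * \<epsilon> \<le> \<theta> * S \<omega>" "\<theta>\<^sup>2 * Q \<omega> \<le> \<theta>\<^sup>2 * \<eta>"
        using True \<theta> R[OF \<omega>] by (auto simp: Q_def intro!: mult_left_mono)
      then have "0 \<le> - \<epsilon>\<^sup>2 / (2 * \<eta>) + (\<theta> * S \<omega> - \<theta>\<^sup>2 * Q \<omega> / 2)"
        using exponent by simp
      then have "1 \<le> exp (- \<epsilon>\<^sup>2 / (2 * \<eta>)) * exp (\<theta> * S \<omega> - \<theta>\<^sup>2 * Q \<omega> / 2)"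
        unfolding exp_add[symmetric] by (subst one_le_exp_iff)
      then show ?thesis using True \<omega> by (simp add: ennreal_mult'[symmetric])
    qed simp
  qed
  also have "\<dots> = ennreal (exp (- \<epsilon>\<^sup>2 / (2 * \<eta>)))"
    using one by (subst nn_integral_cmult) auto
  finally show ?thesis
    unfolding S_def[symmetric] by (simp add: emeasure_eq_measure)
qed

text \<open>Stopping the sum when it first leaves \<open>[-\<epsilon>, \<epsilon>]\<close>, or just before its quadratic
  variation exceeds \<open>\<eta>\<close>, reduces the maximal inequality to the bound for the final value.\<close>

lemma maximal_inequality:
  assumes "0 \<le> \<sigma> 0" "strict_mono_on {..n} \<sigma>"
    and q: "\<And>i. i < n \<Longrightarrow> q i \<in> borel_measurable (F (\<sigma> i))"
    and "0 < \<epsilon>" "0 < \<eta>"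
  shows "prob {\<omega> \<in> space M. \<exists>m\<le>n. \<bar>\<Sum>i<m. q i \<omega> * (B (\<sigma> (Suc i)) \<omega> - B (\<sigma> i) \<omega>)\<bar> > \<epsilon>}
     \<le> prob {\<omega> \<in> space M. (\<Sum>i<n. (q i \<omega>)\<^sup>2 * (\<sigma> (Suc i) - \<sigma> i)) > \<eta>} + 2 * exp (- \<epsilon>\<^sup>2 / (2 * \<eta>))"
proof -
  define S where "S m \<omega> = (\<Sum>i<m. q i \<omega> * (B (\<sigma> (Suc i)) \<omega> - B (\<sigma> i) \<omega>))" for m \<omega>
  define Q where "Q m \<omega> = (\<Sum>i<m. (q i \<omega>)\<^sup>2 * (\<sigma> (Suc i) - \<sigma> i))" for m \<omega>
  \<comment> \<open>The index \<open>Suc i\<close> in \<open>Q\<close> is no look into the future: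
    \<open>q i\<close> is known at time \<open>\<sigma> i\<close>, hence so is
    \<open>Q (Suc i)\<close>. For the sums \<open>S\<close> only indices up to \<open>i\<close> are
    allowed.\<close>
  define e where "e i \<omega> = (if (\<forall>l\<le>i. \<bar>S l \<omega>\<bar> \<le> \<epsilon>) \<and> Q (Suc i) \<omega> \<le> \<eta> then 1 else 0 :: real)" for i \<omega>
  define k where "k i \<omega> = q i \<omega> * e i \<omega>" for i \<omega>
  define T where "T \<omega> = (\<Sum>i<n. k i \<omega> * (B (\<sigma> (Suc i)) \<omega> - B (\<sigma> i) \<omega>))" for \<omega>
  have le: "\<sigma> i \<le> \<sigma> j" if "i \<le> j" "j \<le> n" for i j
    using assms(2) that by (cases "i = j") (auto simp: strict_mono_on_def less_imp_le)
  have S_meas: "S m \<in> borel_measurable (F (\<sigma> m))" and Q_meas: "Q m \<in> borel_measurable (F (\<sigma> m))"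
    if "m \<le> n" for m
    using measurable_sum_increments[OF assms(1,2) that q] unfolding S_def[abs_def] Q_def[abs_def] by auto
  have k_meas: "k i \<in> borel_measurable (F (\<sigma> i))" if "i < n" for i
  proof -
    have [measurable]: "S l \<in> borel_measurable (F (\<sigma> i))" if "l \<le> i" for l
      using S_meas[of l] le[of l i] that \<open>i < n\<close> F_measurable_mono by (meson le_trans less_imp_le)
    have [measurable]: "Q i \<in> borel_measurable (F (\<sigma> i))" "q i \<in> borel_measurable (F (\<sigma> i))"
      using Q_meas[of i] q that by auto
    have "Q (Suc i) = (\<lambda>\<omega>. Q i \<omega> + (q i \<omega>)\<^sup>2 * (\<sigma> (Suc i) - \<sigma> i))"
      by (simp add: Q_def fun_eq_iff)
    then have [measurable]: "Q (Suc i) \<in> borel_measurable (F (\<sigma> i))"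
      by simp
    have "Measurable.pred (F (\<sigma> i)) (\<lambda>\<omega>. \<forall>l\<in>{..i}. \<bar>S l \<omega>\<bar> \<le> \<epsilon>)"
      by (rule pred_intros_finite) auto
    then have [measurable]: "Measurable.pred (F (\<sigma> i)) (\<lambda>\<omega>. \<forall>l\<le>i. \<bar>S l \<omega>\<bar> \<le> \<epsilon>)"
      by (simp add: Ball_def)
    show ?thesis unfolding k_def[abs_def] e_def[abs_def] by measurable
  qed
  have inc: "0 \<le> \<sigma> (Suc i) - \<sigma> i" if "i < n" for i using le[of i "Suc i"] that by simp
  have Qmono: "Q i \<omega> \<le> Q j \<omega>" if "i \<le> j" "j \<le> n" for i j \<omega>
    unfolding Q_def using that inc by (intro sum_mono2) auto
  \<comment> \<open>A summand that is switched off changes nothing; at a summand that is switched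
    on, the whole cut-off sum is at most \<open>Q (Suc m)\<close>, which \<open>e\<close> keeps
    below \<open>\<eta>\<close>.\<close>
  have kQ: "(\<Sum>i<m. (k i \<omega>)\<^sup>2 * (\<sigma> (Suc i) - \<sigma> i)) \<le> \<eta>" if "m \<le> n" for m \<omega>
    using that
  proof (induction m)
    case (Suc m)
    show ?case
    proof (cases "e m \<omega> = 0")
      case True
      then show ?thesis using Suc by (simp add: k_def)
    next
      case False
      have "(\<Sum>i<Suc m. (k i \<omega>)\<^sup>2 * (\<sigma> (Suc i) - \<sigma> i)) \<le> Q (Suc m) \<omega>"
        unfolding Q_def using Suc.prems inc
        by (intro sum_mono mult_right_mono) (auto simp: k_def e_def)
      also have "\<dots> \<le> \<eta>" using False by (auto simp: e_def split: if_splits)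
      finally show ?thesis .
    qed
  qed (use assms in simp)
  have T1: "prob {\<omega> \<in> space M. T \<omega> > \<epsilon>} \<le> exp (- \<epsilon>\<^sup>2 / (2 * \<eta>))"
    unfolding T_def using kQ[of n] k_meas by (intro tail_bound assms) auto
  have T2: "prob {\<omega> \<in> space M. - T \<omega> > \<epsilon>} \<le> exp (- \<epsilon>\<^sup>2 / (2 * \<eta>))"
    using tail_bound[OF assms(1,2), of "\<lambda>i \<omega>. - k i \<omega>" \<epsilon> \<eta>] kQ[of n] k_meas assms(4,5)
    by (simp add: T_def sum_negf)
  have [measurable]: "T \<in> borel_measurable M" "Q n \<in> borel_measurable M"
    using measurable_sum_increments(1)[OF assms(1,2) le_refl k_meas] F_measurable_M Q_meas[OF le_refl]
    unfolding T_def[abs_def] by blast+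
  have "{\<omega> \<in> space M. \<exists>m\<le>n. \<bar>S m \<omega>\<bar> > \<epsilon>}
     \<subseteq> {\<omega> \<in> space M. Q n \<omega> > \<eta>} \<union> ({\<omega> \<in> space M. T \<omega> > \<epsilon>} \<union> {\<omega> \<in> space M. - T \<omega> > \<epsilon>})"
  proof (rule subsetI, rule ccontr)
    fix \<omega> assume "\<omega> \<in> {\<omega> \<in> space M. \<exists>m\<le>n. \<bar>S m \<omega>\<bar> > \<epsilon>}"
      and neg: "\<omega> \<notin> {\<omega> \<in> space M. Q n \<omega> > \<eta>} \<union> ({\<omega> \<in> space M. T \<omega> > \<epsilon>} \<union> {\<omega> \<in> space M. - T \<omega> > \<epsilon>})"
    then have \<omega>: "\<omega> \<in> space M" and "\<exists>m. m \<le> n \<and> \<bar>S m \<omega>\<bar> > \<epsilon>" by auto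
    then obtain m where m: "m \<le> n" "\<bar>S m \<omega>\<bar> > \<epsilon>" and least: "\<And>l. l < m \<Longrightarrow> \<not> (l \<le> n \<and> \<bar>S l \<omega>\<bar> > \<epsilon>)"
      using exists_least_iff[of "\<lambda>m. m \<le> n \<and> \<bar>S m \<omega>\<bar> > \<epsilon>"] by auto
    have Qn: "Q n \<omega> \<le> \<eta>" and Tn: "\<bar>T \<omega>\<bar> \<le> \<epsilon>" using neg \<omega> by auto
    \<comment> \<open>Since \<open>Q n \<omega> \<le> \<eta>\<close>, only the exit from
      \<open>[-\<epsilon>, \<epsilon>]\<close> switches summands off. So \<open>T\<close> stays at
      the value \<open>S m\<close> of the first exit, which is larger than \<open>\<epsilon>\<close>
      in modulus.\<close>
    have "e i \<omega> = (if i < m then 1 else 0)" if "i < n" for i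
    proof (cases "i < m")
      case True
      then have "\<forall>l\<le>i. \<bar>S l \<omega>\<bar> \<le> \<epsilon>"
        using least m(1) by (meson le_less_trans less_imp_le not_le order_trans)
      moreover have "Q (Suc i) \<omega> \<le> \<eta>"
        using Qmono[of "Suc i" n \<omega>] that Qn by simp
      ultimately show ?thesis using True by (simp add: e_def)
    next
      case False
      then have "\<not> (\<forall>l\<le>i. \<bar>S l \<omega>\<bar> \<le> \<epsilon>)"
        using m(2) by (meson not_le)
      then show ?thesis using False by (simp add: e_def)
    qed
    then have "T \<omega> = (\<Sum>i<n. if i < m then q i \<omega> * (B (\<sigma> (Suc i)) \<omega> - B (\<sigma> i) \<omega>) else 0)"
      unfolding T_def k_def by (intro sum.cong) auto
    also have "\<dots> = S m \<omega>"
      unfolding S_def using m by (subst sum.inter_filter[symmetric]) (auto intro!: sum.cong)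
    finally show False using Tn m by simp
  qed
  then have "prob {\<omega> \<in> space M. \<exists>m\<le>n. \<bar>S m \<omega>\<bar> > \<epsilon>}
     \<le> prob ({\<omega> \<in> space M. Q n \<omega> > \<eta>} \<union> ({\<omega> \<in> space M. T \<omega> > \<epsilon>} \<union> {\<omega> \<in> space M. - T \<omega> > \<epsilon>}))"
    by (rule finite_measure_mono) measurable
  also have "\<dots> \<le> prob {\<omega> \<in> space M. Q n \<omega> > \<eta>} + (prob {\<omega> \<in> space M. T \<omega> > \<epsilon>} + prob {\<omega> \<in> space M. - T \<omega> > \<epsilon>})"
    by (intro order_trans[OF measure_Un_le] add_left_mono measure_Un_le) auto
  finally show ?thesis using T1 T2 unfolding S_def Q_def by simp
qed

end

text \<open>The value of a simple process on the interval immediately to the right of \<open>s\<close>; unlike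
  \<^const>\<open>simple_process\<close> at a later time it is known at time \<open>s\<close>.\<close>

definition simple_right :: "nat \<Rightarrow> (nat \<Rightarrow> real) \<Rightarrow> (nat \<Rightarrow> 'a \<Rightarrow> real) \<Rightarrow> real \<Rightarrow> 'a \<Rightarrow> real" where
  "simple_right n \<tau> \<xi> s \<omega> = (\<Sum>i<n. \<xi> i \<omega> * indicator {\<tau> i..<\<tau> (Suc i)} s)"

lemma simple_process_eq_simple_right:
  assumes "\<And>i. i \<le> n \<Longrightarrow> \<tau> i \<notin> {a<..<b}" "a < s" "s \<le> b"
  shows "simple_process n \<tau> \<xi> s \<omega> = simple_right n \<tau> \<xi> a \<omega>"
proof -
  have "indicator {\<tau> i<..\<tau> (Suc i)} s = (indicator {\<tau> i..<\<tau> (Suc i)} a :: real)" if "i < n" for i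
    using assms(1)[of i] assms(1)[of "Suc i"] assms(2,3) that by (auto simp: indicator_def)
  then show ?thesis by (simp add: simple_process_def simple_right_def)
qed

lemma simple_integral_diff:
  assumes "\<And>i. i \<le> n \<Longrightarrow> \<tau> i \<notin> {a<..<b}" "a < b" "\<And>i. i < n \<Longrightarrow> \<tau> i < \<tau> (Suc i)"
  shows "simple_integral B n \<tau> \<xi> b \<omega> - simple_integral B n \<tau> \<xi> a \<omega>
       = simple_right n \<tau> \<xi> a \<omega> * (B b \<omega> - B a \<omega>)"
proof -
  \<comment> \<open>A knot lies at or before \<open>a\<close>, or at or after \<open>b\<close>; so
    the path stopped at the knot either stands still between \<open>a\<close> and \<open>b\<close>
    or makes the full move.\<close>
  have *: "B (min (\<tau> i) b) \<omega> - B (min (\<tau> i) a) \<omega> = (if a < \<tau> i then B b \<omega> - B a \<omega> else 0)" if "i \<le> n" for i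
    using assms(1)[OF that] assms(2) by (auto simp: min_def)
  have "simple_integral B n \<tau> \<xi> b \<omega> - simple_integral B n \<tau> \<xi> a \<omega> =
    (\<Sum>i<n. \<xi> i \<omega> * ((B (min (\<tau> (Suc i)) b) \<omega> - B (min (\<tau> (Suc i)) a) \<omega>) - (B (min (\<tau> i) b) \<omega> - B (min (\<tau> i) a) \<omega>)))"
    unfolding simple_integral_def sum_subtractf[symmetric] by (intro sum.cong) (auto simp: algebra_simps)
  also have "\<dots> = (\<Sum>i<n. \<xi> i \<omega> * indicator {\<tau> i..<\<tau> (Suc i)} a * (B b \<omega> - B a \<omega>))"
  proof (intro sum.cong refl)
    fix i assume "i \<in> {..<n}"
    then show "\<xi> i \<omega> * ((B (min (\<tau> (Suc i)) b) \<omega> - B (min (\<tau> (Suc i)) a) \<omega>) - (B (min (\<tau> i) b) \<omega> - B (min (\<tau> i) a) \<omega>))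
      = \<xi> i \<omega> * indicator {\<tau> i..<\<tau> (Suc i)} a * (B b \<omega> - B a \<omega>)"
      using *[of i] *[of "Suc i"] assms(3)[of i] by (auto simp: indicator_def)
  qed
  finally show ?thesis unfolding simple_right_def sum_distrib_right .
qed

lemma simple_integrand_nonneg:
  assumes "simple_integrand M F n \<tau> \<xi>" "i \<le> n"
  shows "0 \<le> \<tau> i"
  using assms(2)
proof (induction i)
  case (Suc i)
  then show ?case using assms(1) unfolding simple_integrand_def
    by (meson Suc_le_eq less_imp_le order_trans)
qed (use assms in \<open>simp add: simple_integrand_def\<close>)

lemma simple_integral_partition:
  assumes "simple_integrand M F n \<tau> \<xi>" "\<sigma> 0 = 0" "strict_mono_on {..N} \<sigma>"
    and "\<And>i j. i \<le> n \<Longrightarrow> j < N \<Longrightarrow> \<tau> i \<notin> {\<sigma> j<..<\<sigma> (Suc j)}" and "m \<le> N"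
  shows "simple_integral B n \<tau> \<xi> (\<sigma> m) \<omega>
       = (\<Sum>i<m. simple_right n \<tau> \<xi> (\<sigma> i) \<omega> * (B (\<sigma> (Suc i)) \<omega> - B (\<sigma> i) \<omega>))"
  using assms(5)
proof (induction m)
  case 0
  have "min (\<tau> i) 0 = 0" if "i \<le> n" for i
    using simple_integrand_nonneg[OF assms(1) that] by simp
  then show ?case using assms(2) by (auto simp: simple_integral_def intro!: sum.neutral)
next
  case (Suc m)
  have "simple_integral B n \<tau> \<xi> (\<sigma> (Suc m)) \<omega> - simple_integral B n \<tau> \<xi> (\<sigma> m) \<omega>
    = simple_right n \<tau> \<xi> (\<sigma> m) \<omega> * (B (\<sigma> (Suc m)) \<omega> - B (\<sigma> m) \<omega>)"
    using Suc.prems assms(1,3,4)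
    by (intro simple_integral_diff) (auto simp: simple_integrand_def strict_mono_on_def)
  then show ?case using Suc by simp
qed

lemma (in brownian_motion) simple_right_measurable:
  assumes "simple_integrand M F n \<tau> \<xi>"
  shows "simple_right n \<tau> \<xi> s \<in> borel_measurable (F s)"
proof -
  have "(\<lambda>\<omega>. \<xi> i \<omega> * indicator {\<tau> i..<\<tau> (Suc i)} s) \<in> borel_measurable (F s)" if "i < n" for i
  proof (cases "\<tau> i \<le> s")
    case True
    have "\<xi> i \<in> borel_measurable (F s)"
      using assms that True F_measurable_mono[of "\<tau> i" s] by (auto simp: simple_integrand_def)
    then show ?thesis by simp
  qed simp
  then show ?thesis unfolding simple_right_def[abs_def] by (intro borel_measurable_sum) auto
qed

section \<open>Step functions and finite partitions\<close>

lemma has_integral_step: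
  fixes f :: "real \<Rightarrow> real"
  assumes "strict_mono_on {..N} \<sigma>"
    and "\<And>i s. i < N \<Longrightarrow> \<sigma> i < s \<Longrightarrow> s \<le> \<sigma> (Suc i) \<Longrightarrow> f s = c i"
  shows "(f has_integral (\<Sum>i<N. c i * (\<sigma> (Suc i) - \<sigma> i))) {\<sigma> 0..\<sigma> N}"
  using assms
proof (induction N)
  case (Suc N)
  have lt: "\<sigma> 0 \<le> \<sigma> N" "\<sigma> N < \<sigma> (Suc N)"
    using Suc.prems(1) by (cases N; auto simp: strict_mono_on_def less_imp_le)+
  have "((\<lambda>s. c N) has_integral (c N * (\<sigma> (Suc N) - \<sigma> N))) {\<sigma> N..\<sigma> (Suc N)}"
    using has_integral_const_real[of "c N" "\<sigma> N" "\<sigma> (Suc N)"] lt by (simp add: mult.commute)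
  \<comment> \<open>The left end point carries the value of the preceding interval; a single point
    does not affect the integral.\<close>
  then have "(f has_integral (c N * (\<sigma> (Suc N) - \<sigma> N))) {\<sigma> N..\<sigma> (Suc N)}"
    by (rule has_integral_spike_finite[of "{\<sigma> N}", rotated 2]) (use Suc.prems(2)[of N] in auto)
  moreover have "(f has_integral (\<Sum>i<N. c i * (\<sigma> (Suc i) - \<sigma> i))) {\<sigma> 0..\<sigma> N}"
    using Suc.prems by (intro Suc.IH) (auto simp: strict_mono_on_def)
  ultimately show ?case
    using has_integral_combine[OF lt(1) less_imp_le[OF lt(2)], of f] by simp
qed (simp add: has_integral_refl)

text \<open>Merges the knots of several simple processes with prescribed times into one increasing
  grid, between whose neighbours no knot can lie.\<close>

lemma finite_set_partition:
  fixes P :: "'b :: linorder set"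
  assumes "finite P" "P \<noteq> {}"
  obtains N \<sigma> where "strict_mono_on {..N} \<sigma>" "\<sigma> ` {..N} = P" "\<sigma> 0 = Min P" "\<sigma> N = Max P"
    "\<And>p j. p \<in> P \<Longrightarrow> j < N \<Longrightarrow> p \<notin> {\<sigma> j<..<\<sigma> (Suc j)}"
proof -
  define \<sigma> where "\<sigma> i = sorted_list_of_set P ! i" for i
  define N where "N = card P - 1"
  have len: "length (sorted_list_of_set P) = Suc N"
    using assms by (simp add: N_def card_gt_0_iff)
  have mono: "strict_mono_on {..N} \<sigma>"
    unfolding \<sigma>_def strict_mono_on_def
    using strict_sorted_list_of_set[of P] len by (auto simp: sorted_wrt_iff_nth_less)
  have im: "\<sigma> ` {..N} = P"
    using nth_image[of "Suc N" "sorted_list_of_set P"] len assms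
    by (simp add: \<sigma>_def[abs_def] atLeast0LessThan lessThan_Suc_atMost)
  have le: "\<sigma> i \<le> \<sigma> j \<longleftrightarrow> i \<le> j" if "i \<le> N" "j \<le> N" for i j
    using strict_mono_on_less_eq[OF mono] that by auto
  have "Min P = \<sigma> 0"
    unfolding im[symmetric] using le by (intro Min_eqI) auto
  moreover have "Max P = \<sigma> N"
    unfolding im[symmetric] using le by (intro Max_eqI) auto
  moreover have "p \<notin> {\<sigma> j<..<\<sigma> (Suc j)}" if p: "p \<in> P" "j < N" for p j
  proof -
    obtain i where "i \<le> N" "p = \<sigma> i"
      using p(1) im by auto
    then show ?thesis using le[of i j] le[of "Suc j" i] p(2)
      by (cases "i \<le> j") (simp_all add: Suc_le_eq leD)
  qed
  ultimately show ?thesis using mono im by (intro that[of N \<sigma>]) simp_all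
qed

section \<open>Uniform approximation of the stochastic integral\<close>

text \<open>Truncating at 1 turns convergence in probability into convergence in mean, which has an
  almost surely convergent subsequence. Once the truncated values are below 1 they are the true
  ones.\<close>

lemma (in prob_space) tendsto_in_probability_AE_subseq:
  assumes "tendsto_in_probability M Y (\<lambda>\<omega>. 0)"
  obtains r where "strict_mono r" "AE \<omega> in M. (\<lambda>k. Y (r k) \<omega>) \<longlonglongrightarrow> 0"
proof -
  define u where "u k \<omega> = min 1 \<bar>Y k \<omega>\<bar>" for k \<omega>
  have [measurable]: "Y k \<in> borel_measurable M" for k
    using assms by (simp add: tendsto_in_probability_def)
  have prob_lim: "(\<lambda>k. prob {\<omega> \<in> space M. \<bar>Y k \<omega>\<bar> > \<epsilon>}) \<longlonglongrightarrow> 0" if "\<epsilon> > 0" for \<epsilon>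
    using assms that by (simp add: tendsto_in_probability_def)
  have [measurable]: "u k \<in> borel_measurable M" for k
    unfolding u_def[abs_def] by measurable
  have int: "integrable M (u k)" for k
    by (rule integrable_const_bound[where B = 1]) (auto simp: u_def)
  have le: "(\<integral>\<omega>. norm (u k \<omega>) \<partial>M) \<le> \<epsilon> + prob {\<omega> \<in> space M. \<bar>Y k \<omega>\<bar> > \<epsilon>}" if "\<epsilon> > 0" for k \<epsilon>
  proof -
    have ind: "integrable M (indicator {\<omega> \<in> space M. \<bar>Y k \<omega>\<bar> > \<epsilon>} :: 'a \<Rightarrow> real)"
      by (intro integrable_real_indicator) (auto simp: emeasure_eq_measure)
    then have "(\<integral>\<omega>. norm (u k \<omega>) \<partial>M) \<le> (\<integral>\<omega>. \<epsilon> + indicator {\<omega> \<in> space M. \<bar>Y k \<omega>\<bar> > \<epsilon>} \<omega> \<partial>M)"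
      using that by (intro integral_mono integrable_norm int Bochner_Integration.integrable_add ind) (auto simp: u_def indicator_def)
    also have "\<dots> = \<epsilon> + prob {\<omega> \<in> space M. \<bar>Y k \<omega>\<bar> > \<epsilon>}"
      using ind by (subst Bochner_Integration.integral_add) (auto simp: prob_space)
    finally show ?thesis .
  qed
  have "(\<lambda>k. \<integral>\<omega>. norm (u k \<omega>) \<partial>M) \<longlonglongrightarrow> 0"
  proof (rule LIMSEQ_I)
    fix \<epsilon> :: real assume "0 < \<epsilon>"
    then have "\<forall>\<^sub>F k in sequentially. prob {\<omega> \<in> space M. \<bar>Y k \<omega>\<bar> > \<epsilon> / 2} < \<epsilon> / 2"
      by (intro order_tendstoD(2)[OF prob_lim]) auto
    then obtain k0 where "\<And>k. k \<ge> k0 \<Longrightarrow> prob {\<omega> \<in> space M. \<bar>Y k \<omega>\<bar> > \<epsilon> / 2} < \<epsilon> / 2"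
      by (auto simp: eventually_sequentially)
    then have "\<bar>\<integral>\<omega>. norm (u k \<omega>) \<partial>M\<bar> < \<epsilon>" if "k \<ge> k0" for k
      using le[of "\<epsilon> / 2" k] \<open>0 < \<epsilon>\<close> that by (fastforce simp: abs_of_nonneg integral_nonneg)
    then show "\<exists>no. \<forall>k\<ge>no. norm ((\<integral>\<omega>. norm (u k \<omega>) \<partial>M) - 0) < \<epsilon>" by auto
  qed
  then obtain r where r: "strict_mono r" "AE \<omega> in M. (\<lambda>k. u (r k) \<omega>) \<longlonglongrightarrow> 0"
    using tendsto_L1_AE_subseq[of M u, OF int] by blast
  have lim: "(\<lambda>k. Y (r k) \<omega>) \<longlonglongrightarrow> 0" if u0: "(\<lambda>k. u (r k) \<omega>) \<longlonglongrightarrow> 0" for \<omega>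
  proof -
    have "\<forall>\<^sub>F k in sequentially. u (r k) \<omega> < 1"
      using order_tendstoD(2)[OF u0, of 1] by simp
    then have "\<forall>\<^sub>F k in sequentially. u (r k) \<omega> = \<bar>Y (r k) \<omega>\<bar>"
      by eventually_elim (auto simp: u_def min_def split: if_splits)
    then have "(\<lambda>k. \<bar>Y (r k) \<omega>\<bar>) \<longlonglongrightarrow> 0"
      using u0 by (simp cong: filterlim_cong)
    then show ?thesis by (simp add: tendsto_rabs_zero_iff)
  qed
  have "AE \<omega> in M. (\<lambda>k. Y (r k) \<omega>) \<longlonglongrightarrow> 0"
    using r(2) by eventually_elim (rule lim)
  then show thesis using that r(1) by blast
qed

lemma tendsto_in_probability_subseq:
  assumes "tendsto_in_probability M Y Z" "strict_mono r"
  shows "tendsto_in_probability M (\<lambda>k. Y (r k)) Z"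
  unfolding tendsto_in_probability_def
proof (intro conjI allI impI)
  fix \<epsilon> :: real assume "\<epsilon> > 0"
  then have "(\<lambda>k. measure M {\<omega> \<in> space M. \<bar>Y k \<omega> - Z \<omega>\<bar> > \<epsilon>}) \<longlonglongrightarrow> 0"
    using assms(1) by (simp add: tendsto_in_probability_def)
  from LIMSEQ_subseq_LIMSEQ[OF this assms(2)]
  show "(\<lambda>k. measure M {\<omega> \<in> space M. \<bar>Y (r k) \<omega> - Z \<omega>\<bar> > \<epsilon>}) \<longlonglongrightarrow> 0"
    by (simp add: comp_def)
qed (use assms in \<open>auto simp: tendsto_in_probability_def\<close>)

text \<open>Ensures that the approximation error is a genuine integral rather than the default value
  0 of a nonintegrable function, and that it may be read as a gauge integral.\<close>

lemma set_integrable_simple_process_diff: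
  fixes h :: "real \<Rightarrow> real"
  assumes "continuous_on {0..t} h"
  shows "set_integrable lborel {0..t} (\<lambda>s. (simple_process n \<tau> \<xi> s \<omega> - h s)\<^sup>2)"
proof -
  let ?K = "\<lambda>s. simple_process n \<tau> \<xi> s \<omega>"
  obtain C where C: "\<And>s. s \<in> {0..t} \<Longrightarrow> norm (h s) \<le> C"
    using compact_imp_bounded[OF compact_continuous_image[OF assms compact_Icc]]
    unfolding bounded_iff by blast
  have K: "norm (?K s) \<le> (\<Sum>i<n. \<bar>\<xi> i \<omega>\<bar>)" for s
    unfolding simple_process_def real_norm_def
    by (intro order_trans[OF sum_abs] sum_mono) (auto simp: indicator_def)
  have [measurable]: "(\<lambda>s. indicator {0..t} s *\<^sub>R h s) \<in> borel_measurable borel"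
    using assms by (intro borel_measurable_continuous_on_indicator) auto
  have [measurable]: "?K \<in> borel_measurable borel"
    unfolding simple_process_def by measurable
  have eq: "indicator {0..t} s *\<^sub>R (?K s - h s)\<^sup>2 = (indicator {0..t} s * ?K s - indicator {0..t} s *\<^sub>R h s)\<^sup>2" for s
    by (auto simp: indicator_def)
  have "(\<lambda>s. indicator {0..t} s *\<^sub>R (?K s - h s)\<^sup>2) \<in> borel_measurable borel"
    unfolding eq by measurable
  moreover have "norm ((?K s - h s)\<^sup>2) \<le> ((\<Sum>i<n. \<bar>\<xi> i \<omega>\<bar>) + C)\<^sup>2" if "s \<in> {0..t}" for s
  proof -
    have "\<bar>?K s - h s\<bar> \<le> (\<Sum>i<n. \<bar>\<xi> i \<omega>\<bar>) + C"
      using K[of s] C[OF that] by simp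
    then show ?thesis using power_mono[of "\<bar>?K s - h s\<bar>" _ 2] by simp
  qed
  ultimately show ?thesis
    unfolding set_integrable_def
    by (intro integrableI_bounded_set[where A = "{0..t}" and B = "((\<Sum>i<n. \<bar>\<xi> i \<omega>\<bar>) + C)\<^sup>2"])
      (auto simp: indicator_def emeasure_lborel_Icc_eq)
qed

section \<open>Simple integrals compared with the stochastic integral\<close>

locale ito_approximation = brownian_motion M F B
  for M :: "'a measure" and F B +
  fixes H I :: "real \<Rightarrow> 'a \<Rightarrow> real" and n :: "nat \<Rightarrow> nat" and \<tau> :: "nat \<Rightarrow> nat \<Rightarrow> real"
    and \<xi> :: "nat \<Rightarrow> nat \<Rightarrow> 'a \<Rightarrow> real" and t :: real
  assumes t_nonneg: "0 \<le> t"
    and simple: "\<And>k. simple_integrand M F (n k) (\<tau> k) (\<xi> k)"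
    and L2_lim: "tendsto_in_probability M
           (\<lambda>k \<omega>. LBINT s:{0..t}. (simple_process (n k) (\<tau> k) (\<xi> k) s \<omega> - H s \<omega>)\<^sup>2) (\<lambda>\<omega>. 0)"
    and integral_lim: "\<And>s. 0 \<le> s \<Longrightarrow> tendsto_in_probability M
           (\<lambda>k. simple_integral B (n k) (\<tau> k) (\<xi> k) s) (I s)"
    and H_cont: "\<And>\<omega>. \<omega> \<in> space M \<Longrightarrow> continuous_on {0..t} (\<lambda>s. H s \<omega>)"
begin

abbreviation "K k \<equiv> simple_process (n k) (\<tau> k) (\<xi> k)"
abbreviation "J k \<equiv> simple_integral B (n k) (\<tau> k) (\<xi> k)"
abbreviation "R k \<equiv> simple_right (n k) (\<tau> k) (\<xi> k)"

definition err :: "nat \<Rightarrow> 'a \<Rightarrow> real" where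
  "err k \<omega> = (LBINT s:{0..t}. (K k s \<omega> - H s \<omega>)\<^sup>2)"

lemma err_measurable [measurable]: "err k \<in> borel_measurable M"
  using L2_lim unfolding err_def[abs_def] tendsto_in_probability_def by blast

lemma I_measurable: "0 \<le> s \<Longrightarrow> I s \<in> borel_measurable M"
  and J_measurable: "0 \<le> s \<Longrightarrow> J k s \<in> borel_measurable M"
  using integral_lim unfolding tendsto_in_probability_def by blast+

lemma err_integral:
  assumes "\<omega> \<in> space M"
  shows "(\<lambda>s. (K k s \<omega> - H s \<omega>)\<^sup>2) integrable_on {0..t}"
    and "err k \<omega> = integral {0..t} (\<lambda>s. (K k s \<omega> - H s \<omega>)\<^sup>2)"
  using set_borel_integral_eq_integral[OF set_integrable_simple_process_diff[OF H_cont[OF assms]]]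
  by (auto simp: err_def)

lemma err_nonneg: "\<omega> \<in> space M \<Longrightarrow> 0 \<le> err k \<omega>"
  by (simp add: err_integral integral_nonneg)

lemma err_prob_lim:
  assumes "0 < c"
  shows "(\<lambda>k. prob {\<omega> \<in> space M. err k \<omega> > c}) \<longlonglongrightarrow> 0"
proof -
  have eq: "{\<omega> \<in> space M. \<bar>err k \<omega> - 0\<bar> > c} = {\<omega> \<in> space M. err k \<omega> > c}" for k
    using err_nonneg by force
  have "tendsto_in_probability M err (\<lambda>\<omega>. 0)"
    using L2_lim unfolding err_def[abs_def] .
  then have "(\<lambda>k. prob {\<omega> \<in> space M. \<bar>err k \<omega> - 0\<bar> > c}) \<longlonglongrightarrow> 0"
    using assms unfolding tendsto_in_probability_def by blast
  then show ?thesis unfolding eq .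
qed

lemma K_partition:
  assumes "\<And>i j. i \<le> n k \<Longrightarrow> j < N \<Longrightarrow> \<tau> k i \<notin> {\<sigma> j<..<\<sigma> (Suc j)}"
    and "j < N" "\<sigma> j < s" "s \<le> \<sigma> (Suc j)"
  shows "K k s \<omega> = R k (\<sigma> j) \<omega>"
  using assms by (intro simple_process_eq_simple_right[where b = "\<sigma> (Suc j)"]) auto

text \<open>Both simple processes are compared with the common limit \<open>H\<close>; the
  parallelogram identity supplies the factors 2. The sum is exactly the integral of
  \<open>(K k - K k')\<^sup>2\<close>, because the partition separates all knots.\<close>

lemma sum_square_diff_le:
  assumes "\<sigma> 0 = 0" "strict_mono_on {..N} \<sigma>" "\<sigma> N = t"
    and "\<And>i j. i \<le> n k \<Longrightarrow> j < N \<Longrightarrow> \<tau> k i \<notin> {\<sigma> j<..<\<sigma> (Suc j)}"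
    and "\<And>i j. i \<le> n k' \<Longrightarrow> j < N \<Longrightarrow> \<tau> k' i \<notin> {\<sigma> j<..<\<sigma> (Suc j)}"
    and "\<omega> \<in> space M"
  shows "(\<Sum>i<N. (R k (\<sigma> i) \<omega> - R k' (\<sigma> i) \<omega>)\<^sup>2 * (\<sigma> (Suc i) - \<sigma> i)) \<le> 2 * err k \<omega> + 2 * err k' \<omega>"
proof -
  have "((\<lambda>s. (K k s \<omega> - K k' s \<omega>)\<^sup>2) has_integral
    (\<Sum>i<N. (R k (\<sigma> i) \<omega> - R k' (\<sigma> i) \<omega>)\<^sup>2 * (\<sigma> (Suc i) - \<sigma> i))) {\<sigma> 0..\<sigma> N}"
  proof (intro has_integral_step assms)
    fix i s assume "i < N" "\<sigma> i < s" "s \<le> \<sigma> (Suc i)"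
    then have "K k s \<omega> = R k (\<sigma> i) \<omega>" "K k' s \<omega> = R k' (\<sigma> i) \<omega>"
      using assms(4,5) by (intro K_partition[of _ N]; simp)+
    then show "(K k s \<omega> - K k' s \<omega>)\<^sup>2 = (R k (\<sigma> i) \<omega> - R k' (\<sigma> i) \<omega>)\<^sup>2" by simp
  qed
  then have step: "((\<lambda>s. (K k s \<omega> - K k' s \<omega>)\<^sup>2) has_integral
    (\<Sum>i<N. (R k (\<sigma> i) \<omega> - R k' (\<sigma> i) \<omega>)\<^sup>2 * (\<sigma> (Suc i) - \<sigma> i))) {0..t}"
    using assms by simp
  have "((\<lambda>s. 2 * (K k s \<omega> - H s \<omega>)\<^sup>2 + 2 * (K k' s \<omega> - H s \<omega>)\<^sup>2) has_integral
    2 * err k \<omega> + 2 * err k' \<omega>) {0..t}"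
    using err_integral[OF assms(6)] by (intro has_integral_add has_integral_mult_right) auto
  then show ?thesis
  proof (rule has_integral_le[OF step])
    fix s
    have "2 * (K k s \<omega> - H s \<omega>)\<^sup>2 + 2 * (K k' s \<omega> - H s \<omega>)\<^sup>2 - (K k s \<omega> - K k' s \<omega>)\<^sup>2
      = (K k s \<omega> + K k' s \<omega> - 2 * H s \<omega>)\<^sup>2"
      by (simp add: power2_eq_square algebra_simps)
    then show "(K k s \<omega> - K k' s \<omega>)\<^sup>2 \<le> 2 * (K k s \<omega> - H s \<omega>)\<^sup>2 + 2 * (K k' s \<omega> - H s \<omega>)\<^sup>2"
      by (metis diff_ge_0_iff_ge zero_le_power2)
  qed
qed

lemma partition_exists:
  assumes "finite P" "P \<subseteq> {0..t}"
  obtains N \<sigma> where "strict_mono_on {..N} \<sigma>" "\<sigma> 0 = 0" "\<sigma> N = t" "P \<subseteq> \<sigma> ` {..N}" "\<sigma> ` {..N} \<subseteq> {0..t}"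
    "\<And>p j. p \<in> P \<Longrightarrow> j < N \<Longrightarrow> p \<notin> {\<sigma> j<..<\<sigma> (Suc j)}"
proof -
  let ?P = "insert 0 (insert t P)"
  have fin: "finite ?P" "?P \<noteq> {}" using assms by auto
  have "Min ?P = 0" "Max ?P = t"
    using assms t_nonneg by (intro Min_eqI Max_eqI; force)+
  moreover obtain N \<sigma> where "strict_mono_on {..N} \<sigma>" "\<sigma> ` {..N} = ?P" "\<sigma> 0 = Min ?P" "\<sigma> N = Max ?P"
    "\<And>p j. p \<in> ?P \<Longrightarrow> j < N \<Longrightarrow> p \<notin> {\<sigma> j<..<\<sigma> (Suc j)}"
    using finite_set_partition[OF fin] by metis
  ultimately show ?thesis
    using assms t_nonneg by (intro that[of N \<sigma>]) auto
qed

text \<open>Knots beyond the horizon are dropped so that partitions stay inside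
  \<open>{0..t}\<close>; a dropped knot cannot fall between two partition points.\<close>

definition knots :: "nat \<Rightarrow> real set" where
  "knots k = \<tau> k ` {..n k} \<inter> {0..t}"

lemma finite_knots [simp]: "finite (knots k)" and knots_subset: "knots k \<subseteq> {0..t}"
  by (auto simp: knots_def)

lemma knots_partition:
  assumes "\<And>p. p \<in> knots k \<Longrightarrow> p \<notin> {\<sigma> j<..<\<sigma> (Suc j)}"
    and "\<sigma> ` {..N} \<subseteq> {0..t}" "j < N" "i \<le> n k"
  shows "\<tau> k i \<notin> {\<sigma> j<..<\<sigma> (Suc j)}"
proof
  assume *: "\<tau> k i \<in> {\<sigma> j<..<\<sigma> (Suc j)}"
  have "\<sigma> j \<in> {0..t}" "\<sigma> (Suc j) \<in> {0..t}"
    using assms(2,3) unfolding image_subset_iff by simp_all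
  then have "\<tau> k i \<in> knots k" using * assms(4) by (auto simp: knots_def)
  then show False using assms(1) * by blast
qed

text \<open>The maximal inequality on a grid through \<open>P\<close> and all knots. Errors of at
  most \<open>\<eta> / 4\<close> each keep the quadratic variation of the difference below
  \<open>2 * \<eta> / 4 + 2 * \<eta> / 4 = \<eta>\<close>. The bound does not depend on
  \<open>P\<close>.\<close>

lemma prob_simple_integral_diff:
  assumes "finite P" "P \<subseteq> {0..t}" "0 < \<epsilon>" "0 < \<eta>"
  shows "prob {\<omega> \<in> space M. \<exists>s\<in>P. \<bar>J k s \<omega> - J k' s \<omega>\<bar> > \<epsilon>}
    \<le> prob {\<omega> \<in> space M. err k \<omega> > \<eta> / 4} + prob {\<omega> \<in> space M. err k' \<omega> > \<eta> / 4} + 2 * exp (- \<epsilon>\<^sup>2 / (2 * \<eta>))"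
proof -
  obtain N \<sigma> where \<sigma>: "strict_mono_on {..N} \<sigma>" "\<sigma> 0 = 0" "\<sigma> N = t"
    "P \<union> knots k \<union> knots k' \<subseteq> \<sigma> ` {..N}" "\<sigma> ` {..N} \<subseteq> {0..t}"
    and avoid: "\<And>p j. p \<in> P \<union> knots k \<union> knots k' \<Longrightarrow> j < N \<Longrightarrow> p \<notin> {\<sigma> j<..<\<sigma> (Suc j)}"
    using partition_exists[of "P \<union> knots k \<union> knots k'"] assms knots_subset by auto
  have k: "\<tau> k i \<notin> {\<sigma> j<..<\<sigma> (Suc j)}" if "i \<le> n k" "j < N" for i j
    by (rule knots_partition[OF _ \<sigma>(5) that(2,1)]) (use avoid that(2) in blast)
  have k': "\<tau> k' i \<notin> {\<sigma> j<..<\<sigma> (Suc j)}" if "i \<le> n k'" "j < N" for i j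
    by (rule knots_partition[OF _ \<sigma>(5) that(2,1)]) (use avoid that(2) in blast)
  let ?q = "\<lambda>i \<omega>. R k (\<sigma> i) \<omega> - R k' (\<sigma> i) \<omega>"
  let ?S = "\<lambda>m \<omega>. \<Sum>i<m. ?q i \<omega> * (B (\<sigma> (Suc i)) \<omega> - B (\<sigma> i) \<omega>)"
  let ?Q = "\<lambda>\<omega>. \<Sum>i<N. (?q i \<omega>)\<^sup>2 * (\<sigma> (Suc i) - \<sigma> i)"
  have q: "?q i \<in> borel_measurable (F (\<sigma> i))" for i
    using simple by (intro borel_measurable_diff simple_right_measurable)
  have S: "J k (\<sigma> m) \<omega> - J k' (\<sigma> m) \<omega> = ?S m \<omega>" if "m \<le> N" for m \<omega>
    using simple_integral_partition[OF simple \<sigma>(2,1) k that] simple_integral_partition[OF simple \<sigma>(2,1) k' that]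
    by (simp add: sum_subtractf[symmetric] left_diff_distrib)
  have S_meas: "?S m \<in> borel_measurable M" if "m \<le> N" for m
    using measurable_sum_increments(1)[of \<sigma> N m ?q] F_measurable_M q \<sigma> that by auto
  have "prob {\<omega> \<in> space M. \<exists>s\<in>P. \<bar>J k s \<omega> - J k' s \<omega>\<bar> > \<epsilon>} \<le> prob {\<omega> \<in> space M. \<exists>m\<le>N. \<bar>?S m \<omega>\<bar> > \<epsilon>}"
  proof (rule finite_measure_mono)
    show "{\<omega> \<in> space M. \<exists>s\<in>P. \<bar>J k s \<omega> - J k' s \<omega>\<bar> > \<epsilon>} \<subseteq> {\<omega> \<in> space M. \<exists>m\<le>N. \<bar>?S m \<omega>\<bar> > \<epsilon>}"
    proof (intro Collect_mono impI conjI; elim conjE bexE)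
      fix \<omega> s assume "s \<in> P" and gt: "\<bar>J k s \<omega> - J k' s \<omega>\<bar> > \<epsilon>"
      then obtain m where "m \<le> N" "s = \<sigma> m" using \<sigma>(4) by auto
      then show "\<exists>m\<le>N. \<bar>?S m \<omega>\<bar> > \<epsilon>" using S gt by (intro exI[of _ m]) simp
    qed
    have "{\<omega> \<in> space M. \<exists>m\<in>{..N}. \<bar>?S m \<omega>\<bar> > \<epsilon>} \<in> sets M"
      using S_meas by (intro sets.sets_Collect_finite_Ex borel_measurable_less) auto
    then show "{\<omega> \<in> space M. \<exists>m\<le>N. \<bar>?S m \<omega>\<bar> > \<epsilon>} \<in> sets M" by (simp only: Bex_def atMost_iff)
  qed
  also have "\<dots> \<le> prob {\<omega> \<in> space M. ?Q \<omega> > \<eta>} + 2 * exp (- \<epsilon>\<^sup>2 / (2 * \<eta>))"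
    using \<sigma> q assms by (intro maximal_inequality) auto
  also have "prob {\<omega> \<in> space M. ?Q \<omega> > \<eta>}
      \<le> prob ({\<omega> \<in> space M. err k \<omega> > \<eta> / 4} \<union> {\<omega> \<in> space M. err k' \<omega> > \<eta> / 4})"
    using sum_square_diff_le[OF \<sigma>(2,1,3) k k'] by (intro finite_measure_mono) fastforce+
  also have "\<dots> \<le> prob {\<omega> \<in> space M. err k \<omega> > \<eta> / 4} + prob {\<omega> \<in> space M. err k' \<omega> > \<eta> / 4}"
    by (rule measure_Un_le) auto
  finally show ?thesis by simp
qed

text \<open>Compare with a second index \<open>k'\<close> and let it tend to infinity. On the finite
  set \<open>P\<close> convergence at each single time is enough, and the bound for
  \<open>J k - J k'\<close> is the same for all \<open>P\<close>.\<close>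

lemma prob_simple_integral_error:
  assumes "finite P" "P \<subseteq> {0..t}" "0 < \<epsilon>" "0 < \<eta>"
  shows "prob {\<omega> \<in> space M. \<exists>s\<in>P. \<bar>J k s \<omega> - I s \<omega>\<bar> > 2 * \<epsilon>}
    \<le> prob {\<omega> \<in> space M. err k \<omega> > \<eta> / 4} + 2 * exp (- \<epsilon>\<^sup>2 / (2 * \<eta>))"
proof -
  have meas: "I s \<in> borel_measurable M" "J k s \<in> borel_measurable M" if "s \<in> P" for s k
    using that assms(2) by (intro I_measurable J_measurable; force)+
  let ?A = "{\<omega> \<in> space M. \<exists>s\<in>P. \<bar>J k s \<omega> - I s \<omega>\<bar> > 2 * \<epsilon>}"
  let ?c = "\<lambda>k'. prob {\<omega> \<in> space M. err k \<omega> > \<eta> / 4} + prob {\<omega> \<in> space M. err k' \<omega> > \<eta> / 4} + 2 * exp (- \<epsilon>\<^sup>2 / (2 * \<eta>))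
     + (\<Sum>s\<in>P. prob {\<omega> \<in> space M. \<bar>J k' s \<omega> - I s \<omega>\<bar> > \<epsilon>})"
  have le: "prob ?A \<le> ?c k'" for k'
  proof -
    let ?A1 = "{\<omega> \<in> space M. \<exists>s\<in>P. \<bar>J k s \<omega> - J k' s \<omega>\<bar> > \<epsilon>}"
    let ?A2 = "\<lambda>s. {\<omega> \<in> space M. \<bar>J k' s \<omega> - I s \<omega>\<bar> > \<epsilon>}"
    have A2: "?A2 s \<in> sets M" if "s \<in> P" for s
      using meas that by (intro borel_measurable_less) auto
    have A1: "?A1 \<in> sets M"
      using meas assms(1) by (intro sets.sets_Collect_finite_Ex borel_measurable_less) auto
    have "prob ?A \<le> prob (?A1 \<union> (\<Union>s\<in>P. ?A2 s))"
    proof (rule finite_measure_mono)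
      show "?A \<subseteq> ?A1 \<union> (\<Union>s\<in>P. ?A2 s)" by fastforce
      show "?A1 \<union> (\<Union>s\<in>P. ?A2 s) \<in> sets M"
        using A1 A2 assms(1) by (intro sets.Un sets.finite_UN) auto
    qed
    also have "\<dots> \<le> prob ?A1 + prob (\<Union>s\<in>P. ?A2 s)"
      using A1 A2 assms(1) by (intro measure_Un_le sets.finite_UN) auto
    also have "prob (\<Union>s\<in>P. ?A2 s) \<le> (\<Sum>s\<in>P. prob (?A2 s))"
      using A2 assms(1) by (intro measure_UNION_le) auto
    also have "prob ?A1 \<le> prob {\<omega> \<in> space M. err k \<omega> > \<eta> / 4} + prob {\<omega> \<in> space M. err k' \<omega> > \<eta> / 4} + 2 * exp (- \<epsilon>\<^sup>2 / (2 * \<eta>))"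
      by (rule prob_simple_integral_diff[OF assms])
    finally show ?thesis by simp
  qed
  have "(\<lambda>k'. prob {\<omega> \<in> space M. err k' \<omega> > \<eta> / 4}) \<longlonglongrightarrow> 0"
    using assms(4) by (intro err_prob_lim) simp
  moreover have "(\<lambda>k'. prob {\<omega> \<in> space M. \<bar>J k' s \<omega> - I s \<omega>\<bar> > \<epsilon>}) \<longlonglongrightarrow> 0" if "s \<in> P" for s
    using integral_lim[of s] that assms(2,3) by (auto simp: tendsto_in_probability_def)
  ultimately have "?c \<longlonglongrightarrow> prob {\<omega> \<in> space M. err k \<omega> > \<eta> / 4} + 0 + 2 * exp (- \<epsilon>\<^sup>2 / (2 * \<eta>)) + (\<Sum>s\<in>P. 0)"
    by (intro tendsto_intros)
  then have "prob ?A \<le> prob {\<omega> \<in> space M. err k \<omega> > \<eta> / 4} + 0 + 2 * exp (- \<epsilon>\<^sup>2 / (2 * \<eta>)) + (\<Sum>s\<in>P. 0)"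
    by (rule LIMSEQ_le_const) (use le in auto)
  then show ?thesis by simp
qed

text \<open>The sets \<open>T k\<close> may grow with \<open>k\<close>, since the preceding bound
  does not see the number of points. This replaces uniform convergence on the whole
  interval.\<close>

lemma tendsto_max_simple_integral_error:
  assumes "\<And>k. finite (T k)" "\<And>k. T k \<noteq> {}" "\<And>k. T k \<subseteq> {0..t}"
  shows "tendsto_in_probability M (\<lambda>k \<omega>. Max ((\<lambda>s. \<bar>J k s \<omega> - I s \<omega>\<bar>) ` T k)) (\<lambda>\<omega>. 0)"
proof -
  let ?D = "\<lambda>k \<omega>. Max ((\<lambda>s. \<bar>J k s \<omega> - I s \<omega>\<bar>) ` T k)"
  have meas: "?D k \<in> borel_measurable M" for k
  proof (rule borel_measurable_Max)
    fix s assume "s \<in> T k"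
    then have [measurable]: "I s \<in> borel_measurable M" "J k s \<in> borel_measurable M"
      using assms(3)[of k] by (intro I_measurable J_measurable; force)+
    show "(\<lambda>\<omega>. \<bar>J k s \<omega> - I s \<omega>\<bar>) \<in> borel_measurable M" by measurable
  qed (rule assms)
  have gt: "{\<omega> \<in> space M. \<bar>?D k \<omega> - 0\<bar> > \<epsilon>} = {\<omega> \<in> space M. \<exists>s\<in>T k. \<bar>J k s \<omega> - I s \<omega>\<bar> > \<epsilon>}" for k \<epsilon>
  proof -
    have "0 \<le> ?D k \<omega>" for \<omega>
      using assms(1,2)[of k] by (auto simp: Max_ge_iff)
    moreover have "?D k \<omega> > \<epsilon> \<longleftrightarrow> (\<exists>s\<in>T k. \<bar>J k s \<omega> - I s \<omega>\<bar> > \<epsilon>)" for \<omega>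
      using assms(1,2)[of k] by (subst Max_gr_iff) auto
    ultimately show ?thesis by (auto simp: abs_of_nonneg)
  qed
  have "(\<lambda>k. prob {\<omega> \<in> space M. \<exists>s\<in>T k. \<bar>J k s \<omega> - I s \<omega>\<bar> > \<epsilon>}) \<longlonglongrightarrow> 0" if "0 < \<epsilon>" for \<epsilon>
  proof (rule LIMSEQ_I)
    fix r :: real assume "0 < r"
    \<comment> \<open>\<open>\<eta>\<close> is chosen so that the exponential bound becomes
      \<open>exp (- L)\<close>, and \<open>exp (- L) < 1 / L = r / 4\<close>.\<close>
    define L where "L = 4 / r"
    define \<eta> where "\<eta> = (\<epsilon> / 2)\<^sup>2 / (2 * L)"
    have L: "0 < L" and \<eta>: "0 < \<eta>" using \<open>0 < r\<close> \<open>0 < \<epsilon>\<close> by (auto simp: L_def \<eta>_def)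
    have "- (\<epsilon> / 2)\<^sup>2 / (2 * \<eta>) = - L"
      using L \<open>0 < \<epsilon>\<close> by (simp add: \<eta>_def)
    moreover have "exp (- L) < r / 4"
    proof -
      have "L < exp L" using exp_ge_add_one_self[of L] by linarith
      then have "exp (- L) < inverse L" using L by (simp add: exp_minus)
      then show ?thesis by (simp add: L_def)
    qed
    ultimately have e: "2 * exp (- (\<epsilon> / 2)\<^sup>2 / (2 * \<eta>)) < r / 2" by simp
    have "\<forall>\<^sub>F k in sequentially. prob {\<omega> \<in> space M. err k \<omega> > \<eta> / 4} < r / 2"
      using \<eta> \<open>0 < r\<close> by (intro order_tendstoD(2)[OF err_prob_lim]) auto
    then obtain k0 where k0: "\<And>k. k \<ge> k0 \<Longrightarrow> prob {\<omega> \<in> space M. err k \<omega> > \<eta> / 4} < r / 2"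
      unfolding eventually_sequentially by blast
    have "prob {\<omega> \<in> space M. \<exists>s\<in>T k. \<bar>J k s \<omega> - I s \<omega>\<bar> > \<epsilon>} < r" if "k \<ge> k0" for k
      using prob_simple_integral_error[OF assms(1,3), of "\<epsilon> / 2" \<eta> k k] \<open>0 < \<epsilon>\<close> \<eta> e k0[OF that] by simp
    then show "\<exists>no. \<forall>k\<ge>no. norm (prob {\<omega> \<in> space M. \<exists>s\<in>T k. \<bar>J k s \<omega> - I s \<omega>\<bar> > \<epsilon>} - 0) < r"
      by auto
  qed
  then show ?thesis
    unfolding tendsto_in_probability_def gt using meas by simp
qed

lemma AE_subseq_simple_integral_error:
  assumes "\<And>k. finite (T k)" "\<And>k. T k \<noteq> {}" "\<And>k. T k \<subseteq> {0..t}"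
  obtains r where "strict_mono r"
    "AE \<omega> in M. (\<lambda>k. Max ((\<lambda>s. \<bar>J (r k) s \<omega> - I s \<omega>\<bar>) ` T (r k))) \<longlonglongrightarrow> 0"
    "AE \<omega> in M. (\<lambda>k. err (r k) \<omega>) \<longlonglongrightarrow> 0"
proof -
  let ?D = "\<lambda>k \<omega>. Max ((\<lambda>s. \<bar>J k s \<omega> - I s \<omega>\<bar>) ` T k)"
  obtain r where r: "strict_mono r" "AE \<omega> in M. (\<lambda>k. ?D (r k) \<omega>) \<longlonglongrightarrow> 0"
    using tendsto_in_probability_AE_subseq[OF tendsto_max_simple_integral_error[OF assms]] .
  obtain r' where r': "strict_mono r'" "AE \<omega> in M. (\<lambda>k. err (r (r' k)) \<omega>) \<longlonglongrightarrow> 0"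
    using tendsto_in_probability_AE_subseq[OF tendsto_in_probability_subseq[OF L2_lim r(1)]]
    unfolding err_def .
  have "AE \<omega> in M. (\<lambda>k. ?D (r (r' k)) \<omega>) \<longlonglongrightarrow> 0"
    using r(2)
  proof eventually_elim
    case (elim \<omega>)
    show ?case using LIMSEQ_subseq_LIMSEQ[OF elim r'(1)] by (simp add: comp_def)
  qed
  moreover have "strict_mono (\<lambda>k. r (r' k))"
    using strict_mono_o[OF r(1) r'(1)] by (simp add: comp_def)
  ultimately show thesis using that r'(2) by blast
qed

end

section \<open>The Riccati equation\<close>

text \<open>\<open>OU_a \<alpha> \<gamma>\<close> is the positive equilibrium of the Riccati
  equation; the other one is \<open>- (a + \<alpha>)\<close>, so the second inequality says that it
  is negative.\<close>

lemma OU_a_facts: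
  assumes "0 < \<gamma>"
  shows "0 < OU_a \<alpha> \<gamma>" "0 < OU_a \<alpha> \<gamma> + \<alpha>" "2 * (OU_a \<alpha> \<gamma>)\<^sup>2 + 2 * \<alpha> * OU_a \<alpha> \<gamma> = \<gamma>"
proof -
  have "\<bar>\<alpha>\<bar> < sqrt (\<alpha>\<^sup>2 + 2 * \<gamma>)"
    using assms by (intro real_less_rsqrt) simp
  then show "0 < OU_a \<alpha> \<gamma>" "0 < OU_a \<alpha> \<gamma> + \<alpha>"
    by (auto simp: OU_a_def field_simps)
  have "(sqrt (\<alpha>\<^sup>2 + 2 * \<gamma>))\<^sup>2 = \<alpha>\<^sup>2 + 2 * \<gamma>"
    using assms by (intro real_sqrt_pow2) (simp add: add_nonneg_nonneg)
  then show "2 * (OU_a \<alpha> \<gamma>)\<^sup>2 + 2 * \<alpha> * OU_a \<alpha> \<gamma> = \<gamma>"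
    by (simp add: OU_a_def power2_eq_square field_simps)
qed

text \<open>At time 0 the denominator equals \<open>2 * a + \<alpha>\<close>, and it grows with
  time. Hence \<open>\<phi>\<close> does not blow up on the half-line.\<close>

lemma OU_denominator_pos:
  fixes \<alpha> :: real
  assumes "0 < \<gamma>" "0 \<le> l" "0 \<le> s"
  defines "a \<equiv> OU_a \<alpha> \<gamma>"
  shows "0 < exp (2 * s * (\<alpha> + 2 * a)) * (a + \<alpha> + l) + a - l"
proof -
  have a: "0 < a" "0 < a + \<alpha>" using OU_a_facts[OF assms(1), of \<alpha>] by (simp_all add: a_def)
  have "1 \<le> exp (2 * s * (\<alpha> + 2 * a))" using a assms by simp
  then have "1 * (a + \<alpha> + l) \<le> exp (2 * s * (\<alpha> + 2 * a)) * (a + \<alpha> + l)"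
    using a assms by (intro mult_right_mono) auto
  then show ?thesis using a by simp
qed

lemma OU_phi_0: "0 < \<gamma> \<Longrightarrow> OU_phi \<alpha> \<gamma> 0 l = l"
  using OU_a_facts(1,2)[of \<gamma> \<alpha>] by (simp add: OU_phi_def Let_def add.commute)

lemma OU_psi_0: "OU_psi \<delta> \<alpha> \<gamma> 0 l = 0"
  by (simp add: OU_psi_def Let_def)

text \<open>Over the common denominator the numerator regroups into products of nonnegative factors.
  Together with the nonnegativity of \<open>X\<close> this bounds the exponent \<open>V\<close> from
  above.\<close>

lemma OU_phi_nonneg:
  assumes "0 < \<gamma>" "0 \<le> l" "0 \<le> s"
  shows "0 \<le> OU_phi \<alpha> \<gamma> s l"
proof -
  define a where "a = OU_a \<alpha> \<gamma>"
  define E where "E = exp (2 * s * (\<alpha> + 2 * a))"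
  define D where "D = E * (a + \<alpha> + l) + a - l"
  have a: "0 < a" "0 < a + \<alpha>" using OU_a_facts[OF assms(1), of \<alpha>] by (simp_all add: a_def)
  have D: "0 < D" using OU_denominator_pos[OF assms] by (simp add: D_def E_def a_def)
  have E: "1 \<le> E" using a assms by (simp add: E_def)
  have "OU_phi \<alpha> \<gamma> s l = a + (l - a) * (2 * a + \<alpha>) / D"
    by (simp add: OU_phi_def Let_def D_def E_def a_def)
  also have "\<dots> = (l * (a * E + (a + \<alpha>)) + a * (a + \<alpha>) * (E - 1)) / D"
    using D by (simp add: divide_simps) (simp add: D_def algebra_simps)
  also have "\<dots> \<ge> 0"
  proof -
    have "0 \<le> a * E" using a E by simp
    then have "0 \<le> a * E + (a + \<alpha>)" using a by linarith
    then have "0 \<le> l * (a * E + (a + \<alpha>))" using assms(2) by simp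
    moreover have "0 \<le> a * (a + \<alpha>) * (E - 1)" using a E by simp
    ultimately show ?thesis using D by simp
  qed
  finally show ?thesis .
qed

lemma OU_phi_deriv:
  assumes "0 < \<gamma>" "0 \<le> l" "0 \<le> s"
  shows "((\<lambda>s. OU_phi \<alpha> \<gamma> s l) has_real_derivative
    \<gamma> - 2 * (OU_phi \<alpha> \<gamma> s l)\<^sup>2 - 2 * \<alpha> * OU_phi \<alpha> \<gamma> s l) (at s within A)"
proof -
  define a where "a = OU_a \<alpha> \<gamma>"
  define c where "c = 2 * a + \<alpha>"
  define E where "E s = exp (2 * s * (\<alpha> + 2 * a))" for s
  define D where "D s = E s * (a + \<alpha> + l) + a - l" for s
  \<comment> \<open>The deviation of \<open>\<phi>\<close> from the equilibrium \<open>a\<close>.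
    Subtracting \<open>a\<close> removes the constant term of the Riccati equation and leaves the
    Bernoulli equation \<open>w' = - 2 * c * w - 2 * w\<^sup>2\<close>, solved by a multiple of
    \<open>1 / D\<close>.\<close>
  define w where "w = (l - a) * c / D s"
  have D: "0 < D s" using OU_denominator_pos[OF assms] by (simp add: D_def E_def a_def)
  have phi: "OU_phi \<alpha> \<gamma> s l = a + (l - a) * c / D s" for s
    by (simp add: OU_phi_def Let_def D_def E_def a_def c_def)
  have "(D has_real_derivative 2 * c * (D s + (l - a))) (at s within A)"
    unfolding D_def[abs_def] E_def
    by (auto intro!: derivative_eq_intros simp: c_def algebra_simps)
  then have "((\<lambda>s. a + (l - a) * c / D s) has_real_derivative
      - ((l - a) * c * (2 * c * (D s + (l - a)))) / (D s)\<^sup>2) (at s within A)"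
    using D by (auto intro!: derivative_eq_intros simp: power2_eq_square)
  moreover have "- ((l - a) * c * (2 * c * (D s + (l - a)))) / (D s)\<^sup>2 = - 2 * c * w - 2 * w\<^sup>2"
    using D by (simp add: w_def divide_simps) (simp add: power2_eq_square algebra_simps)
  moreover have "- 2 * c * w - 2 * w\<^sup>2 = \<gamma> - 2 * (a + w)\<^sup>2 - 2 * \<alpha> * (a + w)"
    using OU_a_facts(3)[OF assms(1), of \<alpha>] by (simp add: a_def[symmetric] c_def power2_eq_square algebra_simps)
  ultimately show ?thesis
    unfolding phi w_def by simp
qed

lemma OU_psi_deriv:
  assumes "0 < \<gamma>" "0 \<le> l" "0 \<le> s"
  shows "((\<lambda>s. OU_psi \<delta> \<alpha> \<gamma> s l) has_real_derivative \<delta> * OU_phi \<alpha> \<gamma> s l) (at s within {0..})"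
proof -
  define a where "a = OU_a \<alpha> \<gamma>"
  define c where "c = 2 * a + \<alpha>"
  define E where "E s = exp (2 * s * (\<alpha> + 2 * a))" for s
  define D where "D s = E s * (a + \<alpha> + l) + a - l" for s
  have c: "0 < c" using OU_a_facts[OF assms(1), of \<alpha>] by (simp add: a_def c_def)
  have D: "0 < D s" if "0 \<le> s" for s
    using OU_denominator_pos[OF assms(1,2) that] by (simp add: D_def E_def a_def)
  have phi: "OU_phi \<alpha> \<gamma> s l = a + (l - a) * c / D s"
    by (simp add: OU_phi_def Let_def D_def E_def a_def c_def)
  \<comment> \<open>The argument of the logarithm collapses to \<open>E s * c / D s\<close>, which
    is positive for nonnegative times; so the absolute value disappears and the logarithm splits.
    Hence the one-sided derivative at 0.\<close>
  have psi: "OU_psi \<delta> \<alpha> \<gamma> s l = \<delta> * a * s - \<delta> / 2 * (2 * s * c + ln c - ln (D s))" if "0 \<le> s" for s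
  proof -
    have "1 + (l - a) * (1 - E s) / D s = E s * c / D s"
      using D[OF that] by (simp add: divide_simps) (simp add: D_def c_def algebra_simps)
    moreover have "0 < E s * c / D s" using c D[OF that] by (simp add: E_def)
    moreover have "ln (E s * c / D s) = 2 * s * c + ln c - ln (D s)"
      using c D[OF that] by (simp add: ln_mult ln_div E_def c_def add.commute)
    moreover have "OU_psi \<delta> \<alpha> \<gamma> s l = \<delta> * a * s - \<delta> / 2 * ln \<bar>1 + (l - a) * (1 - E s) / D s\<bar>"
      by (simp add: OU_psi_def Let_def D_def E_def a_def add_ac)
    ultimately show ?thesis by (simp del: abs_divide abs_mult)
  qed
  have dD: "(D has_real_derivative 2 * c * (D s + (l - a))) (at s within {0..})"
    unfolding D_def[abs_def] E_def
    by (auto intro!: derivative_eq_intros simp: c_def algebra_simps)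
  have "((\<lambda>s. \<delta> * a * s - \<delta> / 2 * (2 * s * c + ln c - ln (D s))) has_real_derivative
      \<delta> * a - \<delta> / 2 * (2 * c - 2 * c * (D s + (l - a)) / D s)) (at s within {0..})"
    using D[OF assms(3)] dD by (auto intro!: derivative_eq_intros)
  moreover have "\<delta> * a - \<delta> / 2 * (2 * c - 2 * c * (D s + (l - a)) / D s) = \<delta> * OU_phi \<alpha> \<gamma> s l"
    unfolding phi using D[OF assms(3)] by (simp add: field_simps)
  ultimately show ?thesis
    using psi assms(3) by (auto elim!: has_field_derivative_transform_within[OF _ zero_less_one])
qed

lemma OU_reversed_derivs:
  fixes \<alpha> \<gamma> \<delta> l t :: real
  assumes "0 < \<gamma>" "0 \<le> l" "s \<in> {0..t}"
  defines "f \<equiv> \<lambda>s. OU_phi \<alpha> \<gamma> (t - s) l" and "g \<equiv> \<lambda>s. OU_psi \<delta> \<alpha> \<gamma> (t - s) l"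
  shows "(f has_real_derivative 2 * (f s)\<^sup>2 + 2 * \<alpha> * f s - \<gamma>) (at s within {0..t})"
    and "(g has_real_derivative - (\<delta> * f s)) (at s within {0..t})"
proof -
  have sub: "(\<lambda>s. t - s) ` {0..t} \<subseteq> {0..}" and ts: "0 \<le> t - s" using assms(3) by auto
  have r: "((\<lambda>s. t - s) has_real_derivative - 1) (at s within {0..t})"
    by (auto intro!: derivative_eq_intros)
  have "((\<lambda>s. OU_phi \<alpha> \<gamma> s l) \<circ> (\<lambda>s. t - s) has_real_derivative
     (\<gamma> - 2 * (f s)\<^sup>2 - 2 * \<alpha> * f s) * - 1) (at s within {0..t})"
    unfolding f_def by (rule DERIV_image_chain[OF OU_phi_deriv[OF assms(1,2) ts] r])
  then show "(f has_real_derivative 2 * (f s)\<^sup>2 + 2 * \<alpha> * f s - \<gamma>) (at s within {0..t})"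
    by (simp add: f_def comp_def algebra_simps)
  have "((\<lambda>s. OU_psi \<delta> \<alpha> \<gamma> s l) \<circ> (\<lambda>s. t - s) has_real_derivative
     (\<delta> * f s) * - 1) (at s within {0..t})"
    unfolding f_def
    by (rule DERIV_image_chain[OF has_field_derivative_subset[OF OU_psi_deriv[OF assms(1,2) ts] sub] r])
  then show "(g has_real_derivative - (\<delta> * f s)) (at s within {0..t})"
    by (simp add: g_def comp_def)
qed

text \<open>With \<open>V = - f X - g - \<gamma> \<integral> X\<close> and \<open>e = S - I\<close>, the Riccati equation for \<open>f\<close> turns an increment
  of \<open>V\<close> minus the corresponding increment of the discrete exponent into \<open>2 f\<^sub>u \<Delta>e\<close> plus the
  quadratic variation error plus the integral of \<open>X\<^sub>s p\<^sub>u - X\<^sub>v p\<^sub>s + \<delta> (f\<^sub>s - f\<^sub>u)\<close>, where \<open>p = f'\<close>.\<close>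

lemma exponent_increment_error:
  fixes f g X I S :: "real \<Rightarrow> real" and \<alpha> \<gamma> \<delta> q C :: real
  defines "p \<equiv> \<lambda>s. 2 * (f s)\<^sup>2 + 2 * \<alpha> * f s - \<gamma>"
    and "V \<equiv> \<lambda>s. - f s * X s - g s - \<gamma> * integral {0..s} X"
  assumes uv: "0 \<le> u" "u < v" "v \<le> t"
    and f: "\<And>s. s \<in> {0..t} \<Longrightarrow> (f has_real_derivative p s) (at s within {0..t})"
    and g: "\<And>s. s \<in> {0..t} \<Longrightarrow> (g has_real_derivative - (\<delta> * f s)) (at s within {0..t})"
    and X: "continuous_on {0..t} X"
    and sde: "\<And>s. s \<in> {0..t} \<Longrightarrow> X s = x + 2 * I s + integral {0..s} (\<lambda>r. \<delta> - 2 * \<alpha> * X r)"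
    and osc: "\<And>s. s \<in> {u..v} \<Longrightarrow> \<bar>X s - X v\<bar> \<le> \<epsilon>" "\<And>s. s \<in> {u..v} \<Longrightarrow> \<bar>f s - f u\<bar> \<le> \<epsilon>"
    and bounds: "\<And>s. s \<in> {0..t} \<Longrightarrow> \<bar>f s\<bar> \<le> C" "\<And>s. s \<in> {0..t} \<Longrightarrow> \<bar>X s\<bar> \<le> C" "\<And>s. s \<in> {0..t} \<Longrightarrow> \<bar>p s\<bar> \<le> C"
  shows "\<bar>(V v - V u) - (- 2 * f u * (S v - S u) - 2 * (f u)\<^sup>2 * q)
      - 2 * f u * ((S v - I v) - (S u - I u)) - 2 * (f u)\<^sup>2 * (q - (integral {0..v} X - integral {0..u} X))\<bar>
     \<le> (C * (4 * C + 2 * \<bar>\<alpha>\<bar>) + C + \<bar>\<delta>\<bar>) * \<epsilon> * (v - u)"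
proof -
  let ?A = "integral {0..v} X - integral {0..u} X"
  have sub: "{u..v} \<subseteq> {0..t}" using uv by auto
  have int: "X integrable_on {0..s}" if "s \<le> t" for s
    by (rule integrable_continuous_real) (use that in \<open>auto intro: continuous_on_subset[OF X]\<close>)
  have intuv: "X integrable_on {u..v}"
    by (rule integrable_continuous_real) (rule continuous_on_subset[OF X sub])
  have "integral {u..v} X = ?A"
    using Henstock_Kurzweil_Integration.integral_combine[of 0 u v X] uv int[of v] by simp
  then have hX: "(X has_integral ?A) {u..v}"
    using intuv by (simp add: has_integral_iff)
  have hp: "(p has_integral (f v - f u)) {u..v}"
    using uv
    by (intro fundamental_theorem_of_calculus)
      (auto simp: has_real_derivative_iff_has_vector_derivative[symmetric]
        intro!: has_field_derivative_subset[OF f sub])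
  have hf: "((\<lambda>s. - (\<delta> * f s)) has_integral (g v - g u)) {u..v}"
    using uv
    by (intro fundamental_theorem_of_calculus)
      (auto simp: has_real_derivative_iff_has_vector_derivative[symmetric]
        intro!: has_field_derivative_subset[OF g sub])
  have drift: "integral {0..s} (\<lambda>r. \<delta> - 2 * \<alpha> * X r) = \<delta> * s - 2 * \<alpha> * integral {0..s} X" if "s \<in> {0..t}" for s
    using int[of s] that by (subst Henstock_Kurzweil_Integration.integral_diff) (auto intro!: integrable_on_mult_right)
  have I: "2 * (I v - I u) = X v - X u - \<delta> * (v - u) + 2 * \<alpha> * ?A"
    using sde[of u] sde[of v] drift[of u] drift[of v] uv by (simp add: algebra_simps)
  have h: "((\<lambda>s. p u * X s - X v * p s - (- (\<delta> * f s)) - \<delta> * f u) has_integral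
      (p u * ?A - X v * (f v - f u) - (g v - g u) - \<delta> * f u * (v - u))) {u..v}"
    using has_integral_const_real[of "\<delta> * f u" u v] uv
    by (intro has_integral_diff has_integral_mult_right hX hp hf) (simp add: mult.commute)
  have "\<bar>p u * X s - X v * p s - (- (\<delta> * f s)) - \<delta> * f u\<bar> \<le> (C * (4 * C + 2 * \<bar>\<alpha>\<bar>) + C + \<bar>\<delta>\<bar>) * \<epsilon>"
    if s: "s \<in> {u..v}" for s
  proof -
    have s': "s \<in> {0..t}" "u \<in> {0..t}" using s sub uv by auto
    have \<epsilon>: "0 \<le> \<epsilon>" and C: "0 \<le> C" using osc(2)[of u] bounds(1)[of u] s' uv by auto
    have "p u - p s = (f u - f s) * (2 * (f u + f s) + 2 * \<alpha>)"
      by (simp add: p_def power2_eq_square algebra_simps)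
    then have "\<bar>p u - p s\<bar> = \<bar>f s - f u\<bar> * \<bar>2 * (f u + f s) + 2 * \<alpha>\<bar>"
      by (simp add: abs_mult abs_minus_commute)
    also have "\<dots> \<le> \<epsilon> * (4 * C + 2 * \<bar>\<alpha>\<bar>)"
      using bounds(1)[OF s'(1)] bounds(1)[OF s'(2)] by (intro mult_mono osc s) (auto simp: \<epsilon>)
    finally have "\<bar>X s * (p u - p s)\<bar> \<le> C * (\<epsilon> * (4 * C + 2 * \<bar>\<alpha>\<bar>))"
      unfolding abs_mult using bounds(2)[OF s'(1)] C by (intro mult_mono) auto
    moreover have "\<bar>(X s - X v) * p s\<bar> \<le> \<epsilon> * C"
      unfolding abs_mult using bounds(3)[OF s'(1)] osc(1)[OF s] \<epsilon> by (intro mult_mono) auto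
    moreover have "\<bar>\<delta> * (f s - f u)\<bar> \<le> \<bar>\<delta>\<bar> * \<epsilon>"
      unfolding abs_mult using osc(2)[OF s] by (intro mult_left_mono) auto
    moreover have "p u * X s - X v * p s - (- (\<delta> * f s)) - \<delta> * f u
        = X s * (p u - p s) + (X s - X v) * p s + \<delta> * (f s - f u)"
      by (simp add: algebra_simps)
    ultimately have "\<bar>p u * X s - X v * p s - (- (\<delta> * f s)) - \<delta> * f u\<bar>
        \<le> C * (\<epsilon> * (4 * C + 2 * \<bar>\<alpha>\<bar>)) + \<epsilon> * C + \<bar>\<delta>\<bar> * \<epsilon>"
      by linarith
    then show ?thesis by (simp add: algebra_simps)
  qed
  moreover have "0 \<le> (C * (4 * C + 2 * \<bar>\<alpha>\<bar>) + C + \<bar>\<delta>\<bar>) * \<epsilon>"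
    using osc(2)[of u] bounds(1)[of u] uv by (intro mult_nonneg_nonneg add_nonneg_nonneg) auto
  ultimately have "\<bar>p u * ?A - X v * (f v - f u) - (g v - g u) - \<delta> * f u * (v - u)\<bar>
      \<le> (C * (4 * C + 2 * \<bar>\<alpha>\<bar>) + C + \<bar>\<delta>\<bar>) * \<epsilon> * (v - u)"
    using has_integral_bound_real[OF _ finite.emptyI h] uv by simp
  moreover have "(V v - V u) - (- 2 * f u * (S v - S u) - 2 * (f u)\<^sup>2 * q)
      - 2 * f u * ((S v - I v) - (S u - I u)) - 2 * (f u)\<^sup>2 * (q - ?A)
    = - f v * X v + f u * X u - (g v - g u) - \<gamma> * ?A + f u * (2 * (I v - I u)) + 2 * (f u)\<^sup>2 * ?A"
    by (simp add: V_def algebra_simps)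
  \<comment> \<open>Discrete product rule: the increment of \<open>f X\<close> is
    \<open>f u * (X v - X u) + X v * (f v - f u)\<close>. The first part cancels against
    \<open>f u * (2 * (I v - I u))\<close> up to drift terms, and the drift completes
    \<open>2 * (f u)\<^sup>2 - \<gamma>\<close> to \<open>p u\<close>.\<close>
  moreover have "\<dots> = p u * ?A - X v * (f v - f u) - (g v - g u) - \<delta> * f u * (v - u)"
    unfolding I by (simp add: p_def power2_eq_square algebra_simps)
  ultimately show ?thesis by simp
qed

section \<open>Convergence of the exponent along a path\<close>

text \<open>Applied to \<open>e = S - I\<close>, which is uniformly small but has uncontrolled
  increments; the differences are moved to the Lipschitz coefficient.\<close>

lemma sum_by_parts:
  fixes a e :: "nat \<Rightarrow> real"
  shows "(\<Sum>i<m. a i * (e (Suc i) - e i)) = a m * e m - a 0 * e 0 - (\<Sum>i<m. e (Suc i) * (a (Suc i) - a i))"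
  by (induction m) (auto simp: algebra_simps)

text \<open>By Young's inequality \<open>\<bar>K\<^sup>2 - H\<^sup>2\<bar>\<close> is at most
  \<open>(1 + 1 / \<rho>) * (K - H)\<^sup>2 + \<rho> * H\<^sup>2\<close>, and the integrals of this
  majorant over the partition intervals telescope. The parameter \<open>\<rho>\<close> stays free:
  first \<open>e\<close> tends to 0, then \<open>\<rho>\<close> is made small.\<close>

lemma quadratic_variation_error:
  fixes H K :: "real \<Rightarrow> real"
  assumes H: "continuous_on {0..t} H"
    and \<sigma>: "strict_mono_on {..N} \<sigma>" "\<sigma> 0 = 0" "\<sigma> N = t"
    and K: "\<And>i s. i < N \<Longrightarrow> \<sigma> i < s \<Longrightarrow> s \<le> \<sigma> (Suc i) \<Longrightarrow> K s = \<kappa> i"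
    and err: "((\<lambda>s. (K s - H s)\<^sup>2) has_integral e) {0..t}"
    and "0 < \<rho>"
  shows "(\<Sum>i<N. \<bar>(\<kappa> i)\<^sup>2 * (\<sigma> (Suc i) - \<sigma> i)
           - (integral {0..\<sigma> (Suc i)} (\<lambda>s. (H s)\<^sup>2) - integral {0..\<sigma> i} (\<lambda>s. (H s)\<^sup>2))\<bar>)
         \<le> (1 + 1 / \<rho>) * e + \<rho> * integral {0..t} (\<lambda>s. (H s)\<^sup>2)"
proof -
  define G where "G s = (1 + 1 / \<rho>) * (K s - H s)\<^sup>2 + \<rho> * (H s)\<^sup>2" for s
  have le: "\<sigma> i \<le> \<sigma> j" if "i \<le> j" "j \<le> N" for i j
    using \<sigma>(1) that by (cases "i = j") (auto simp: strict_mono_on_def less_imp_le)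
  have H2: "continuous_on {0..t} (\<lambda>s. (H s)\<^sup>2)"
    by (intro continuous_intros H)
  then have intH2: "(\<lambda>s. (H s)\<^sup>2) integrable_on {0..t}"
    by (rule integrable_continuous_real)
  have "(G has_integral ((1 + 1 / \<rho>) * e + \<rho> * integral {0..t} (\<lambda>s. (H s)\<^sup>2))) {0..t}"
    unfolding G_def using err intH2 by (intro has_integral_add has_integral_mult_right) auto
  then have intG: "G integrable_on {0..t}"
    and G_total: "integral {0..t} G = (1 + 1 / \<rho>) * e + \<rho> * integral {0..t} (\<lambda>s. (H s)\<^sup>2)"
    by (auto simp: has_integral_iff)
  have summand: "\<bar>(\<kappa> i)\<^sup>2 * (\<sigma> (Suc i) - \<sigma> i)
           - (integral {0..\<sigma> (Suc i)} (\<lambda>s. (H s)\<^sup>2) - integral {0..\<sigma> i} (\<lambda>s. (H s)\<^sup>2))\<bar>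
         \<le> integral {0..\<sigma> (Suc i)} G - integral {0..\<sigma> i} G" if "i < N" for i
  proof -
    define u v where "u = \<sigma> i" and "v = \<sigma> (Suc i)"
    have uv: "0 \<le> u" "u \<le> v" "v \<le> t"
      using le[of 0 i] le[of i "Suc i"] le[of "Suc i" N] that \<sigma> by (auto simp: u_def v_def)
    have split: "(h has_integral (integral {0..v} h - integral {0..u} h)) {u..v}"
      if "h integrable_on {0..t}" for h :: "real \<Rightarrow> real"
    proof -
      have "h integrable_on {0..v}" "h integrable_on {u..v}"
        using uv by (auto intro: integrable_subinterval_real[OF that])
      then show ?thesis
        using Henstock_Kurzweil_Integration.integral_combine[of 0 u v h] uv
        by (simp add: has_integral_iff)
    qed
    have "((\<lambda>s. (\<kappa> i)\<^sup>2) has_integral (\<kappa> i)\<^sup>2 * (v - u)) {u..v}"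
      using has_integral_const_real[of "(\<kappa> i)\<^sup>2" u v] uv by (simp add: mult.commute)
    then have "((\<lambda>s. (K s)\<^sup>2) has_integral (\<kappa> i)\<^sup>2 * (v - u)) {u..v}"
      by (rule has_integral_spike_finite[of "{u}", rotated 2]) (use K[OF that] in \<open>auto simp: u_def v_def\<close>)
    then have diff: "((\<lambda>s. (K s)\<^sup>2 - (H s)\<^sup>2) has_integral ((\<kappa> i)\<^sup>2 * (v - u)
        - (integral {0..v} (\<lambda>s. (H s)\<^sup>2) - integral {0..u} (\<lambda>s. (H s)\<^sup>2)))) {u..v}"
      by (rule has_integral_diff[OF _ split[OF intH2]])
    have pt: "\<bar>(K s)\<^sup>2 - (H s)\<^sup>2\<bar> \<le> G s" for s
    proof -
      define d where "d = K s - H s"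
      have "(K s)\<^sup>2 - (H s)\<^sup>2 = d\<^sup>2 + 2 * d * H s"
        by (simp add: d_def power2_eq_square algebra_simps)
      moreover have "\<bar>2 * d * H s\<bar> \<le> d\<^sup>2 / \<rho> + \<rho> * (H s)\<^sup>2"
      proof -
        have "0 \<le> (\<bar>d\<bar> - \<rho> * \<bar>H s\<bar>)\<^sup>2 / \<rho>" using \<open>0 < \<rho>\<close> by simp
        also have "\<dots> = d\<^sup>2 / \<rho> + \<rho> * (H s)\<^sup>2 - \<bar>2 * d * H s\<bar>"
          using \<open>0 < \<rho>\<close> by (simp add: power2_diff power_mult_distrib abs_mult field_simps power2_eq_square)
        finally show ?thesis by simp
      qed
      ultimately have "\<bar>(K s)\<^sup>2 - (H s)\<^sup>2\<bar> \<le> d\<^sup>2 + (d\<^sup>2 / \<rho> + \<rho> * (H s)\<^sup>2)"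
        using abs_triangle_ineq[of "d\<^sup>2" "2 * d * H s"] by simp
      then show ?thesis by (simp add: G_def d_def[symmetric] algebra_simps)
    qed
    have "(\<kappa> i)\<^sup>2 * (v - u) - (integral {0..v} (\<lambda>s. (H s)\<^sup>2) - integral {0..u} (\<lambda>s. (H s)\<^sup>2))
        \<le> integral {0..v} G - integral {0..u} G"
      using pt by (intro has_integral_le[OF diff split[OF intG]]) (auto simp: abs_le_iff)
    moreover have "- ((\<kappa> i)\<^sup>2 * (v - u) - (integral {0..v} (\<lambda>s. (H s)\<^sup>2) - integral {0..u} (\<lambda>s. (H s)\<^sup>2)))
        \<le> integral {0..v} G - integral {0..u} G"
      using pt by (intro has_integral_le[OF has_integral_neg[OF diff] split[OF intG]]) (metis abs_le_iff)
    ultimately show ?thesis by (simp add: u_def v_def)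
  qed
  have "(\<Sum>i<N. \<bar>(\<kappa> i)\<^sup>2 * (\<sigma> (Suc i) - \<sigma> i)
           - (integral {0..\<sigma> (Suc i)} (\<lambda>s. (H s)\<^sup>2) - integral {0..\<sigma> i} (\<lambda>s. (H s)\<^sup>2))\<bar>)
      \<le> (\<Sum>i<N. integral {0..\<sigma> (Suc i)} G - integral {0..\<sigma> i} G)"
    using summand by (intro sum_mono) auto
  also have "\<dots> = integral {0..t} G"
    using sum_lessThan_telescope[of "\<lambda>i. integral {0..\<sigma> i} G" N] \<sigma> by simp
  finally show ?thesis using G_total by simp
qed

text \<open>Logarithm of the discrete stochastic exponential with integrand
  \<open>- 2 * f * \<kappa>\<close>, whose halved square is
  \<open>2 * f\<^sup>2 * \<kappa>\<^sup>2\<close>. The number of steps is a parameter, so stopping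
  means choosing a smaller \<open>m\<close>.\<close>

definition discrete_exponent ::
  "(real \<Rightarrow> real) \<Rightarrow> (real \<Rightarrow> real) \<Rightarrow> (nat \<Rightarrow> real) \<Rightarrow> (nat \<Rightarrow> real) \<Rightarrow> nat \<Rightarrow> real" where
  "discrete_exponent f S \<kappa> \<sigma> m = (\<Sum>i<m. - 2 * f (\<sigma> i) * (S (\<sigma> (Suc i)) - S (\<sigma> i)))
     - (\<Sum>i<m. 2 * (f (\<sigma> i))\<^sup>2 * ((\<kappa> i)\<^sup>2 * (\<sigma> (Suc i) - \<sigma> i)))"

text \<open>A single sample path. The stochastic integral is just a function \<open>I\<close> tied
  to \<open>X\<close> by the equation, so that the convergence of the exponent becomes a
  deterministic statement.\<close>

locale riccati_path =
  fixes f g X I :: "real \<Rightarrow> real" and \<alpha> \<gamma> \<delta> x t :: real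
  assumes f_deriv: "\<And>s. s \<in> {0..t} \<Longrightarrow> (f has_real_derivative 2 * (f s)\<^sup>2 + 2 * \<alpha> * f s - \<gamma>) (at s within {0..t})"
    and g_deriv: "\<And>s. s \<in> {0..t} \<Longrightarrow> (g has_real_derivative - (\<delta> * f s)) (at s within {0..t})"
    and X_cont: "continuous_on {0..t} X"
    and X_nonneg: "\<And>s. s \<in> {0..t} \<Longrightarrow> 0 \<le> X s"
    and sde: "\<And>s. s \<in> {0..t} \<Longrightarrow> X s = x + 2 * I s + integral {0..s} (\<lambda>r. \<delta> - 2 * \<alpha> * X r)"
begin

abbreviation "p s \<equiv> 2 * (f s)\<^sup>2 + 2 * \<alpha> * f s - \<gamma>"

definition V :: "real \<Rightarrow> real" where
  "V s = - f s * X s - g s - \<gamma> * integral {0..s} X"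

lemma f_cont: "continuous_on {0..t} f"
  using f_deriv by (rule DERIV_continuous_on)

lemma common_bound:
  obtains C where "0 \<le> C" "\<And>s. s \<in> {0..t} \<Longrightarrow> \<bar>f s\<bar> \<le> C" "\<And>s. s \<in> {0..t} \<Longrightarrow> \<bar>X s\<bar> \<le> C"
    "\<And>s. s \<in> {0..t} \<Longrightarrow> \<bar>p s\<bar> \<le> C"
proof -
  have bdd: "\<exists>c. \<forall>s\<in>{0..t}. \<bar>h s\<bar> \<le> c" if "continuous_on {0..t} h" for h :: "real \<Rightarrow> real"
    using compact_imp_bounded[OF compact_continuous_image[OF that compact_Icc]]
    unfolding bounded_iff by simp
  have "continuous_on {0..t} p" by (intro continuous_intros f_cont)
  from bdd[OF f_cont] bdd[OF X_cont] bdd[OF this]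
  obtain c1 c2 c3 where c: "\<forall>s\<in>{0..t}. \<bar>f s\<bar> \<le> c1" "\<forall>s\<in>{0..t}. \<bar>X s\<bar> \<le> c2" "\<forall>s\<in>{0..t}. \<bar>p s\<bar> \<le> c3"
    by blast
  show ?thesis
    by (rule that[of "max 0 (max c1 (max c2 c3))"]) (use c in \<open>auto simp: le_max_iff_disj\<close>)
qed

text \<open>The increment errors are summed. Summation by parts yields \<open>4 * C * e1\<close>
  from its two boundary terms and \<open>2 * C * t * e1\<close> from the Lipschitz bound on
  \<open>f\<close>; the quadratic variation contributes \<open>2 * C\<^sup>2 * e2\<close>, and the
  oscillations inside the intervals the last term.\<close>

lemma exponent_error:
  assumes \<sigma>: "strict_mono_on {..N} \<sigma>" "\<sigma> 0 = 0" "\<sigma> N = t"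
    and osc: "\<And>i s. i < N \<Longrightarrow> s \<in> {\<sigma> i..\<sigma> (Suc i)} \<Longrightarrow> \<bar>X s - X (\<sigma> (Suc i))\<bar> \<le> \<epsilon>"
      "\<And>i s. i < N \<Longrightarrow> s \<in> {\<sigma> i..\<sigma> (Suc i)} \<Longrightarrow> \<bar>f s - f (\<sigma> i)\<bar> \<le> \<epsilon>"
    and bounds: "\<And>s. s \<in> {0..t} \<Longrightarrow> \<bar>f s\<bar> \<le> C" "\<And>s. s \<in> {0..t} \<Longrightarrow> \<bar>X s\<bar> \<le> C" "\<And>s. s \<in> {0..t} \<Longrightarrow> \<bar>p s\<bar> \<le> C"
    and S: "\<And>i. i \<le> N \<Longrightarrow> \<bar>S (\<sigma> i) - I (\<sigma> i)\<bar> \<le> e1"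
    and qv: "(\<Sum>i<N. \<bar>(\<kappa> i)\<^sup>2 * (\<sigma> (Suc i) - \<sigma> i) - (integral {0..\<sigma> (Suc i)} X - integral {0..\<sigma> i} X)\<bar>) \<le> e2"
    and m: "m \<le> N" and "0 \<le> \<epsilon>"
  shows "\<bar>V (\<sigma> m) - V 0 - discrete_exponent f S \<kappa> \<sigma> m\<bar>
    \<le> (4 * C + 2 * C * t) * e1 + 2 * C\<^sup>2 * e2 + (C * (4 * C + 2 * \<bar>\<alpha>\<bar>) + C + \<bar>\<delta>\<bar>) * \<epsilon> * t"
proof -
  let ?R = "(C * (4 * C + 2 * \<bar>\<alpha>\<bar>) + C + \<bar>\<delta>\<bar>) * \<epsilon>"
  define e where "e i = S (\<sigma> i) - I (\<sigma> i)" for i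
  define Q where "Q i = (\<kappa> i)\<^sup>2 * (\<sigma> (Suc i) - \<sigma> i) - (integral {0..\<sigma> (Suc i)} X - integral {0..\<sigma> i} X)" for i
  define D where "D i = V (\<sigma> (Suc i)) - V (\<sigma> i)
    - (- 2 * f (\<sigma> i) * (S (\<sigma> (Suc i)) - S (\<sigma> i)) - 2 * (f (\<sigma> i))\<^sup>2 * ((\<kappa> i)\<^sup>2 * (\<sigma> (Suc i) - \<sigma> i)))" for i
  have le: "\<sigma> i \<le> \<sigma> j" if "i \<le> j" "j \<le> N" for i j
    using \<sigma>(1) that by (cases "i = j") (auto simp: strict_mono_on_def less_imp_le)
  have range: "\<sigma> i \<in> {0..t}" if "i \<le> N" for i
    using le[of 0 i] le[of i N] that \<sigma> by auto
  have t: "0 \<le> t" using range[OF le_refl] \<sigma>(3) by simp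
  then have C: "0 \<le> C" using bounds(1)[of 0] by auto
  have e: "\<bar>e i\<bar> \<le> e1" if "i \<le> N" for i using S that by (simp add: e_def)
  then have e1: "0 \<le> e1" using order_trans[OF abs_ge_zero] by blast
  have inc: "\<bar>f (\<sigma> (Suc i)) - f (\<sigma> i)\<bar> \<le> C * (\<sigma> (Suc i) - \<sigma> i)" if "i < N" for i
    using field_differentiable_bound[of "{0..t}" f p C "\<sigma> (Suc i)" "\<sigma> i"]
      f_deriv bounds(3) range[of i] range[of "Suc i"] le[of i "Suc i"] that by auto
  have D: "\<bar>D i - 2 * f (\<sigma> i) * (e (Suc i) - e i) - 2 * (f (\<sigma> i))\<^sup>2 * Q i\<bar> \<le> ?R * (\<sigma> (Suc i) - \<sigma> i)"
    if "i < N" for i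
    unfolding D_def Q_def e_def V_def
    by (rule exponent_increment_error[where t = t and x = x])
      (use that range[of i] range[of "Suc i"] \<sigma>(1) in
        \<open>auto simp: strict_mono_on_def intro: f_deriv g_deriv X_cont sde osc bounds\<close>)
  have len: "(\<Sum>i<m. \<sigma> (Suc i) - \<sigma> i) \<le> t"
    using sum_lessThan_telescope[of \<sigma> m] \<sigma>(2) range[OF m] by simp
  have R: "0 \<le> ?R" using C \<open>0 \<le> \<epsilon>\<close> by simp
  have "\<bar>\<Sum>i<m. D i - 2 * f (\<sigma> i) * (e (Suc i) - e i) - 2 * (f (\<sigma> i))\<^sup>2 * Q i\<bar> \<le> (\<Sum>i<m. ?R * (\<sigma> (Suc i) - \<sigma> i))"
    using D m by (intro order_trans[OF sum_abs] sum_mono) auto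
  also have "\<dots> \<le> ?R * t"
    unfolding sum_distrib_left[symmetric] using len R by (rule mult_left_mono)
  finally have d1: "\<bar>(\<Sum>i<m. D i) - 2 * (\<Sum>i<m. f (\<sigma> i) * (e (Suc i) - e i)) - (\<Sum>i<m. 2 * (f (\<sigma> i))\<^sup>2 * Q i)\<bar> \<le> ?R * t"
    by (simp add: sum_subtractf sum_distrib_left mult.assoc)
  have "\<bar>\<Sum>i<m. e (Suc i) * (f (\<sigma> (Suc i)) - f (\<sigma> i))\<bar> \<le> (\<Sum>i<m. e1 * (C * (\<sigma> (Suc i) - \<sigma> i)))"
    using e inc m e1 by (intro order_trans[OF sum_abs] sum_mono) (auto simp: abs_mult intro!: mult_mono)
  also have "\<dots> = e1 * (C * (\<Sum>i<m. \<sigma> (Suc i) - \<sigma> i))"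
    by (simp add: sum_distrib_left)
  also have "\<dots> \<le> e1 * (C * t)"
    using len C e1 by (intro mult_left_mono) auto
  finally have "\<bar>\<Sum>i<m. e (Suc i) * (f (\<sigma> (Suc i)) - f (\<sigma> i))\<bar> \<le> e1 * (C * t)" .
  moreover have "\<bar>f (\<sigma> m) * e m\<bar> \<le> C * e1" "\<bar>f (\<sigma> 0) * e 0\<bar> \<le> C * e1"
    unfolding abs_mult using bounds(1)[OF range] e m C by (auto intro!: mult_mono)
  ultimately have d2: "\<bar>\<Sum>i<m. f (\<sigma> i) * (e (Suc i) - e i)\<bar> \<le> C * e1 + C * e1 + e1 * (C * t)"
    unfolding sum_by_parts[of "\<lambda>i. f (\<sigma> i)" e] by linarith
  have "\<bar>\<Sum>i<m. 2 * (f (\<sigma> i))\<^sup>2 * Q i\<bar> \<le> (\<Sum>i<m. 2 * C\<^sup>2 * \<bar>Q i\<bar>)"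
  proof (rule order_trans[OF sum_abs sum_mono])
    fix i assume "i \<in> {..<m}"
    then have "(f (\<sigma> i))\<^sup>2 \<le> C\<^sup>2"
      using power_mono[OF bounds(1)[OF range[of i]], of 2] m by simp
    then show "\<bar>2 * (f (\<sigma> i))\<^sup>2 * Q i\<bar> \<le> 2 * C\<^sup>2 * \<bar>Q i\<bar>"
      unfolding abs_mult by (intro mult_right_mono) auto
  qed
  also have "\<dots> \<le> 2 * C\<^sup>2 * (\<Sum>i<N. \<bar>Q i\<bar>)"
    unfolding sum_distrib_left[symmetric] using m by (intro mult_left_mono sum_mono2) auto
  also have "\<dots> \<le> 2 * C\<^sup>2 * e2"
    using qv by (intro mult_left_mono) (auto simp: Q_def)
  finally have d3: "\<bar>\<Sum>i<m. 2 * (f (\<sigma> i))\<^sup>2 * Q i\<bar> \<le> 2 * C\<^sup>2 * e2" .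
  have "(\<Sum>i<m. D i) = V (\<sigma> m) - V 0 - discrete_exponent f S \<kappa> \<sigma> m"
    using sum_lessThan_telescope[of "\<lambda>i. V (\<sigma> i)" m] \<sigma>(2)
    by (simp add: D_def discrete_exponent_def sum_subtractf)
  then show ?thesis using d1 d2 d3 by (simp add: algebra_simps)
qed

end

context riccati_path
begin

text \<open>Vanishing mesh controls the oscillations through uniform continuity of \<open>X\<close>
  and \<open>f\<close>; \<open>E\<close> and \<open>e\<close> control the remaining errors.
  Uniformity in \<open>m\<close> is what the stopped exponentials need.\<close>

lemma discrete_exponent_limit:
  fixes \<sigma> \<kappa> :: "nat \<Rightarrow> nat \<Rightarrow> real" and S K :: "nat \<Rightarrow> real \<Rightarrow> real"
  assumes \<sigma>: "\<And>k. strict_mono_on {..N k} (\<sigma> k)" "\<And>k. \<sigma> k 0 = 0" "\<And>k. \<sigma> k (N k) = t"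
    and mesh: "\<And>k i. i < N k \<Longrightarrow> \<sigma> k (Suc i) - \<sigma> k i \<le> d k" "d \<longlonglongrightarrow> 0"
    and S: "\<And>k i. i \<le> N k \<Longrightarrow> \<bar>S k (\<sigma> k i) - I (\<sigma> k i)\<bar> \<le> E k" "E \<longlonglongrightarrow> 0"
    and K: "\<And>k i s. i < N k \<Longrightarrow> \<sigma> k i < s \<Longrightarrow> s \<le> \<sigma> k (Suc i) \<Longrightarrow> K k s = \<kappa> k i"
    and e: "\<And>k. ((\<lambda>s. (K k s - sqrt (X s))\<^sup>2) has_integral e k) {0..t}" "e \<longlonglongrightarrow> 0"
  shows "0 < \<epsilon> \<Longrightarrow> \<forall>\<^sub>F k in sequentially. \<forall>m\<le>N k.
      \<bar>V (\<sigma> k m) - V 0 - discrete_exponent f (S k) (\<kappa> k) (\<sigma> k) m\<bar> \<le> \<epsilon>"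
    and "(\<lambda>k. \<Sum>i<N k. (\<kappa> k i)\<^sup>2 * (\<sigma> k (Suc i) - \<sigma> k i)) \<longlonglongrightarrow> integral {0..t} X"
proof -
  have le: "\<sigma> k i \<le> \<sigma> k j" if "i \<le> j" "j \<le> N k" for i j k
    using \<sigma>(1)[of k] that by (cases "i = j") (auto simp: strict_mono_on_def less_imp_le)
  have range: "\<sigma> k i \<in> {0..t}" if "i \<le> N k" for i k
    using le[of 0 i k] le[of i "N k" k] that \<sigma> by auto
  have t: "0 \<le> t" using range[OF le_refl] \<sigma>(3) by simp
  define q where "q k = (\<Sum>i<N k. \<bar>(\<kappa> k i)\<^sup>2 * (\<sigma> k (Suc i) - \<sigma> k i)
     - (integral {0..\<sigma> k (Suc i)} X - integral {0..\<sigma> k i} X)\<bar>)" for k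
  have H2: "integral {0..s} (\<lambda>r. (sqrt (X r))\<^sup>2) = integral {0..s} X" if "s \<in> {0..t}" for s
    using that by (intro Henstock_Kurzweil_Integration.integral_cong) (auto simp: X_nonneg)
  have A: "0 \<le> integral {0..t} X"
    using integrable_continuous_real[OF X_cont] X_nonneg by (intro integral_nonneg) auto
  have q_le: "q k \<le> (1 + 1 / \<rho>) * e k + \<rho> * integral {0..t} X" if "0 < \<rho>" for k \<rho>
  proof -
    have "q k = (\<Sum>i<N k. \<bar>(\<kappa> k i)\<^sup>2 * (\<sigma> k (Suc i) - \<sigma> k i)
      - (integral {0..\<sigma> k (Suc i)} (\<lambda>r. (sqrt (X r))\<^sup>2) - integral {0..\<sigma> k i} (\<lambda>r. (sqrt (X r))\<^sup>2))\<bar>)"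
      unfolding q_def using range[of _ k] by (intro sum.cong refl) (simp add: H2)
    also have "\<dots> \<le> (1 + 1 / \<rho>) * e k + \<rho> * integral {0..t} (\<lambda>r. (sqrt (X r))\<^sup>2)"
      by (rule quadratic_variation_error[where K = "K k"])
        (use \<sigma> K e(1) that in \<open>auto intro!: continuous_intros X_cont\<close>)
    finally show ?thesis using t by (simp add: H2)
  qed
  have q_nonneg: "0 \<le> q k" for k unfolding q_def by (rule sum_nonneg) simp
  have q0: "q \<longlonglongrightarrow> 0"
  proof (rule LIMSEQ_I)
    fix r :: real assume "0 < r"
    \<comment> \<open>Makes the \<open>\<rho>\<close> term smaller than \<open>r / 2\<close>; the
      summand 1 excludes division by 0 when the integral of \<open>X\<close> vanishes.\<close>
    define \<rho> where "\<rho> = r / (2 * (integral {0..t} X + 1))"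
    have \<rho>: "0 < \<rho>" using \<open>0 < r\<close> A by (simp add: \<rho>_def)
    have "\<rho> * integral {0..t} X < \<rho> * (integral {0..t} X + 1)" using \<rho> by simp
    also have "\<dots> = r / 2" using A by (simp add: \<rho>_def divide_simps)
    finally have small: "\<rho> * integral {0..t} X < r / 2" .
    have "(\<lambda>k. (1 + 1 / \<rho>) * e k) \<longlonglongrightarrow> (1 + 1 / \<rho>) * 0"
      by (intro tendsto_intros e)
    then have "\<forall>\<^sub>F k in sequentially. (1 + 1 / \<rho>) * e k < r / 2"
      using \<open>0 < r\<close> by (intro order_tendstoD(2)) auto
    then have "\<forall>\<^sub>F k in sequentially. norm (q k - 0) < r"
    proof eventually_elim
      case (elim k)
      have "q k < r / 2 + r / 2"
        by (rule le_less_trans[OF q_le[OF \<rho>] add_strict_mono[OF elim small]])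
      then show ?case using q_nonneg[of k] by simp
    qed
    then show "\<exists>no. \<forall>k\<ge>no. norm (q k - 0) < r" by (simp add: eventually_sequentially)
  qed
  show "(\<lambda>k. \<Sum>i<N k. (\<kappa> k i)\<^sup>2 * (\<sigma> k (Suc i) - \<sigma> k i)) \<longlonglongrightarrow> integral {0..t} X"
  proof -
    have "\<bar>(\<Sum>i<N k. (\<kappa> k i)\<^sup>2 * (\<sigma> k (Suc i) - \<sigma> k i)) - integral {0..t} X\<bar> \<le> q k" for k
    proof -
      have "(\<Sum>i<N k. integral {0..\<sigma> k (Suc i)} X - integral {0..\<sigma> k i} X) = integral {0..t} X"
        using sum_lessThan_telescope[of "\<lambda>i. integral {0..\<sigma> k i} X" "N k"] \<sigma> by simp
      then have "(\<Sum>i<N k. (\<kappa> k i)\<^sup>2 * (\<sigma> k (Suc i) - \<sigma> k i)) - integral {0..t} X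
        = (\<Sum>i<N k. (\<kappa> k i)\<^sup>2 * (\<sigma> k (Suc i) - \<sigma> k i) - (integral {0..\<sigma> k (Suc i)} X - integral {0..\<sigma> k i} X))"
        by (simp add: sum_subtractf)
      then show ?thesis unfolding q_def by (simp only: sum_abs)
    qed
    then have "(\<lambda>k. (\<Sum>i<N k. (\<kappa> k i)\<^sup>2 * (\<sigma> k (Suc i) - \<sigma> k i)) - integral {0..t} X) \<longlonglongrightarrow> 0"
      by (intro Lim_null_comparison[OF _ q0]) auto
    then show ?thesis by (rule LIM_zero_cancel)
  qed
  assume "0 < \<epsilon>"
  obtain C where C: "0 \<le> C" "\<And>s. s \<in> {0..t} \<Longrightarrow> \<bar>f s\<bar> \<le> C" "\<And>s. s \<in> {0..t} \<Longrightarrow> \<bar>X s\<bar> \<le> C"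
    "\<And>s. s \<in> {0..t} \<Longrightarrow> \<bar>p s\<bar> \<le> C"
    using common_bound by blast
  define R where "R = C * (4 * C + 2 * \<bar>\<alpha>\<bar>) + C + \<bar>\<delta>\<bar>"
  \<comment> \<open>The oscillation permitted inside one interval: it contributes at most
    \<open>\<epsilon> / 2\<close> over the whole time span.\<close>
  define \<epsilon>2 where "\<epsilon>2 = \<epsilon> / (2 * (R * t + 1))"
  have R: "0 \<le> R" using C by (simp add: R_def)
  then have Rt: "0 < R * t + 1" using t by (simp add: add_nonneg_pos)
  have \<epsilon>2: "0 < \<epsilon>2" using \<open>0 < \<epsilon>\<close> Rt by (simp add: \<epsilon>2_def)
  have "R * \<epsilon>2 * t \<le> \<epsilon>2 * (R * t + 1)" using \<epsilon>2 by (simp add: algebra_simps)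
  also have "\<dots> = \<epsilon> / 2" using Rt by (simp add: \<epsilon>2_def divide_simps)
  finally have small: "R * \<epsilon>2 * t \<le> \<epsilon> / 2" .
  have unif: "\<exists>r>0. \<forall>s\<in>{0..t}. \<forall>s'\<in>{0..t}. dist s' s < r \<longrightarrow> dist (h s') (h s) < \<epsilon>2"
    if "continuous_on {0..t} h" for h :: "real \<Rightarrow> real"
    using compact_uniformly_continuous[OF that compact_Icc] \<epsilon>2 unfolding uniformly_continuous_on_def by simp
  obtain d1 where d1: "0 < d1"
    "\<And>s r. s \<in> {0..t} \<Longrightarrow> r \<in> {0..t} \<Longrightarrow> dist s r < d1 \<Longrightarrow> dist (X s) (X r) < \<epsilon>2"
    using unif[OF X_cont] by blast
  obtain d2 where d2: "0 < d2"
    "\<And>s r. s \<in> {0..t} \<Longrightarrow> r \<in> {0..t} \<Longrightarrow> dist s r < d2 \<Longrightarrow> dist (f s) (f r) < \<epsilon>2"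
    using unif[OF f_cont] by blast
  have ev_d: "\<forall>\<^sub>F k in sequentially. d k < min d1 d2"
    using mesh(2) d1(1) d2(1) by (intro order_tendstoD(2)) auto
  have "(\<lambda>k. (4 * C + 2 * C * t) * E k + 2 * C\<^sup>2 * q k) \<longlonglongrightarrow> (4 * C + 2 * C * t) * 0 + 2 * C\<^sup>2 * 0"
    by (intro tendsto_intros S q0)
  then have "\<forall>\<^sub>F k in sequentially. (4 * C + 2 * C * t) * E k + 2 * C\<^sup>2 * q k < \<epsilon> / 2"
    using \<open>0 < \<epsilon>\<close> by (intro order_tendstoD(2)) auto
  with ev_d show "\<forall>\<^sub>F k in sequentially. \<forall>m\<le>N k.
      \<bar>V (\<sigma> k m) - V 0 - discrete_exponent f (S k) (\<kappa> k) (\<sigma> k) m\<bar> \<le> \<epsilon>"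
  proof eventually_elim
    case (elim k)
    have near: "s \<in> {0..t}" "dist s (\<sigma> k (Suc i)) < d1" "dist s (\<sigma> k i) < d2"
      if "i < N k" "s \<in> {\<sigma> k i..\<sigma> k (Suc i)}" for i s
      using that mesh(1)[OF that(1)] elim(1) range[of i k] range[of "Suc i" k] by (auto simp: dist_real_def)
    show ?case
    proof (intro allI impI)
      fix m assume "m \<le> N k"
      have "\<bar>V (\<sigma> k m) - V 0 - discrete_exponent f (S k) (\<kappa> k) (\<sigma> k) m\<bar>
        \<le> (4 * C + 2 * C * t) * E k + 2 * C\<^sup>2 * q k + (C * (4 * C + 2 * \<bar>\<alpha>\<bar>) + C + \<bar>\<delta>\<bar>) * \<epsilon>2 * t"
      proof (rule exponent_error[OF \<sigma>])
        fix i s assume i: "i < N k" "s \<in> {\<sigma> k i..\<sigma> k (Suc i)}"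
        show "\<bar>X s - X (\<sigma> k (Suc i))\<bar> \<le> \<epsilon>2"
          using d1(2)[OF near(1)[OF i] range near(2)[OF i]] i by (simp add: dist_real_def)
        show "\<bar>f s - f (\<sigma> k i)\<bar> \<le> \<epsilon>2"
          using d2(2)[OF near(1)[OF i] range near(3)[OF i]] i by (simp add: dist_real_def)
      qed (use C S(1) \<open>m \<le> N k\<close> \<epsilon>2 in \<open>auto simp: q_def\<close>)
      then show "\<bar>V (\<sigma> k m) - V 0 - discrete_exponent f (S k) (\<kappa> k) (\<sigma> k) m\<bar> \<le> \<epsilon>"
        using elim(2) small by (simp add: R_def)
    qed
  qed
qed

end

section \<open>Cutoff index and limits of expectations\<close>

lemma cutoff_index:
  fixes a :: "nat \<Rightarrow> real"
  assumes "\<And>i. i < N \<Longrightarrow> 0 \<le> a i" "0 \<le> \<eta>"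
  obtains j where "j \<le> N" "\<And>i. i < N \<Longrightarrow> (\<Sum>l<Suc i. a l) \<le> \<eta> \<longleftrightarrow> i < j" "(\<Sum>i<j. a i) \<le> \<eta>"
    "(\<Sum>i<N. a i) \<le> \<eta> \<Longrightarrow> j = N"
proof -
  have mono: "(\<Sum>l<i. a l) \<le> (\<Sum>l<j. a l)" if "i \<le> j" "j \<le> N" for i j
    using assms(1) that by (intro sum_mono2) auto
  \<comment> \<open>The last index whose partial sum is admissible; 0 always is. As the terms are
    nonnegative, the cutoff condition holds precisely before \<open>j\<close>, so that cutting off
    coefficients amounts to stopping at \<open>j\<close>.\<close>
  define j where "j = (GREATEST j. j \<le> N \<and> (\<Sum>i<j. a i) \<le> \<eta>)"
  have j: "j \<le> N \<and> (\<Sum>i<j. a i) \<le> \<eta>"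
    unfolding j_def by (rule GreatestI_nat[of _ 0 N]) (use assms in auto)
  have max: "i \<le> j" if "i \<le> N" "(\<Sum>l<i. a l) \<le> \<eta>" for i
    unfolding j_def by (rule Greatest_le_nat[of _ _ N]) (use that in auto)
  have "(\<Sum>l<Suc i. a l) \<le> \<eta> \<longleftrightarrow> i < j" if "i < N" for i
  proof
    assume "(\<Sum>l<Suc i. a l) \<le> \<eta>"
    then show "i < j" using max[of "Suc i"] that by auto
  next
    assume "i < j"
    then show "(\<Sum>l<Suc i. a l) \<le> \<eta>" using mono[of "Suc i" j] j by auto
  qed
  then show thesis using that[of j] j max[of N] by (auto intro: antisym)
qed

text \<open>The second moments give uniform integrability; \<open>A\<close> is the event on which the limit is identified.\<close>

lemma (in prob_space) expectation_limit_bound: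
  fixes Z :: "nat \<Rightarrow> 'a \<Rightarrow> real"
  assumes Z [measurable]: "\<And>k. Z k \<in> borel_measurable M" and Z_nonneg: "\<And>k \<omega>. 0 \<le> Z k \<omega>"
    and mean: "\<And>k. (\<integral>\<^sup>+\<omega>. ennreal (Z k \<omega>) \<partial>M) = 1"
    and second: "\<And>k. (\<integral>\<^sup>+\<omega>. ennreal ((Z k \<omega>)\<^sup>2) \<partial>M) \<le> ennreal D" and "0 \<le> D"
    and bound: "AE \<omega> in M. \<forall>\<^sub>F k in sequentially. Z k \<omega> \<le> c" and "0 \<le> c"
    and Y [measurable]: "Y \<in> borel_measurable M" "AE \<omega> in M. 0 \<le> Y \<omega> \<and> Y \<omega> \<le> c"
    and A [measurable]: "A \<in> sets M" and lim: "AE \<omega> in M. \<omega> \<in> A \<longrightarrow> (\<lambda>k. Z k \<omega>) \<longlonglongrightarrow> Y \<omega>"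
  shows "\<bar>1 - expectation Y\<bar> \<le> c * prob (space M - A)"
proof -
  have int_Z: "integrable M (Z k)" for k
    by (rule integrableI_nonneg) (use Z_nonneg mean in auto)
  have int_Z2: "integrable M (\<lambda>\<omega>. (Z k \<omega>)\<^sup>2)" for k
    by (rule integrableI_nonneg) (use second[of k] in \<open>auto simp: top.not_eq_extremum intro: le_less_trans\<close>)
  have E_Z: "expectation (Z k) = 1" for k
    using mean[of k] nn_integral_eq_integral[OF int_Z] Z_nonneg by simp
  have E_Z2: "expectation (\<lambda>\<omega>. (Z k \<omega>)\<^sup>2) \<le> D" for k
    using second[of k] nn_integral_eq_integral[OF int_Z2] \<open>0 \<le> D\<close> by simp
  let ?m = "\<lambda>k \<omega>. min (Z k \<omega>) c"
  let ?P = "\<lambda>k. {\<omega> \<in> space M. Z k \<omega> > c}"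
  have int_m: "integrable M (?m k)" for k
    by (rule integrable_const_bound[where B = c]) (use Z_nonneg \<open>0 \<le> c\<close> in auto)
  have int_Y: "integrable M Y"
    by (rule integrable_const_bound[where B = c]) (use Y in auto)
  have P_lim: "(\<lambda>k. prob (?P k)) \<longlonglongrightarrow> 0"
  proof -
    have "(\<lambda>k. \<integral>\<omega>. indicator (?P k) \<omega> \<partial>M) \<longlonglongrightarrow> (\<integral>\<omega>. (0 :: real) \<partial>M)"
    proof (rule integral_dominated_convergence[where w = "\<lambda>_. 1"])
      show "AE \<omega> in M. (\<lambda>k. indicator (?P k) \<omega> :: real) \<longlonglongrightarrow> 0"
        using bound
      proof eventually_elim
        case (elim \<omega>)
        then have "\<forall>\<^sub>F k in sequentially. indicator (?P k) \<omega> = (0 :: real)"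
          by eventually_elim (simp add: indicator_def)
        then show ?case by (rule tendsto_eventually)
      qed
    qed (auto simp: indicator_def)
    then show ?thesis by simp
  qed
  have excess: "1 - expectation (?m k) \<le> \<epsilon> * D + prob (?P k) / (4 * \<epsilon>)" if "0 < \<epsilon>" for k \<epsilon>
  proof -
    have ind: "integrable M (indicator (?P k) :: 'a \<Rightarrow> real)"
      by (intro integrable_real_indicator) (auto simp: emeasure_eq_measure)
    have pt: "Z k \<omega> - ?m k \<omega> \<le> \<epsilon> * (Z k \<omega>)\<^sup>2 + indicator (?P k) \<omega> / (4 * \<epsilon>)" if "\<omega> \<in> space M" for \<omega>
    proof (cases "Z k \<omega> > c")
      case True
      \<comment> \<open>Young's inequality again: it trades the first moment beyond \<open>c\<close>
        for a small multiple of the second moment and the probability of exceeding \<open>c\<close>,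
        which tends to 0.\<close>
      have "0 \<le> (2 * \<epsilon> * Z k \<omega> - 1)\<^sup>2 / (4 * \<epsilon>)" using \<open>0 < \<epsilon>\<close> by simp
      also have "\<dots> = \<epsilon> * (Z k \<omega>)\<^sup>2 + 1 / (4 * \<epsilon>) - Z k \<omega>"
        using \<open>0 < \<epsilon>\<close> by (simp add: power2_eq_square field_simps)
      finally show ?thesis using True \<open>\<omega> \<in> space M\<close> \<open>0 \<le> c\<close> by simp
    next
      case False
      then show ?thesis using \<open>0 < \<epsilon>\<close> by simp
    qed
    have "1 - expectation (?m k) = expectation (\<lambda>\<omega>. Z k \<omega> - ?m k \<omega>)"
      using int_Z int_m by (simp add: E_Z)
    also have "\<dots> \<le> expectation (\<lambda>\<omega>. \<epsilon> * (Z k \<omega>)\<^sup>2 + indicator (?P k) \<omega> / (4 * \<epsilon>))"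
      using int_Z int_m int_Z2 ind pt by (intro integral_mono) auto
    also have "\<dots> = \<epsilon> * expectation (\<lambda>\<omega>. (Z k \<omega>)\<^sup>2) + prob (?P k) / (4 * \<epsilon>)"
      using int_Z2 ind by (subst Bochner_Integration.integral_add) auto
    also have "\<dots> \<le> \<epsilon> * D + prob (?P k) / (4 * \<epsilon>)"
      using E_Z2[of k] \<open>0 < \<epsilon>\<close> by simp
    finally show ?thesis .
  qed
  have deficit: "0 \<le> 1 - expectation (?m k)" for k
    using integral_mono[OF int_m int_Z, of k k] by (simp add: E_Z)
  have m_lim: "(\<lambda>k. 1 - expectation (?m k)) \<longlonglongrightarrow> 0"
  proof (rule LIMSEQ_I)
    fix r :: real assume "0 < r"
    define \<epsilon> where "\<epsilon> = r / (2 * (D + 1))"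
    have \<epsilon>: "0 < \<epsilon>" using \<open>0 < r\<close> \<open>0 \<le> D\<close> by (simp add: \<epsilon>_def)
    have "\<epsilon> * D < \<epsilon> * (D + 1)" using \<epsilon> by simp
    also have "\<dots> = r / 2" using \<open>0 \<le> D\<close> by (simp add: \<epsilon>_def divide_simps)
    finally have small: "\<epsilon> * D < r / 2" .
    have "(\<lambda>k. prob (?P k) / (4 * \<epsilon>)) \<longlonglongrightarrow> 0 / (4 * \<epsilon>)"
      using \<epsilon> by (intro tendsto_divide P_lim tendsto_const) simp
    then have "\<forall>\<^sub>F k in sequentially. prob (?P k) / (4 * \<epsilon>) < r / 2"
      using \<open>0 < r\<close> by (intro order_tendstoD(2)) auto
    then have "\<forall>\<^sub>F k in sequentially. norm (1 - expectation (?m k) - 0) < r"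
    proof eventually_elim
      case (elim k)
      then show ?case using excess[OF \<epsilon>, of k] deficit[of k] small by simp
    qed
    then show "\<exists>no. \<forall>k\<ge>no. norm (1 - expectation (?m k) - 0) < r"
      by (simp add: eventually_sequentially)
  qed
  have diff_lim: "(\<lambda>k. expectation (\<lambda>\<omega>. \<bar>?m k \<omega> - Y \<omega>\<bar> * indicator A \<omega>)) \<longlonglongrightarrow> expectation (\<lambda>\<omega>. 0)"
  proof (rule integral_dominated_convergence[where w = "\<lambda>_. c"])
    show "AE \<omega> in M. (\<lambda>k. \<bar>?m k \<omega> - Y \<omega>\<bar> * indicator A \<omega>) \<longlonglongrightarrow> 0"
      using lim Y(2)
    proof eventually_elim
      case (elim \<omega>)
      show ?case
      proof (cases "\<omega> \<in> A")
        case True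
        then have "(\<lambda>k. \<bar>?m k \<omega> - Y \<omega>\<bar>) \<longlonglongrightarrow> \<bar>min (Y \<omega>) c - Y \<omega>\<bar>"
          using elim(1) by (intro tendsto_intros) auto
        then show ?thesis using True elim(2) by simp
      qed simp
    qed
    fix k show "AE \<omega> in M. norm (\<bar>?m k \<omega> - Y \<omega>\<bar> * indicator A \<omega>) \<le> c"
      using Y(2)
    proof eventually_elim
      case (elim \<omega>)
      then show ?case using Z_nonneg[of k \<omega>] \<open>0 \<le> c\<close> by (auto simp: indicator_def)
    qed
  qed auto
  \<comment> \<open>Three errors: the mass lost by capping at \<open>c\<close>, the discrepancy on
    \<open>A\<close>, and the part off \<open>A\<close>, where the capped variable and
    \<open>Y\<close> both lie between 0 and \<open>c\<close>. The first two vanish as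
    \<open>k\<close> grows.\<close>
  have "\<bar>1 - expectation Y\<bar> \<le> (1 - expectation (?m k)) + expectation (\<lambda>\<omega>. \<bar>?m k \<omega> - Y \<omega>\<bar> * indicator A \<omega>)
      + c * prob (space M - A)" for k
  proof -
    have ind: "integrable M (indicator (space M - A) :: 'a \<Rightarrow> real)"
      by (intro integrable_real_indicator) (auto simp: emeasure_eq_measure)
    have intA: "integrable M (\<lambda>\<omega>. \<bar>?m k \<omega> - Y \<omega>\<bar> * indicator A \<omega>)"
      using int_m int_Y by (intro integrable_real_mult_indicator integrable_abs Bochner_Integration.integrable_diff) auto
    have "\<bar>expectation (?m k) - expectation Y\<bar> = \<bar>expectation (\<lambda>\<omega>. ?m k \<omega> - Y \<omega>)\<bar>"
      using int_m int_Y by simp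
    also have "\<dots> \<le> expectation (\<lambda>\<omega>. \<bar>?m k \<omega> - Y \<omega>\<bar>)"
      by (rule integral_abs_bound)
    also have "\<dots> \<le> expectation (\<lambda>\<omega>. \<bar>?m k \<omega> - Y \<omega>\<bar> * indicator A \<omega> + c * indicator (space M - A) \<omega>)"
    proof (rule integral_mono_AE)
      show "AE \<omega> in M. \<bar>?m k \<omega> - Y \<omega>\<bar> \<le> \<bar>?m k \<omega> - Y \<omega>\<bar> * indicator A \<omega> + c * indicator (space M - A) \<omega>"
        using Y(2) AE_space
      proof eventually_elim
        case (elim \<omega>)
        then show ?case using Z_nonneg[of k \<omega>] \<open>0 \<le> c\<close> by (auto simp: indicator_def)
      qed
    qed (use int_m int_Y ind intA in auto)
    also have "\<dots> = expectation (\<lambda>\<omega>. \<bar>?m k \<omega> - Y \<omega>\<bar> * indicator A \<omega>) + c * prob (space M - A)"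
      using intA ind by (subst Bochner_Integration.integral_add) auto
    finally show ?thesis using deficit[of k] by linarith
  qed
  then show ?thesis
    using LIMSEQ_le_const[OF tendsto_add[OF tendsto_add[OF m_lim diff_lim] tendsto_const[of "c * prob (space M - A)"]]]
    by auto
qed

section \<open>Truncated exponentials and the passage to the limit\<close>

context ito_approximation
begin

lemma fine_partition:
  obtains N \<sigma> where "strict_mono_on {..N} \<sigma>" "\<sigma> 0 = 0" "\<sigma> N = t" "\<sigma> ` {..N} \<subseteq> {0..t}"
    "\<And>i j. i \<le> n k \<Longrightarrow> j < N \<Longrightarrow> \<tau> k i \<notin> {\<sigma> j<..<\<sigma> (Suc j)}"
    "\<And>j. j < N \<Longrightarrow> \<sigma> (Suc j) - \<sigma> j \<le> 1 / real (Suc m)"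
proof -
  define h where "h = real (Suc m)"
  have h: "0 < h" by (simp add: h_def)
  define grid where "grid = (\<lambda>j. real j / h) ` {..nat \<lceil>t * h\<rceil>} \<inter> {0..t}"
  have "finite (knots k \<union> grid)" "knots k \<union> grid \<subseteq> {0..t}"
    using knots_subset[of k] by (auto simp: grid_def)
  then obtain N \<sigma> where \<sigma>: "strict_mono_on {..N} \<sigma>" "\<sigma> 0 = 0" "\<sigma> N = t"
    "knots k \<union> grid \<subseteq> \<sigma> ` {..N}" "\<sigma> ` {..N} \<subseteq> {0..t}"
    and avoid: "\<And>p j. p \<in> knots k \<union> grid \<Longrightarrow> j < N \<Longrightarrow> p \<notin> {\<sigma> j<..<\<sigma> (Suc j)}"
    using partition_exists by metis
  show thesis
  proof (rule that[OF \<sigma>(1,2,3,5)])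
    fix i j assume "i \<le> n k" "j < N"
    then show "\<tau> k i \<notin> {\<sigma> j<..<\<sigma> (Suc j)}"
      by (intro knots_partition[OF _ \<sigma>(5)]) (use avoid in blast)+
  next
    fix j assume j: "j < N"
    have range: "\<sigma> j \<in> {0..t}" "\<sigma> (Suc j) \<in> {0..t}"
      using \<sigma>(5) j unfolding image_subset_iff by simp_all
    show "\<sigma> (Suc j) - \<sigma> j \<le> 1 / real (Suc m)"
    proof (rule ccontr)
      assume "\<not> ?thesis"
      then have gap: "\<sigma> j + 1 / h < \<sigma> (Suc j)" by (simp add: h_def)
      \<comment> \<open>The first grid index strictly to the right of \<open>\<sigma> j\<close>;
        floor plus one, so strictly to the right also when \<open>\<sigma> j\<close> is itself a
        grid point.\<close>
      define i where "i = nat (\<lfloor>\<sigma> j * h\<rfloor> + 1)"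
      have "0 \<le> \<lfloor>\<sigma> j * h\<rfloor>" using range h by simp
      then have "real i = of_int \<lfloor>\<sigma> j * h\<rfloor> + 1" by (simp add: i_def)
      then have i: "\<sigma> j * h < real i" "real i \<le> \<sigma> j * h + 1"
        by linarith+
      have lo: "\<sigma> j < real i / h" using i(1) h by (simp add: field_simps)
      have "real i / h \<le> \<sigma> j + 1 / h" using i(2) h by (simp add: field_simps)
      then have hi: "real i / h < \<sigma> (Suc j)" using gap by linarith
      have "real i / h \<le> t" using hi range by simp
      then have "real i \<le> t * h" using h by (simp add: field_simps)
      then have "i \<le> nat \<lceil>t * h\<rceil>" by linarith
      then have "real i / h \<in> grid" using h \<open>real i / h \<le> t\<close> by (auto simp: grid_def)
      then show False using avoid[of "real i / h" j] j lo hi by simp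
    qed
  qed
qed

text \<open>Switching the integrand off at the cutoff keeps the mean equal to 1 and bounds the
  quadratic variation by \<open>4 * C\<^sup>2 * \<eta>\<close>. The index \<open>j\<close> exhibits
  the result as the original discrete exponential stopped on each path, so that path estimates apply
  to it.\<close>

lemma truncated_exponential:
  assumes \<sigma>: "strict_mono_on {..N} \<sigma>" "\<sigma> 0 = 0" "\<sigma> ` {..N} \<subseteq> {0..t}"
    and avoid: "\<And>i j. i \<le> n k \<Longrightarrow> j < N \<Longrightarrow> \<tau> k i \<notin> {\<sigma> j<..<\<sigma> (Suc j)}"
    and f: "\<And>s. s \<in> {0..t} \<Longrightarrow> \<bar>f s\<bar> \<le> C" and "0 \<le> \<eta>"
  shows "\<exists>Z. Z \<in> borel_measurable M \<and> (\<forall>\<omega>. 0 \<le> Z \<omega>) \<and> (\<integral>\<^sup>+\<omega>. ennreal (Z \<omega>) \<partial>M) = 1 \<and>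
    (\<integral>\<^sup>+\<omega>. ennreal ((Z \<omega>)\<^sup>2) \<partial>M) \<le> ennreal (exp (4 * C\<^sup>2 * \<eta>)) \<and>
    (\<forall>\<omega>. \<exists>j\<le>N. Z \<omega> = exp (discrete_exponent f (\<lambda>s. J k s \<omega>) (\<lambda>i. R k (\<sigma> i) \<omega>) \<sigma> j) \<and>
      ((\<Sum>i<N. (R k (\<sigma> i) \<omega>)\<^sup>2 * (\<sigma> (Suc i) - \<sigma> i)) \<le> \<eta> \<longrightarrow> j = N))"
proof -
  \<comment> \<open>The condition includes the current interval, and yet it is known at
    \<open>\<sigma> i\<close>, because \<open>R\<close> gives the value to the right of a point.
    Thus the level is never overshot.\<close>
  define q where "q i \<omega> = (if (\<Sum>l<Suc i. (R k (\<sigma> l) \<omega>)\<^sup>2 * (\<sigma> (Suc l) - \<sigma> l)) \<le> \<eta>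
    then - 2 * f (\<sigma> i) * R k (\<sigma> i) \<omega> else 0)" for i \<omega>
  define L where "L \<omega> = (\<Sum>i<N. q i \<omega> * (B (\<sigma> (Suc i)) \<omega> - B (\<sigma> i) \<omega>))" for \<omega>
  define Q where "Q \<omega> = (\<Sum>i<N. (q i \<omega>)\<^sup>2 * (\<sigma> (Suc i) - \<sigma> i))" for \<omega>
  define Z where "Z \<omega> = exp (L \<omega> - Q \<omega> / 2)" for \<omega>
  have \<sigma>0: "0 \<le> \<sigma> 0" using \<sigma>(2) by simp
  have le: "\<sigma> i \<le> \<sigma> j" if "i \<le> j" "j \<le> N" for i j
    using \<sigma>(1) that by (cases "i = j") (auto simp: strict_mono_on_def less_imp_le)
  have inc: "0 \<le> \<sigma> (Suc i) - \<sigma> i" if "i < N" for i using le[of i "Suc i"] that by simp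
  have range: "\<sigma> i \<in> {0..t}" if "i \<le> N" for i using \<sigma>(3) that by auto
  have q_meas: "q i \<in> borel_measurable (F (\<sigma> i))" if "i < N" for i
  proof -
    have [measurable]: "R k (\<sigma> l) \<in> borel_measurable (F (\<sigma> i))" if "l < Suc i" for l
      using F_measurable_mono[OF _ simple_right_measurable[OF simple]] le[of l i] that \<open>i < N\<close> by simp
    have [measurable]: "(\<lambda>\<omega>. \<Sum>l<Suc i. (R k (\<sigma> l) \<omega>)\<^sup>2 * (\<sigma> (Suc l) - \<sigma> l)) \<in> borel_measurable (F (\<sigma> i))"
      by (intro borel_measurable_sum borel_measurable_times borel_measurable_power) auto
    show ?thesis unfolding q_def[abs_def] by measurable
  qed
  have [measurable]: "L \<in> borel_measurable M" "Q \<in> borel_measurable M"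
    using measurable_sum_increments[where q = q, OF \<sigma>0 \<sigma>(1) le_refl q_meas] F_measurable_M
    unfolding L_def[abs_def] Q_def[abs_def] by blast+
  have Z_meas: "Z \<in> borel_measurable M" unfolding Z_def[abs_def] by measurable
  have mean: "(\<integral>\<^sup>+\<omega>. ennreal (Z \<omega>) \<partial>M) = 1"
    unfolding Z_def L_def Q_def by (rule nn_integral_exp_martingale[OF \<sigma>0 \<sigma>(1) q_meas])
  have stop: "\<exists>j\<le>N. L \<omega> - Q \<omega> / 2 = discrete_exponent f (\<lambda>s. J k s \<omega>) (\<lambda>i. R k (\<sigma> i) \<omega>) \<sigma> j \<and>
      ((\<Sum>i<N. (R k (\<sigma> i) \<omega>)\<^sup>2 * (\<sigma> (Suc i) - \<sigma> i)) \<le> \<eta> \<longrightarrow> j = N) \<and> Q \<omega> \<le> 4 * C\<^sup>2 * \<eta>" for \<omega>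
  proof -
    let ?a = "\<lambda>i. (R k (\<sigma> i) \<omega>)\<^sup>2 * (\<sigma> (Suc i) - \<sigma> i)"
    have a: "0 \<le> ?a i" if "i < N" for i using inc[OF that] by simp
    obtain j where j: "j \<le> N" "\<And>i. i < N \<Longrightarrow> (\<Sum>l<Suc i. ?a l) \<le> \<eta> \<longleftrightarrow> i < j"
      "(\<Sum>i<j. ?a i) \<le> \<eta>" "(\<Sum>i<N. ?a i) \<le> \<eta> \<Longrightarrow> j = N"
      using cutoff_index[of N ?a \<eta>] a \<open>0 \<le> \<eta>\<close> by blast
    have q: "q i \<omega> = (if i < j then - 2 * f (\<sigma> i) * R k (\<sigma> i) \<omega> else 0)" if "i < N" for i
      using j(2)[OF that] by (simp add: q_def)
    have cut: "(\<Sum>i<N. if i < j then h i else 0) = (\<Sum>i<j. h i)" for h :: "nat \<Rightarrow> real"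
      using j(1) by (subst sum.inter_filter[symmetric]) (auto intro!: sum.cong)
    have J: "J k (\<sigma> (Suc i)) \<omega> - J k (\<sigma> i) \<omega> = R k (\<sigma> i) \<omega> * (B (\<sigma> (Suc i)) \<omega> - B (\<sigma> i) \<omega>)" if "i < N" for i
      using simple_integral_partition[OF simple \<sigma>(2,1) avoid, where m = i and \<omega> = \<omega> and B = B]
        simple_integral_partition[OF simple \<sigma>(2,1) avoid, where m = "Suc i" and \<omega> = \<omega> and B = B] that by simp
    have "L \<omega> = (\<Sum>i<N. if i < j then - 2 * f (\<sigma> i) * (J k (\<sigma> (Suc i)) \<omega> - J k (\<sigma> i) \<omega>) else 0)"
      unfolding L_def by (intro sum.cong) (auto simp: q J)
    moreover have Q: "Q \<omega> = (\<Sum>i<N. if i < j then 4 * (f (\<sigma> i))\<^sup>2 * ?a i else 0)"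
      unfolding Q_def by (intro sum.cong) (auto simp: q power_mult_distrib)
    ultimately have "L \<omega> - Q \<omega> / 2 = discrete_exponent f (\<lambda>s. J k s \<omega>) (\<lambda>i. R k (\<sigma> i) \<omega>) \<sigma> j"
      unfolding discrete_exponent_def cut by (simp add: sum_divide_distrib mult_ac)
    moreover have "Q \<omega> \<le> 4 * C\<^sup>2 * \<eta>"
    proof -
      have "Q \<omega> \<le> (\<Sum>i<j. 4 * C\<^sup>2 * ?a i)"
        unfolding Q cut
      proof (rule sum_mono)
        fix i assume "i \<in> {..<j}"
        then have i: "i < N" using j(1) by simp
        have "(f (\<sigma> i))\<^sup>2 \<le> C\<^sup>2"
          using power_mono[OF f[OF range[of i]], of 2] i by simp
        then show "4 * (f (\<sigma> i))\<^sup>2 * ?a i \<le> 4 * C\<^sup>2 * ?a i"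
          using a[OF i] by (intro mult_right_mono) auto
      qed
      also have "\<dots> \<le> 4 * C\<^sup>2 * \<eta>"
        unfolding sum_distrib_left[symmetric] using j(3) by (intro mult_left_mono) auto
      finally show ?thesis .
    qed
    ultimately show ?thesis using j(1,4) by blast
  qed
  have "(\<integral>\<^sup>+\<omega>. ennreal ((Z \<omega>)\<^sup>2) \<partial>M)
      \<le> (\<integral>\<^sup>+\<omega>. ennreal (exp (4 * C\<^sup>2 * \<eta>)) * ennreal (exp (2 * L \<omega> - 4 * Q \<omega> / 2)) \<partial>M)"
  proof (rule nn_integral_mono)
    fix \<omega>
    \<comment> \<open>Doubling the integrand multiplies its quadratic variation by 4; completing
      \<open>2 * L - Q\<close> to the exponent for \<open>2 * q\<close>, again of mean 1, leaves the
      bounded factor \<open>exp Q\<close>.\<close>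
    have "(Z \<omega>)\<^sup>2 = exp (Q \<omega>) * exp (2 * L \<omega> - 4 * Q \<omega> / 2)"
      unfolding Z_def exp_add[symmetric] exp_double[symmetric] by (simp add: algebra_simps)
    also have "\<dots> \<le> exp (4 * C\<^sup>2 * \<eta>) * exp (2 * L \<omega> - 4 * Q \<omega> / 2)"
      using stop[of \<omega>] by (intro mult_right_mono) auto
    finally show "ennreal ((Z \<omega>)\<^sup>2) \<le> ennreal (exp (4 * C\<^sup>2 * \<eta>)) * ennreal (exp (2 * L \<omega> - 4 * Q \<omega> / 2))"
      by (simp add: ennreal_mult'[symmetric] ennreal_leI)
  qed
  also have "\<dots> = ennreal (exp (4 * C\<^sup>2 * \<eta>)) * (\<integral>\<^sup>+\<omega>. ennreal (exp (2 * L \<omega> - 4 * Q \<omega> / 2)) \<partial>M)"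
    by (rule nn_integral_cmult) measurable
  also have "(\<integral>\<^sup>+\<omega>. ennreal (exp (2 * L \<omega> - 4 * Q \<omega> / 2)) \<partial>M) = 1"
    using nn_integral_exp_martingale[OF \<sigma>0 \<sigma>(1), of "\<lambda>i \<omega>. 2 * q i \<omega>"] q_meas
    by (simp add: L_def Q_def sum_distrib_left mult_ac power_mult_distrib)
  finally have "(\<integral>\<^sup>+\<omega>. ennreal ((Z \<omega>)\<^sup>2) \<partial>M) \<le> ennreal (exp (4 * C\<^sup>2 * \<eta>))" by simp
  moreover have "\<exists>j\<le>N. Z \<omega> = exp (discrete_exponent f (\<lambda>s. J k s \<omega>) (\<lambda>i. R k (\<sigma> i) \<omega>) \<sigma> j) \<and>
      ((\<Sum>i<N. (R k (\<sigma> i) \<omega>)\<^sup>2 * (\<sigma> (Suc i) - \<sigma> i)) \<le> \<eta> \<longrightarrow> j = N)" for \<omega>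
  proof -
    obtain j where j: "j \<le> N" "L \<omega> - Q \<omega> / 2 = discrete_exponent f (\<lambda>s. J k s \<omega>) (\<lambda>i. R k (\<sigma> i) \<omega>) \<sigma> j"
      "(\<Sum>i<N. (R k (\<sigma> i) \<omega>)\<^sup>2 * (\<sigma> (Suc i) - \<sigma> i)) \<le> \<eta> \<longrightarrow> j = N"
      using stop[of \<omega>] by blast
    then show ?thesis unfolding Z_def by (intro exI[of _ j] conjI) (simp_all only: j(2))
  qed
  ultimately show ?thesis
    using Z_meas mean by (intro exI[of _ Z]) (auto simp: Z_def)
qed

end

section \<open>Tails, measurability of the time integral, upper bound of the exponent\<close>

lemma (in prob_space) prob_ge_tendsto_0:
  assumes [measurable]: "Y \<in> borel_measurable M"
  shows "(\<lambda>m. prob {\<omega> \<in> space M. real m \<le> Y \<omega>}) \<longlonglongrightarrow> 0"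
proof -
  have "(\<lambda>m. prob {\<omega> \<in> space M. real m \<le> Y \<omega>}) \<longlonglongrightarrow> prob (\<Inter>m. {\<omega> \<in> space M. real m \<le> Y \<omega>})"
    by (rule finite_Lim_measure_decseq) (auto simp: decseq_def intro: order_trans[rotated])
  moreover have "(\<Inter>m. {\<omega> \<in> space M. real m \<le> Y \<omega>}) = {}"
  proof -
    have "\<exists>m. \<not> real m \<le> Y \<omega>" for \<omega>
      using reals_Archimedean2[of "Y \<omega>"] by (auto simp: not_le)
    then show ?thesis by blast
  qed
  ultimately show ?thesis by simp
qed

text \<open>Joint measurability comes from the progressive measurability of \<open>sqrt X\<close>,
  with time clamped to \<open>{0..t}\<close>; then Fubini applies.\<close>

lemma (in brownian_motion) borel_measurable_time_integral:
  assumes "ito_integrand M F (\<lambda>s \<omega>. sqrt (X s \<omega>))" "0 \<le> t"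
  shows "(\<lambda>\<omega>. LBINT s:{0..t}. X s \<omega>) \<in> borel_measurable M"
proof -
  let ?c = "\<lambda>s. max 0 (min t s)"
  have [measurable]: "(\<lambda>(s, \<omega>). sqrt (X s \<omega>)) \<in> borel_measurable (restrict_space borel {0..t} \<Otimes>\<^sub>M F t)"
    using assms by (simp add: ito_integrand_def)
  have [measurable]: "(\<lambda>\<omega>. \<omega>) \<in> measurable M (F t)"
    by (rule F_measurable_M[of _ t]) simp
  have [measurable]: "?c \<in> measurable lborel (restrict_space borel {0..t})"
    using assms(2) by (intro measurable_restrict_space2) auto
  have [measurable]: "(\<lambda>p. (?c (snd p), fst p)) \<in> measurable (M \<Otimes>\<^sub>M lborel) (restrict_space borel {0..t} \<Otimes>\<^sub>M F t)"
    by measurable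
  have meas: "(\<lambda>p. sqrt (X (?c (snd p)) (fst p))) \<in> borel_measurable (M \<Otimes>\<^sub>M lborel)"
    using measurable_compose[OF \<open>(\<lambda>p. (?c (snd p), fst p)) \<in> _\<close> \<open>(\<lambda>(s, \<omega>). sqrt (X s \<omega>)) \<in> _\<close>] by simp
  have [measurable]: "(\<lambda>(\<omega>, s). indicator {0..t} s *\<^sub>R (sqrt (X (?c s) \<omega>) * \<bar>sqrt (X (?c s) \<omega>)\<bar>)) \<in> borel_measurable (M \<Otimes>\<^sub>M lborel)"
    using meas by (simp add: case_prod_beta')
  have "(LBINT s:{0..t}. X s \<omega>) = (\<integral>s. indicator {0..t} s *\<^sub>R (sqrt (X (?c s) \<omega>) * \<bar>sqrt (X (?c s) \<omega>)\<bar>) \<partial>lborel)" for \<omega>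
    unfolding set_lebesgue_integral_def
  proof (rule Bochner_Integration.integral_cong)
    fix s
    \<comment> \<open>Recovers \<open>X\<close> from its root for either sign, as
      \<open>sqrt\<close> is odd.\<close>
    have "sqrt y * \<bar>sqrt y\<bar> = y" for y :: real
      by (cases "0 \<le> y") (auto simp: abs_if)
    then show "indicator {0..t} s *\<^sub>R X s \<omega> = indicator {0..t} s *\<^sub>R (sqrt (X (?c s) \<omega>) * \<bar>sqrt (X (?c s) \<omega>)\<bar>)"
      by (auto simp: indicator_def)
  qed simp
  then show ?thesis by (simp add: lborel.borel_measurable_lebesgue_integral)
qed

lemma (in riccati_path) V_le:
  assumes "0 \<le> \<gamma>" "\<And>s. s \<in> {0..t} \<Longrightarrow> 0 \<le> f s" "\<And>s. s \<in> {0..t} \<Longrightarrow> \<bar>g s\<bar> \<le> c" "s \<in> {0..t}"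
  shows "V s \<le> c"
proof -
  have "X integrable_on {0..s}"
    using assms(4) by (intro integrable_continuous_real continuous_on_subset[OF X_cont]) auto
  then have "0 \<le> integral {0..s} X"
    using assms(4) X_nonneg by (intro integral_nonneg) auto
  then have "0 \<le> \<gamma> * integral {0..s} X" "0 \<le> f s * X s"
    using assms X_nonneg by auto
  then show ?thesis using assms(3)[OF assms(4)] by (simp add: V_def)
qed

section \<open>The Laplace transform\<close>

theorem proposition3p17:
  fixes M :: "'a measure" and F :: "real \<Rightarrow> 'a measure" and B X :: "real \<Rightarrow> 'a \<Rightarrow> real"
    and \<delta> \<alpha> x l \<gamma> t :: real
  assumes "brownian_motion M F B"
    and "\<delta> \<ge> 0" and "x \<ge> 0"
    and "squared_radial_OU M F B \<delta> \<alpha> x X"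
    and "l \<ge> 0" and "\<gamma> > 0" and "t \<ge> 0"
  shows "prob_space.expectation M
           (\<lambda>\<omega>. exp (- l * X t \<omega> - \<gamma> * (LBINT u:{0..t}. X u \<omega>))) =
         exp (- x * OU_phi \<alpha> \<gamma> t l - OU_psi \<delta> \<alpha> \<gamma> t l)"
proof -
  interpret brownian_motion M F B by fact
  have X_adapted: "\<And>s. 0 \<le> s \<Longrightarrow> X s \<in> borel_measurable (F s)"
    and X_cont: "\<And>\<omega>. \<omega> \<in> space M \<Longrightarrow> continuous_on {0..} (\<lambda>s. X s \<omega>)"
    and X_nonneg: "AE \<omega> in M. \<forall>s\<ge>0. 0 \<le> X s \<omega>"
    using assms(4) unfolding squared_radial_OU_def by blast+
  obtain I where ito: "is_ito_integral M F B (\<lambda>s \<omega>. sqrt (X s \<omega>)) I"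
    and sde: "AE \<omega> in M. \<forall>s\<ge>0. X s \<omega> = x + 2 * I s \<omega> + (LBINT r:{0..s}. \<delta> - 2 * \<alpha> * X r \<omega>)"
    using assms(4) unfolding squared_radial_OU_def by blast
  obtain n \<tau> \<xi> where approx: "\<And>k. simple_integrand M F (n k) (\<tau> k) (\<xi> k)"
    "\<And>s. 0 \<le> s \<Longrightarrow> tendsto_in_probability M
       (\<lambda>k \<omega>. LBINT r:{0..s}. (simple_process (n k) (\<tau> k) (\<xi> k) r \<omega> - sqrt (X r \<omega>))\<^sup>2) (\<lambda>\<omega>. 0)"
    "\<And>s. 0 \<le> s \<Longrightarrow> tendsto_in_probability M
       (\<lambda>k. simple_integral B (n k) (\<tau> k) (\<xi> k) s) (I s)"
    using ito unfolding is_ito_integral_def by blast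
  have X_cont_t: "continuous_on {0..s} (\<lambda>s. X s \<omega>)" if "\<omega> \<in> space M" for \<omega> s
    using X_cont[OF that] by (rule continuous_on_subset) auto
  interpret ito_approximation M F B "\<lambda>s \<omega>. sqrt (X s \<omega>)" I n \<tau> \<xi> t
    by unfold_locales (use approx assms(7) X_cont_t in \<open>auto intro!: continuous_intros\<close>)
  have LBINT_eq: "(LBINT s:{0..u}. h s) = integral {0..u} h" if "continuous_on {0..u} h" for h :: "real \<Rightarrow> real" and u
    by (rule set_borel_integral_eq_integral(2)[OF borel_integrable_atLeastAtMost'[OF that]])

  \<comment> \<open>The solution runs backwards from the horizon: \<open>f t = l\<close> and
    \<open>g t = 0\<close> produce the exponent under the expectation, \<open>f 0\<close> and
    \<open>g 0\<close> the exponent of the claimed value.\<close>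
  define f where "f s = OU_phi \<alpha> \<gamma> (t - s) l" for s
  define g where "g s = OU_psi \<delta> \<alpha> \<gamma> (t - s) l" for s
  have path: "AE \<omega> in M. riccati_path f g (\<lambda>s. X s \<omega>) (\<lambda>s. I s \<omega>) \<alpha> \<gamma> \<delta> x t"
    using X_nonneg sde AE_space
  proof eventually_elim
    case (elim \<omega>)
    show ?case
    proof
      fix s assume s: "s \<in> {0..t}"
      show "(f has_real_derivative 2 * (f s)\<^sup>2 + 2 * \<alpha> * f s - \<gamma>) (at s within {0..t})"
        "(g has_real_derivative - (\<delta> * f s)) (at s within {0..t})"
        using OU_reversed_derivs[OF assms(6,5) s] unfolding f_def[abs_def] g_def[abs_def] by auto
      show "0 \<le> X s \<omega>" using elim(1) s by simp
      have "continuous_on {0..s} (\<lambda>r. \<delta> - 2 * \<alpha> * X r \<omega>)"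
        by (intro continuous_intros X_cont_t elim(3))
      then show "X s \<omega> = x + 2 * I s \<omega> + integral {0..s} (\<lambda>r. \<delta> - 2 * \<alpha> * X r \<omega>)"
        using elim(2) s LBINT_eq by simp
    qed (rule X_cont_t[OF elim(3)])
  qed
  have fg_cont: "continuous_on {0..t} f" "continuous_on {0..t} g"
    unfolding f_def[abs_def] g_def[abs_def]
    by (rule DERIV_continuous_on, rule OU_reversed_derivs[OF assms(6,5)], assumption)+
  have bdd: "\<exists>c. \<forall>s\<in>{0..t}. \<bar>h s\<bar> \<le> c" if "continuous_on {0..t} h" for h :: "real \<Rightarrow> real"
    using compact_imp_bounded[OF compact_continuous_image[OF that compact_Icc]]
    unfolding bounded_iff by simp
  obtain C where C: "\<And>s. s \<in> {0..t} \<Longrightarrow> \<bar>f s\<bar> \<le> C"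
    using bdd[OF fg_cont(1)] by blast
  obtain c where c: "\<And>s. s \<in> {0..t} \<Longrightarrow> \<bar>g s\<bar> \<le> c"
    using bdd[OF fg_cont(2)] by blast
  have f_nonneg: "0 \<le> f s" if "s \<in> {0..t}" for s
    using that OU_phi_nonneg[OF assms(6,5)] by (simp add: f_def)

  \<comment> \<open>Partition \<open>k\<close> resolves the knots of the simple process
    \<open>k\<close>, and its mesh tends to 0.\<close>
  have "\<forall>k. \<exists>N \<sigma>. strict_mono_on {..N} \<sigma> \<and> \<sigma> 0 = 0 \<and> \<sigma> N = t \<and> \<sigma> ` {..N} \<subseteq> {0..t} \<and>
      (\<forall>i j. i \<le> n k \<longrightarrow> j < N \<longrightarrow> \<tau> k i \<notin> {\<sigma> j<..<\<sigma> (Suc j)}) \<and>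
      (\<forall>j<N. \<sigma> (Suc j) - \<sigma> j \<le> 1 / real (Suc k))" (is "\<forall>k. ?P k")
  proof
    show "?P k" for k
      by (rule fine_partition[of k k], intro exI conjI, assumption+, blast, blast)
  qed
  from choice[OF this] obtain N where "\<forall>k. \<exists>\<sigma>. strict_mono_on {..N k} \<sigma> \<and> \<sigma> 0 = 0 \<and> \<sigma> (N k) = t \<and> \<sigma> ` {..N k} \<subseteq> {0..t} \<and>
      (\<forall>i j. i \<le> n k \<longrightarrow> j < N k \<longrightarrow> \<tau> k i \<notin> {\<sigma> j<..<\<sigma> (Suc j)}) \<and>
      (\<forall>j<N k. \<sigma> (Suc j) - \<sigma> j \<le> 1 / real (Suc k))" ..
  from choice[OF this] obtain \<sigma> where
    "\<forall>k. strict_mono_on {..N k} (\<sigma> k) \<and> \<sigma> k 0 = 0 \<and> \<sigma> k (N k) = t \<and> \<sigma> k ` {..N k} \<subseteq> {0..t} \<and>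
      (\<forall>i j. i \<le> n k \<longrightarrow> j < N k \<longrightarrow> \<tau> k i \<notin> {\<sigma> k j<..<\<sigma> k (Suc j)}) \<and>
      (\<forall>j<N k. \<sigma> k (Suc j) - \<sigma> k j \<le> 1 / real (Suc k))" ..
  then have \<sigma>: "\<And>k. strict_mono_on {..N k} (\<sigma> k)" "\<And>k. \<sigma> k 0 = 0" "\<And>k. \<sigma> k (N k) = t"
      "\<And>k. \<sigma> k ` {..N k} \<subseteq> {0..t}"
    and avoid: "\<And>k i j. i \<le> n k \<Longrightarrow> j < N k \<Longrightarrow> \<tau> k i \<notin> {\<sigma> k j<..<\<sigma> k (Suc j)}"
    and mesh: "\<And>k j. j < N k \<Longrightarrow> \<sigma> k (Suc j) - \<sigma> k j \<le> 1 / real (Suc k)"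
    by blast+
  let ?T = "\<lambda>k. \<sigma> k ` {..N k}"
  let ?E = "\<lambda>k \<omega>. Max ((\<lambda>s. \<bar>J k s \<omega> - I s \<omega>\<bar>) ` ?T k)"
  \<comment> \<open>The error is maximised over the points of the \<open>k\<close>-th partition
    itself, which varies with \<open>k\<close>.\<close>
  obtain r where r: "strict_mono r" "AE \<omega> in M. (\<lambda>k. ?E (r k) \<omega>) \<longlonglongrightarrow> 0"
    "AE \<omega> in M. (\<lambda>k. err (r k) \<omega>) \<longlonglongrightarrow> 0"
    by (rule AE_subseq_simple_integral_error[of ?T]) (use \<sigma>(4) in auto)
  have mesh0: "(\<lambda>k. 1 / real (Suc (r k))) \<longlonglongrightarrow> 0"
    using LIMSEQ_subseq_LIMSEQ[OF LIMSEQ_inverse_real_of_nat r(1)] by (simp add: comp_def inverse_eq_divide)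

  define W where "W \<omega> s = - f s * X s \<omega> - g s - \<gamma> * integral {0..s} (\<lambda>s. X s \<omega>)" for \<omega> s
  \<comment> \<open>The variable of the claim divided by its claimed mean, so that the goal becomes
    mean 1; almost surely it equals \<open>exp (W t - W 0)\<close>.\<close>
  define Y where "Y \<omega> = exp (- l * X t \<omega> - \<gamma> * (LBINT u:{0..t}. X u \<omega>)) * exp (x * f 0 + g 0)" for \<omega>
  define A where "A \<omega> = (LBINT u:{0..t}. X u \<omega>)" for \<omega>
  \<comment> \<open>Bounds \<open>exp (W s - W 0)\<close> for all \<open>s\<close>; the extra 1
    absorbs the discretisation error. The cutoff level does not enter.\<close>
  define c' where "c' = exp (c + x * f 0 + g 0 + 1)"
  have A_meas [measurable]: "A \<in> borel_measurable M"
    using borel_measurable_time_integral[of X t] ito assms(7)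
    unfolding A_def[abs_def] is_ito_integral_def by blast
  have [measurable]: "X t \<in> borel_measurable M"
    using F_measurable_M[OF X_adapted[OF assms(7)]] .
  have Y_meas [measurable]: "Y \<in> borel_measurable M"
    unfolding Y_def[abs_def] A_def[symmetric] by measurable
  define QV where "QV k \<omega> = (\<Sum>i<N k. (R k (\<sigma> k i) \<omega>)\<^sup>2 * (\<sigma> k (Suc i) - \<sigma> k i))" for k \<omega>
  define dexp where "dexp k \<omega> = discrete_exponent f (\<lambda>s. J k s \<omega>) (\<lambda>i. R k (\<sigma> k i) \<omega>) (\<sigma> k)" for k \<omega>

  have good: "AE \<omega> in M. (\<forall>\<epsilon>>0. \<forall>\<^sub>F k in sequentially. \<forall>m\<le>N (r k).
        \<bar>W \<omega> (\<sigma> (r k) m) - W \<omega> 0 - dexp (r k) \<omega> m\<bar> \<le> \<epsilon>) \<and>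
      (\<lambda>k. QV (r k) \<omega>) \<longlonglongrightarrow> A \<omega> \<and> (\<forall>s\<in>{0..t}. W \<omega> s \<le> c) \<and>
      - W \<omega> 0 = x * f 0 + g 0 \<and> exp (W \<omega> t - W \<omega> 0) = Y \<omega>"
    using path r(2,3) AE_space
  proof eventually_elim
    case (elim \<omega>)
    interpret riccati_path f g "\<lambda>s. X s \<omega>" "\<lambda>s. I s \<omega>" \<alpha> \<gamma> \<delta> x t by (rule elim(1))
    have W: "W \<omega> = V" by (simp add: W_def V_def fun_eq_iff)
    have A_eq: "A \<omega> = integral {0..t} (\<lambda>s. X s \<omega>)"
      unfolding A_def by (rule LBINT_eq) (rule X_cont_t[OF elim(4)])
    have E: "\<bar>J k (\<sigma> k i) \<omega> - I (\<sigma> k i) \<omega>\<bar> \<le> ?E k \<omega>" if "i \<le> N k" for i k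
      using that by (intro Max_ge) auto
    have err_int: "((\<lambda>s. (K k s \<omega> - sqrt (X s \<omega>))\<^sup>2) has_integral err k \<omega>) {0..t}" for k
      using err_integral[OF elim(4), of k] by (simp add: has_integral_iff)
    have K_eq: "K k s \<omega> = R k (\<sigma> k i) \<omega>" if "i < N k" "\<sigma> k i < s" "s \<le> \<sigma> k (Suc i)" for k i s
      using avoid[of _ k] that by (intro K_partition[where N = "N k"])
    note limits = discrete_exponent_limit[where \<sigma> = "\<lambda>k. \<sigma> (r k)" and N = "\<lambda>k. N (r k)"
      and S = "\<lambda>k s. J (r k) s \<omega>" and K = "\<lambda>k s. K (r k) s \<omega>" and \<kappa> = "\<lambda>k i. R (r k) (\<sigma> (r k) i) \<omega>"
      and E = "\<lambda>k. ?E (r k) \<omega>" and e = "\<lambda>k. err (r k) \<omega>" and d = "\<lambda>k. 1 / real (Suc (r k))",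
      OF \<sigma>(1,2,3) mesh mesh0 E elim(2) K_eq err_int elim(3)]
    \<comment> \<open>The initial value of \<open>I\<close> is found on the path: 0 is a partition
      point, the simple integrals vanish there, and the maximal error tends to 0. Then the equation
      at time 0 gives the starting point \<open>x\<close>.\<close>
    have "J k 0 \<omega> = 0" for k
      using simple_integral_partition[OF simple \<sigma>(2,1) avoid, where m = 0 and \<omega> = \<omega> and B = B] \<sigma>(2) by simp
    then have "\<bar>I 0 \<omega>\<bar> \<le> ?E (r k) \<omega>" for k
      using E[of 0 "r k"] \<sigma>(2) by simp
    then have "I 0 \<omega> = 0"
      using LIMSEQ_le_const[OF elim(2), of "\<bar>I 0 \<omega>\<bar>"] by auto
    then have "X 0 \<omega> = x"
      using sde[of 0] assms(7) by simp
    then have W0: "- W \<omega> 0 = x * f 0 + g 0" by (simp add: W_def mult.commute)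
    moreover have "exp (W \<omega> t - W \<omega> 0) = Y \<omega>"
    proof -
      have "f t = l" "g t = 0" using OU_phi_0[OF assms(6)] by (simp_all add: f_def g_def OU_psi_0)
      then have "W \<omega> t = - l * X t \<omega> - \<gamma> * A \<omega>" by (simp add: W_def A_eq)
      then show ?thesis
        using W0 unfolding Y_def A_def[symmetric] exp_add[symmetric] by (simp add: algebra_simps)
    qed
    moreover have "\<forall>s\<in>{0..t}. W \<omega> s \<le> c"
      unfolding W using f_nonneg c assms(6) by (intro ballI V_le) auto
    ultimately show ?case
      using limits unfolding W A_eq QV_def dexp_def by blast
  qed

  \<comment> \<open>The exponentials are cut off at level \<open>m\<close>. On the event
    \<open>A < m\<close> the cutoff is eventually inactive and the limit is \<open>Y\<close>; the
    complementary event costs at most \<open>c'\<close> times its probability.\<close>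
  have bound: "\<bar>1 - expectation Y\<bar> \<le> c' * prob {\<omega> \<in> space M. real m \<le> A \<omega>}" for m
  proof -
    have "\<forall>k. \<exists>Z. Z \<in> borel_measurable M \<and> (\<forall>\<omega>. 0 \<le> Z \<omega>) \<and> (\<integral>\<^sup>+\<omega>. ennreal (Z \<omega>) \<partial>M) = 1 \<and>
      (\<integral>\<^sup>+\<omega>. ennreal ((Z \<omega>)\<^sup>2) \<partial>M) \<le> ennreal (exp (4 * C\<^sup>2 * real m)) \<and>
      (\<forall>\<omega>. \<exists>j\<le>N (r k). Z \<omega> = exp (dexp (r k) \<omega> j) \<and> (QV (r k) \<omega> \<le> real m \<longrightarrow> j = N (r k)))"
      unfolding dexp_def QV_def by (intro allI truncated_exponential \<sigma> avoid C) auto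
    from choice[OF this] obtain Z where Z: "\<And>k. Z k \<in> borel_measurable M" "\<And>k \<omega>. 0 \<le> Z k \<omega>"
      "\<And>k. (\<integral>\<^sup>+\<omega>. ennreal (Z k \<omega>) \<partial>M) = 1"
      "\<And>k. (\<integral>\<^sup>+\<omega>. ennreal ((Z k \<omega>)\<^sup>2) \<partial>M) \<le> ennreal (exp (4 * C\<^sup>2 * real m))"
      and Z_exp: "\<And>k \<omega>. \<exists>j\<le>N (r k). Z k \<omega> = exp (dexp (r k) \<omega> j) \<and> (QV (r k) \<omega> \<le> real m \<longrightarrow> j = N (r k))"
      by blast
    have "\<bar>1 - expectation Y\<bar> \<le> c' * prob (space M - {\<omega> \<in> space M. A \<omega> < real m})"
    proof (rule expectation_limit_bound[OF Z])
      show "AE \<omega> in M. \<forall>\<^sub>F k in sequentially. Z k \<omega> \<le> c'"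
        using good
      proof eventually_elim
        case (elim \<omega>)
        then have W_facts: "\<forall>s\<in>{0..t}. W \<omega> s \<le> c" "- W \<omega> 0 = x * f 0 + g 0" by blast+
        \<comment> \<open>The stopping index depends on \<open>k\<close> and the path, which is why
          the estimate has to hold for all \<open>j\<close> simultaneously.\<close>
        have "\<forall>\<^sub>F k in sequentially. \<forall>j\<le>N (r k). \<bar>W \<omega> (\<sigma> (r k) j) - W \<omega> 0 - dexp (r k) \<omega> j\<bar> \<le> 1"
          using elim by simp
        then show ?case
        proof eventually_elim
          case (elim k)
          obtain j where j: "j \<le> N (r k)" "Z k \<omega> = exp (dexp (r k) \<omega> j)" using Z_exp by blast
          have "\<sigma> (r k) j \<in> {0..t}"
            using \<sigma>(4)[of "r k"] j(1) unfolding image_subset_iff by (simp del: atLeastAtMost_iff)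
          then have "W \<omega> (\<sigma> (r k) j) \<le> c" "- W \<omega> 0 = x * f 0 + g 0"
            using W_facts by blast+
          moreover have "\<bar>W \<omega> (\<sigma> (r k) j) - W \<omega> 0 - dexp (r k) \<omega> j\<bar> \<le> 1" using elim j(1) by blast
          ultimately have "dexp (r k) \<omega> j \<le> c + x * f 0 + g 0 + 1" by linarith
          then show ?case unfolding j(2) c'_def by simp
        qed
      qed
      show "AE \<omega> in M. 0 \<le> Y \<omega> \<and> Y \<omega> \<le> c'"
        using good
      proof eventually_elim
        case (elim \<omega>)
        then have "W \<omega> t - W \<omega> 0 \<le> c + x * f 0 + g 0 + 1"
          using assms(7) by (auto dest!: bspec[of _ _ t])
        then have "exp (W \<omega> t - W \<omega> 0) \<le> c'" by (simp add: c'_def)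
        then show ?case using elim by (simp add: Y_def)
      qed
      show "AE \<omega> in M. \<omega> \<in> {\<omega> \<in> space M. A \<omega> < real m} \<longrightarrow> (\<lambda>k. Z k \<omega>) \<longlonglongrightarrow> Y \<omega>"
        using good
      proof eventually_elim
        case (elim \<omega>)
        show ?case
        proof
          assume "\<omega> \<in> {\<omega> \<in> space M. A \<omega> < real m}"
          \<comment> \<open>Strictness of \<open>A \<omega> < real m\<close> is used: the discrete
            quadratic variations converge to \<open>A \<omega>\<close> and so end up below the
            level.\<close>
          then have "\<forall>\<^sub>F k in sequentially. QV (r k) \<omega> < real m"
            using elim by (intro order_tendstoD(2)) auto
          then have Z_eq: "\<forall>\<^sub>F k in sequentially. exp (dexp (r k) \<omega> (N (r k))) = Z k \<omega>"
          proof eventually_elim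
            case (elim k)
            then show ?case using Z_exp[of k \<omega>] by auto
          qed
          have "(\<lambda>k. dexp (r k) \<omega> (N (r k))) \<longlonglongrightarrow> W \<omega> t - W \<omega> 0"
          proof (rule tendstoI)
            fix \<epsilon> :: real assume "0 < \<epsilon>"
            then have "0 < \<epsilon> / 2" by simp
            then have "\<forall>\<^sub>F k in sequentially. \<forall>j\<le>N (r k). \<bar>W \<omega> (\<sigma> (r k) j) - W \<omega> 0 - dexp (r k) \<omega> j\<bar> \<le> \<epsilon> / 2"
              using elim by blast
            then show "\<forall>\<^sub>F k in sequentially. dist (dexp (r k) \<omega> (N (r k))) (W \<omega> t - W \<omega> 0) < \<epsilon>"
            proof eventually_elim
              case (elim k)
              then have "\<bar>W \<omega> t - W \<omega> 0 - dexp (r k) \<omega> (N (r k))\<bar> \<le> \<epsilon> / 2"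
                using \<sigma>(3) by (metis order_refl)
              then show ?case using \<open>0 < \<epsilon>\<close> unfolding dist_real_def by linarith
            qed
          qed
          then have "(\<lambda>k. exp (dexp (r k) \<omega> (N (r k)))) \<longlonglongrightarrow> Y \<omega>"
            using elim tendsto_exp by metis
          then show "(\<lambda>k. Z k \<omega>) \<longlonglongrightarrow> Y \<omega>"
            by (rule Lim_transform_eventually[OF _ Z_eq])
        qed
      qed
    qed (auto simp: c'_def)
    also have "space M - {\<omega> \<in> space M. A \<omega> < real m} = {\<omega> \<in> space M. real m \<le> A \<omega>}"
      by auto
    finally show ?thesis .
  qed
  \<comment> \<open>Removal of the cutoff: \<open>A\<close> is finite and \<open>c'\<close> does not
    depend on \<open>m\<close>.\<close>
  have "(\<lambda>m. c' * prob {\<omega> \<in> space M. real m \<le> A \<omega>}) \<longlonglongrightarrow> c' * 0"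
    by (intro tendsto_intros prob_ge_tendsto_0 A_meas)
  then have "\<bar>1 - expectation Y\<bar> \<le> c' * 0"
    by (rule LIMSEQ_le_const) (use bound in auto)
  then have "expectation (\<lambda>\<omega>. exp (- l * X t \<omega> - \<gamma> * (LBINT u:{0..t}. X u \<omega>))) * exp (x * f 0 + g 0) = 1"
    by (simp add: Y_def[abs_def])
  then have "expectation (\<lambda>\<omega>. exp (- l * X t \<omega> - \<gamma> * (LBINT u:{0..t}. X u \<omega>))) = exp (- (x * f 0 + g 0))"
    unfolding exp_minus by (intro inverse_unique[symmetric]) (simp only: mult.commute)
  then show ?thesis by (simp add: f_def g_def)
qed

end
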